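(* Let $\mathbf{k}$ be a field of characteristic zero, let $S=\mathbb{Z}^n_{\geq 0}$, so that $B=\mathbf{k}[S]=\mathbf{k}[x_1,\dots,x_n]$ is a polynomial ring, and let $I\subset B$ be a full monomial ideal such that $B/I$ is finite-dimensional as a $\mathbf{k}$-vector space. Let $G=\operatorname{Aut}_{\mathbf{k}}(B/I)$ be the group of $\mathbf{k}$-algebra automorphisms of $B/I$. Then the following statements hold: (i) The group $G$ is linear algebraic. (ii) The algebraic torus $T=\operatorname{Spec}\mathbf{k}[\mathbb{Z}^n]$ is a maximal torus of $G$. (iii) The connected component $G^0$ of the identity in $G$ is generated by the maximal torus $T$ and the images in $G^0$ of all the $\mathbb{G}_{\mathrm{a}}$-actions corresponding to homogeneous nilpotent derivations $\partial\colon B/I\to B/I$. (iv) The finite group $G/G^0$ is generated by the images of the automorphisms $B/I\to B/I$ induced by semigroup automorphisms $S\to S$ that map $I$ to itself.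
   Context: For $m=(m_1,\dots,m_n)\in\mathbb{Z}_{\ge 0}^n$ write $\mathbf{x}^m=x_1^{m_1}\cdots x_n^{m_n}$. A monomial ideal is an ideal generated by a finite set of monomials, and $\operatorname{supp}(I)=\{m\in S\mid \mathbf{x}^m\in I\}$. A monomial ideal $I\subset \mathbf{k}[x_1,\dots,x_n]$ is full if no standard basis vector $e_i$ lies in $\operatorname{supp}(I)$, i.e. no variable $x_i$ belongs to $I$. The torus $T$ acts on $\mathbf{k}[S]$ as follows: a point $t\in T$ corresponds to a homomorphism $t\colon\mathbb{Z}^n\to\mathbf{k}^*$ and acts by $\mathbf{x}^m\mapsto t(m)\mathbf{x}^m$. This action preserves every monomial ideal, hence induces an action on $B/I$, and $T$ is identified with its image in $G$. Derivations are $\mathbf{k}$-linear. The algebra $B/I$ is $\mathbb{Z}^n$-graded, the class of $\mathbf{x}^m$ (for $m\notin\operatorname{supp}(I)$) having degree $m$. A derivation is homogeneous if it sends homogeneous elements to homogeneous elements. The $\mathbb{G}_{\mathrm{a}}$-action corresponding to a nilpotent derivation $\partial$ is $s\mapsto \exp(s\partial)=\sum_{i\ge 0}\frac{s^i\partial^i}{i!}$. A semigroup automorphism $\widehat g\colon S\to S$ maps $I$ to itself if $\widehat g(\operatorname{supp}(I))=\operatorname{supp}(I)$; the induced automorphism of $B/I$ sends the class of $\mathbf{x}^m$ to the class of $\mathbf{x}^{\widehat g(m)}$. *)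

theory Defs
  imports
    "HOL-Library.Poly_Mapping"
    "HOL-Algebra.Module"
    "HOL-Algebra.QuotRing"
    "HOL-Algebra.Bij"
    "HOL-Algebra.Coset"
    "HOL-Algebra.Generated_Groups"
    "HOL-Algebra.Embedded_Algebras"
    "HOL-Algebra.Algebraic_Closure_Type"
    "HOL-Analysis.Abstract_Topological_Spaces"
begin

section \<open>Monomial ideals\<close>

type_synonym 'n monom = "'n \<Rightarrow>\<^sub>0 nat"
type_synonym ('n, 'k) mpoly = "'n monom \<Rightarrow>\<^sub>0 'k"

abbreviation mpoly_ring :: "('n, 'k::field) mpoly ring"
  where "mpoly_ring \<equiv> ring_of_type_algebra"

definition xmon :: "'n monom \<Rightarrow> ('n, 'k::field) mpoly"
  where "xmon m = Poly_Mapping.single m 1"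

definition monomial_ideal :: "('n, 'k::field) mpoly set \<Rightarrow> bool"
  where "monomial_ideal I \<longleftrightarrow> (\<exists>M. finite M \<and> I = genideal mpoly_ring (xmon ` M))"

definition supp :: "('n, 'k::field) mpoly set \<Rightarrow> 'n monom set"
  where "supp I = {m. xmon m \<in> I}"

definition full :: "('n, 'k::field) mpoly set \<Rightarrow> bool"
  where "full I \<longleftrightarrow> (\<forall>i. Poly_Mapping.single i 1 \<notin> supp I)"


section \<open>The algebra \<open>B/I\<close>\<close>

definition residue_class :: "('n, 'k::field) mpoly set \<Rightarrow> ('n, 'k) mpoly \<Rightarrow> ('n, 'k) mpoly set"
  where "residue_class I p = I +>\<^bsub>mpoly_ring\<^esub> p"

definition quot_alg :: "('n, 'k::field) mpoly set \<Rightarrow> ('k, ('n, 'k) mpoly set) module"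
  where "quot_alg I =
    \<lparr>carrier = carrier (mpoly_ring Quot I),
     monoid.mult = monoid.mult (mpoly_ring Quot I),
     one = one (mpoly_ring Quot I),
     zero = zero (mpoly_ring Quot I),
     add = add (mpoly_ring Quot I),
     module.smult = (\<lambda>c a. \<Union>p\<in>a. residue_class I (Poly_Mapping.single 0 c * p))\<rparr>"

text \<open>The map \<open>B/I \<rightarrow> B'/J\<close> induced by \<open>f : B \<rightarrow> B'\<close>; it is meaningful when \<open>f\<close> is additive and
  \<open>f(I) \<subseteq> J\<close>, since then the union below is a single coset.\<close>

definition induced_map ::
  "('n, 'k::field) mpoly set \<Rightarrow> ('n, 'l::field) mpoly set \<Rightarrow> (('n, 'k) mpoly \<Rightarrow> ('n, 'l) mpoly)
    \<Rightarrow> ('n, 'k) mpoly set \<Rightarrow> ('n, 'l) mpoly set"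
  where "induced_map I J f = (\<lambda>a\<in>carrier (quot_alg I). \<Union>p\<in>a. residue_class J (f p))"

definition finite_dimensional :: "('k::field, 'a) module \<Rightarrow> bool"
  where "finite_dimensional A \<longleftrightarrow>
    ring.finite_dimension A (range (\<lambda>c. c \<odot>\<^bsub>A\<^esub> \<one>\<^bsub>A\<^esub>)) (carrier A)"


section \<open>Linear maps and algebra automorphisms\<close>

definition linear_endo :: "('k::field, 'a) module \<Rightarrow> ('a \<Rightarrow> 'a) \<Rightarrow> bool"
  where "linear_endo A f \<longleftrightarrow>
    f \<in> carrier A \<rightarrow> carrier A \<and>
    (\<forall>x\<in>carrier A. \<forall>y\<in>carrier A. f (x \<oplus>\<^bsub>A\<^esub> y) = f x \<oplus>\<^bsub>A\<^esub> f y) \<and>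
    (\<forall>c. \<forall>x\<in>carrier A. f (c \<odot>\<^bsub>A\<^esub> x) = c \<odot>\<^bsub>A\<^esub> f x)"

definition linear_form :: "('k::field, 'a) module \<Rightarrow> ('a \<Rightarrow> 'k) \<Rightarrow> bool"
  where "linear_form A l \<longleftrightarrow>
    (\<forall>x\<in>carrier A. \<forall>y\<in>carrier A. l (x \<oplus>\<^bsub>A\<^esub> y) = l x + l y) \<and>
    (\<forall>c. \<forall>x\<in>carrier A. l (c \<odot>\<^bsub>A\<^esub> x) = c * l x)"

definition GL :: "('k::field, 'a) module \<Rightarrow> ('a \<Rightarrow> 'a) monoid"
  where "GL A = BijGroup (carrier A) \<lparr>carrier := {f \<in> Bij (carrier A). linear_endo A f}\<rparr>"

definition Aut :: "('k::field, 'a) module \<Rightarrow> ('a \<Rightarrow> 'a) monoid"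
  where "Aut A = BijGroup (carrier A)
    \<lparr>carrier := {f \<in> Bij (carrier A). f \<in> ring_hom A A \<and> linear_endo A f}\<rparr>"


section \<open>Linear algebraic groups\<close>

text \<open>Groups are identified with their groups of \<open>k\<close>-points.  The coordinate ring of \<open>GL(A)\<close> is
  generated by the matrix coefficients of \<open>g\<close> and of \<open>g\<^sup>-\<^sup>1\<close>; for finite-dimensional \<open>A\<close> this is the
  usual \<open>k[x\<^sub>i\<^sub>j, 1/det]\<close>, without a choice of basis.\<close>

inductive_set regular_fun :: "('k::field, 'a) module \<Rightarrow> (('a \<Rightarrow> 'a) \<Rightarrow> 'k) set"
  for A where
  const: "(\<lambda>_. c) \<in> regular_fun A"
| coeff: "linear_form A l \<Longrightarrow> v \<in> carrier A \<Longrightarrow> (\<lambda>g. l (g v)) \<in> regular_fun A"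
| inv_coeff: "linear_form A l \<Longrightarrow> v \<in> carrier A \<Longrightarrow> (\<lambda>g. l ((inv\<^bsub>GL A\<^esub> g) v)) \<in> regular_fun A"
| add: "f \<in> regular_fun A \<Longrightarrow> h \<in> regular_fun A \<Longrightarrow> (\<lambda>g. f g + h g) \<in> regular_fun A"
| mult: "f \<in> regular_fun A \<Longrightarrow> h \<in> regular_fun A \<Longrightarrow> (\<lambda>g. f g * h g) \<in> regular_fun A"

definition zariski :: "('k::field, 'a) module \<Rightarrow> ('a \<Rightarrow> 'a) topology"
  where "zariski A =
    topology_generated_by {{g \<in> carrier (GL A). f g \<noteq> 0} | f. f \<in> regular_fun A}"

definition linear_algebraic :: "('k::field, 'a) module \<Rightarrow> ('a \<Rightarrow> 'a) set \<Rightarrow> bool"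
  where "linear_algebraic A H \<longleftrightarrow> subgroup H (GL A) \<and> closedin (zariski A) H"

definition coord_ring :: "('k::field, 'a) module \<Rightarrow> ('a \<Rightarrow> 'a) set \<Rightarrow> (('a \<Rightarrow> 'a) \<Rightarrow> 'k) set"
  where "coord_ring A H = {restrict f H | f. f \<in> regular_fun A}"

definition identity_component ::
  "('k::field, 'a) module \<Rightarrow> ('a \<Rightarrow> 'a) set \<Rightarrow> ('a \<Rightarrow> 'a) set"
  where "identity_component A H =
    connected_component_of_set (subtopology (zariski A) H) \<one>\<^bsub>GL A\<^esub>"

text \<open>An affine algebraic group is given by its group of points together with its algebra of
  regular functions; an isomorphism has to be a group isomorphism inducing a bijection of the
  algebras of regular functions.\<close>

definition alg_group_iso ::
  "('g, 'x) monoid_scheme \<Rightarrow> ('g \<Rightarrow> 'k) set \<Rightarrow> ('h, 'y) monoid_scheme \<Rightarrow> ('h \<Rightarrow> 'k) set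
    \<Rightarrow> ('g \<Rightarrow> 'h) \<Rightarrow> bool"
  where "alg_group_iso G OG H OH \<phi> \<longleftrightarrow>
    \<phi> \<in> iso G H \<and> OG = {\<lambda>x\<in>carrier G. f (\<phi> x) | f. f \<in> OH}"


section \<open>Tori\<close>

definition exp_lattice :: "'j set \<Rightarrow> ('j \<Rightarrow>\<^sub>0 int) set"
  where "exp_lattice J = {m. Poly_Mapping.keys m \<subseteq> J}"

text \<open>The split torus \<open>Spec k[\<int>\<^sup>J]\<close>: its points are the homomorphisms \<open>\<int>\<^sup>J \<rightarrow> k\<^sup>*\<close>, its coordinate ring
  is the group algebra, with \<open>m \<in> \<int>\<^sup>J\<close> acting as the character \<open>t \<mapsto> t(m)\<close>.\<close>

definition split_torus :: "'j set \<Rightarrow> (('j \<Rightarrow>\<^sub>0 int) \<Rightarrow> 'k::field) monoid"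
  where "split_torus J =
    \<lparr>carrier = {t \<in> extensional (exp_lattice J).
        (\<forall>m\<in>exp_lattice J. t m \<noteq> 0) \<and> (\<forall>m\<in>exp_lattice J. \<forall>m'\<in>exp_lattice J. t (m + m') = t m * t m')},
     monoid.mult = (\<lambda>s t. \<lambda>m\<in>exp_lattice J. s m * t m),
     one = (\<lambda>m\<in>exp_lattice J. 1)\<rparr>"

definition split_torus_ring :: "'j set \<Rightarrow> ((('j \<Rightarrow>\<^sub>0 int) \<Rightarrow> 'k::field) \<Rightarrow> 'k) set"
  where "split_torus_ring J =
    {\<lambda>t\<in>carrier (split_torus J). (\<Sum>m\<in>M. c m * t m) | M c. finite M \<and> M \<subseteq> exp_lattice J}"

text \<open>Base change of \<open>H \<le> GL(B/I)\<close> to the algebraic closure: the Zariski closure of \<open>H\<close> in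
  \<open>GL((B/I) \<otimes> k\<^sup>a)\<close>, where \<open>(B/I) \<otimes> k\<^sup>a\<close> is the quotient of the polynomial ring over \<open>k\<^sup>a\<close> by the
  extended ideal.\<close>

definition ideal_ac :: "('n, 'k::field) mpoly set \<Rightarrow> ('n, 'k alg_closure) mpoly set"
  where "ideal_ac I = genideal mpoly_ring (Poly_Mapping.map to_ac ` I)"

definition base_change ::
  "('n, 'k::field) mpoly set \<Rightarrow> (('n, 'k) mpoly set \<Rightarrow> ('n, 'k) mpoly set) set
    \<Rightarrow> (('n, 'k alg_closure) mpoly set \<Rightarrow> ('n, 'k alg_closure) mpoly set) set"
  where "base_change I H =
    (let \<iota> = induced_map I (ideal_ac I) (Poly_Mapping.map to_ac);
         A' = quot_alg (ideal_ac I)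
     in Abstract_Topology.closure_of (zariski A')
          {g \<in> carrier (GL A'). \<exists>h\<in>H. \<forall>a\<in>carrier (quot_alg I). g (\<iota> a) = \<iota> (h a)})"

text \<open>A torus over \<open>k\<close> is a linear algebraic group that becomes a split torus of some rank over the
  algebraic closure; it need not be split over \<open>k\<close>.\<close>

definition is_torus ::
  "('n, 'k::field) mpoly set \<Rightarrow> (('n, 'k) mpoly set \<Rightarrow> ('n, 'k) mpoly set) set \<Rightarrow> bool"
  where "is_torus I H \<longleftrightarrow>
    linear_algebraic (quot_alg I) H \<and>
    (\<exists>(r::nat) \<phi>. alg_group_iso
      (split_torus {..<r}) (split_torus_ring {..<r})
      (GL (quot_alg (ideal_ac I)) \<lparr>carrier := base_change I H\<rparr>)
      (coord_ring (quot_alg (ideal_ac I)) (base_change I H)) \<phi>)"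

definition maximal_torus ::
  "('n, 'k::field) mpoly set \<Rightarrow> (('n, 'k) mpoly set \<Rightarrow> ('n, 'k) mpoly set) set
    \<Rightarrow> (('n, 'k) mpoly set \<Rightarrow> ('n, 'k) mpoly set) set \<Rightarrow> bool"
  where "maximal_torus I G T \<longleftrightarrow>
    is_torus I T \<and> T \<subseteq> G \<and> (\<forall>H. is_torus I H \<and> H \<subseteq> G \<and> T \<subseteq> H \<longrightarrow> H = T)"

definition torus_action ::
  "('n, 'k::field) mpoly set \<Rightarrow> (('n \<Rightarrow>\<^sub>0 int) \<Rightarrow> 'k) \<Rightarrow> ('n, 'k) mpoly set \<Rightarrow> ('n, 'k) mpoly set"
  where "torus_action I t =
    induced_map I I (Poly_Mapping.mapp (\<lambda>m c. t (Poly_Mapping.map int m) * c))"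

definition torus_image ::
  "('n, 'k::field) mpoly set \<Rightarrow> (('n, 'k) mpoly set \<Rightarrow> ('n, 'k) mpoly set) set"
  where "torus_image I = torus_action I ` carrier (split_torus UNIV)"


section \<open>Additive group actions\<close>

definition derivation :: "('k::field, 'a) module \<Rightarrow> ('a \<Rightarrow> 'a) \<Rightarrow> bool"
  where "derivation A D \<longleftrightarrow> linear_endo A D \<and>
    (\<forall>x\<in>carrier A. \<forall>y\<in>carrier A. D (x \<otimes>\<^bsub>A\<^esub> y) = (D x \<otimes>\<^bsub>A\<^esub> y) \<oplus>\<^bsub>A\<^esub> (x \<otimes>\<^bsub>A\<^esub> D y))"

definition nilpotent :: "('k::field, 'a) module \<Rightarrow> ('a \<Rightarrow> 'a) \<Rightarrow> bool"
  where "nilpotent A D \<longleftrightarrow> (\<exists>N. \<forall>x\<in>carrier A. (D ^^ N) x = \<zero>\<^bsub>A\<^esub>)"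

definition homogeneous_elems :: "('n, 'k::field) mpoly set \<Rightarrow> ('n, 'k) mpoly set set"
  where "homogeneous_elems I = {c \<odot>\<^bsub>quot_alg I\<^esub> residue_class I (xmon m) | c m. True}"

definition homogeneous ::
  "('n, 'k::field) mpoly set \<Rightarrow> (('n, 'k) mpoly set \<Rightarrow> ('n, 'k) mpoly set) \<Rightarrow> bool"
  where "homogeneous I D \<longleftrightarrow> D ` homogeneous_elems I \<subseteq> homogeneous_elems I"

text \<open>For nilpotent \<open>D\<close> the index set is finite, so the sum is the full exponential series.\<close>

definition exp_action ::
  "('k::field_char_0, 'a) module \<Rightarrow> ('a \<Rightarrow> 'a) \<Rightarrow> 'k \<Rightarrow> 'a \<Rightarrow> 'a"
  where "exp_action A D s = (\<lambda>x\<in>carrier A.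
    \<Oplus>\<^bsub>A\<^esub>i\<in>{i. (D ^^ i) x \<noteq> \<zero>\<^bsub>A\<^esub>}. (s ^ i / fact i) \<odot>\<^bsub>A\<^esub> (D ^^ i) x)"

definition ga_images ::
  "('n, 'k::field_char_0) mpoly set \<Rightarrow> (('n, 'k) mpoly set \<Rightarrow> ('n, 'k) mpoly set) set"
  where "ga_images I = {exp_action (quot_alg I) D s | D s.
    derivation (quot_alg I) D \<and> nilpotent (quot_alg I) D \<and> homogeneous I D}"


section \<open>Automorphisms induced by semigroup automorphisms\<close>

definition semigroup_aut :: "('n monom \<Rightarrow> 'n monom) \<Rightarrow> bool"
  where "semigroup_aut \<sigma> \<longleftrightarrow> bij \<sigma> \<and> (\<forall>m m'. \<sigma> (m + m') = \<sigma> m + \<sigma> m')"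

text \<open>\<^const>\<open>Poly_Mapping.map_key\<close> is contravariant (\<open>x\<^sup>\<sigma>\<^sup>(\<^sup>m\<^sup>) \<mapsto> x\<^sup>m\<close>), hence the inverse.\<close>

definition semigroup_induced ::
  "('n, 'k::field) mpoly set \<Rightarrow> (('n, 'k) mpoly set \<Rightarrow> ('n, 'k) mpoly set) set"
  where "semigroup_induced I =
    {induced_map I I (Poly_Mapping.map_key (inv_into UNIV \<sigma>)) | \<sigma>.
      semigroup_aut \<sigma> \<and> \<sigma> ` supp I = supp I}"

end

theory Submission
  imports Defs
begin

text \<open>The monomials outside \<open>supp I\<close> give a basis of \<open>A = B/I\<close> that is multiplicative up to zero, so
endomorphisms of \<open>A\<close> are matrices indexed by standard monomials, and \<open>A\<close> is graded by \<open>\<int>\<^sup>n\<close>.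
All variables survive in \<open>A\<close> because \<open>I\<close> is full, and they are nilpotent because \<open>A\<close> is
finite-dimensional. Hence an automorphism \<open>g\<close> maps each variable to a combination of variables (its
linear part \<open>lin g\<close>) plus terms of higher degree, and \<open>lin\<close> reverses products. The whole group is
understood by peeling off the linear part, then the rest degree by degree.

The linear part. Let \<open>i \<preceq> j\<close> mean that \<open>x\<^sub>j \<partial>/\<partial>x\<^sub>i\<close> maps \<open>I\<close> into itself. Conjugating the Euler
derivation \<open>x\<^sub>k \<partial>/\<partial>x\<^sub>k\<close> by an automorphism \<open>g\<close> gives a derivation whose component of degree
\<open>e\<^sub>j - e\<^sub>i\<close> is \<open>lin g\<^sup>-\<^sup>1 i k * lin g k j\<close> times \<open>x\<^sub>j \<partial>/\<partial>x\<^sub>i\<close>; so \<open>i \<preceq> j\<close> as soon as this coefficient is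
not zero (\<open>root_of_automorphism\<close>). As \<open>\<Sum>\<^sub>i lin g k i * lin g\<^sup>-\<^sup>1 i k = 1\<close>, some \<open>i\<close> can serve as
pivot for row \<open>k\<close>, and the column operations needed to clear row \<open>k\<close> are exactly the automorphisms
\<open>exp (s x\<^sub>j \<partial>/\<partial>x\<^sub>i)\<close> with \<open>i \<preceq> j\<close>. Gaussian elimination therefore takes place inside the group
(\<open>elim_step\<close>, \<open>elim_all\<close>) and ends with a monomial matrix. The permutation of the variables found in
this way preserves \<open>I\<close>, by comparing terms of lowest degree (\<open>permutation_preserves\<close>), and the
diagonal factor lies in \<open>T\<close>. What is left has identity linear part.

The unipotent part. If \<open>u\<close> is the identity up to terms that raise the degree by \<open>d\<close>, then each
\<open>\<int>\<^sup>n\<close>-homogeneous piece of its part raising the degree by exactly \<open>d\<close> is a nilpotent derivation.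
Composing with the exponential of its negative removes this piece, so \<open>u\<close> is a product of
exponentials of homogeneous nilpotent derivations (\<open>unipotent_gen_group\<close>).

Components. Let \<open>N\<close> be the set of automorphisms \<open>g\<close> such that the matrices \<open>lin g\<close> and \<open>lin g\<^sup>-\<^sup>1\<close> are
supported on \<open>\<preceq>\<close>; it is a closed subgroup. For \<open>g\<close> in \<open>N\<close> pivots can be moved to the diagonal within
\<open>N\<close>, so no permutation remains and \<open>N\<close> is contained in the group generated by \<open>T\<close> and the
additive group actions. That group lies in \<open>G\<^sup>0\<close>, because its generators lie on rational curves through the
identity and such curves are connected over an infinite field (\<open>connectedin_curve\<close>). Conversely
finitely many translates of \<open>N\<close> by permutations cover \<open>G\<close>, so \<open>N\<close> is also open in \<open>G\<close> and contains
\<open>G\<^sup>0\<close>. Thus \<open>N = G\<^sup>0\<close>, and the component group consists of the classes of permutations.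

The torus. An automorphism lies in \<open>T\<close> iff it maps each variable to a multiple of itself, which is a
closed condition. Over the algebraic closure, the closure of the \<open>k\<close>-points of \<open>T\<close> is the
whole diagonal torus, since a Laurent polynomial in one variable with infinitely many zeros
vanishes (\<open>base_change_T\<close>). A torus \<open>H\<close> between \<open>T\<close> and \<open>G\<close> embeds in its commutative base change,
so it centralises \<open>T\<close>, hence preserves multidegrees and equals \<open>T\<close> (\<open>T_maximal\<close>). Finally \<open>G\<close> is closed
because multiplicativity is a polynomial condition on matrix coefficients (\<open>Aut_closed\<close>).\<close>

section \<open>Polynomials as finitely supported functions\<close>

abbreviation "lk \<equiv> Poly_Mapping.lookup"
abbreviation "ks \<equiv> Poly_Mapping.keys"

lemma mpoly_ring_simps [simp]:
  "carrier (mpoly_ring :: ('n, 'k::field) mpoly ring) = UNIV"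
  "\<zero>\<^bsub>mpoly_ring :: ('n, 'k::field) mpoly ring\<^esub> = 0"
  "\<one>\<^bsub>mpoly_ring :: ('n, 'k::field) mpoly ring\<^esub> = 1"
  "x \<oplus>\<^bsub>mpoly_ring :: ('n, 'k::field) mpoly ring\<^esub> y = x + y"
  "x \<otimes>\<^bsub>mpoly_ring :: ('n, 'k::field) mpoly ring\<^esub> y = x * y"
  by (simp_all add: ring_of_type_algebra_def)

lemma mem_residue_class: "q \<in> residue_class I p \<longleftrightarrow> q - p \<in> I"
proof -
  have "residue_class I p = (\<lambda>h. h + p) ` I"
    by (auto simp: residue_class_def a_r_coset_def r_coset_def ring_of_type_algebra_def)
  moreover have "q = (q - p) + p" by simp
  ultimately show ?thesis by (metis (no_types, lifting) add_diff_cancel_right' image_iff)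
qed

lemma finite_monom_le:
  "finite {q :: 'n::finite monom. \<forall>i. lk q i \<le> B i}"
proof -
  have "lk ` {q :: 'n monom. \<forall>i. lk q i \<le> B i} \<subseteq> Pi\<^sub>E UNIV (\<lambda>i. {..B i})"
    by (simp add: image_subset_iff PiE_def Pi_def)
  moreover have "finite (Pi\<^sub>E (UNIV :: 'n set) (\<lambda>i. {..B i}))"
    by (intro finite_PiE) simp_all
  ultimately have "finite (lk ` {q :: 'n monom. \<forall>i. lk q i \<le> B i})"
    by (rule finite_subset)
  moreover have "inj_on lk {q :: 'n monom. \<forall>i. lk q i \<le> B i}"
    by (rule inj_onI) (rule poly_mapping_eqI, simp)
  ultimately show ?thesis by (rule finite_imageD)
qed

definition splits :: "'n::finite monom \<Rightarrow> ('n monom \<times> 'n monom) set"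
  where "splits p = {(q, r). q + r = p}"

lemma finite_splits [simp]: "finite (splits p)"
proof -
  let ?F = "{q. \<forall>i. lk q i \<le> lk p i}"
  have "splits p \<subseteq> ?F \<times> ?F" by (auto simp: splits_def lookup_add)
  then show ?thesis by (rule finite_subset) (intro finite_cartesian_product finite_monom_le)
qed

lemma lookup_mult_splits:
  fixes x y :: "('n::finite, 'k::field) mpoly"
  shows "lk (x * y) p = (\<Sum>(q, r)\<in>splits p. lk x q * lk y r)"
proof -
  have "lk (x * y) p = Sum_any (\<lambda>(q, r). lk x q * lk y r when p = q + r)"
    unfolding times_poly_mapping.rep_eq by (rule prod_fun_unfold_prod) auto
  also have "\<dots> = (\<Sum>(q, r)\<in>splits p. (lk x q * lk y r when p = q + r))"
  proof (rule Sum_any.expand_superset[OF finite_splits])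
    show "{a. (case a of (q, r) \<Rightarrow> lk x q * lk y r when p = q + r) \<noteq> 0} \<subseteq> splits p"
      by (auto simp: splits_def)
  qed
  also have "\<dots> = (\<Sum>(q, r)\<in>splits p. lk x q * lk y r)"
    by (rule sum.cong) (auto simp: splits_def)
  finally show ?thesis .
qed

section \<open>The quotient by a monomial ideal\<close>

text \<open>A monomial ideal is recorded by the set \<open>S\<close> of its exponents, which is closed under adding any
exponent. The same \<open>S\<close> serves for the ideal over every field, in particular after base change.\<close>

locale monomial_quotient =
  fixes S :: "'n::finite monom set" and I :: "('n, 'k::field) mpoly set"
  assumes up: "m \<in> S \<Longrightarrow> m + m' \<in> S"
    and I_eq: "I = {p. ks p \<subseteq> S}"
begin

lemma up': "m \<in> S \<Longrightarrow> m' + m \<in> S"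
  using up by (simp add: add.commute)

lemma I_iff: "p \<in> I \<longleftrightarrow> (\<forall>m. m \<notin> S \<longrightarrow> lk p m = 0)"
  by (auto simp: I_eq in_keys_iff)

lemma I_add: "p \<in> I \<Longrightarrow> q \<in> I \<Longrightarrow> p + q \<in> I"
  by (auto simp: I_iff lookup_add)

lemma I_uminus: "p \<in> I \<Longrightarrow> - p \<in> I"
  by (auto simp: I_iff)

lemma I_diff: "p \<in> I \<Longrightarrow> q \<in> I \<Longrightarrow> p - q \<in> I"
  by (auto simp: I_iff lookup_minus)

lemma I_zero [simp]: "0 \<in> I"
  by (auto simp: I_iff)

lemma I_mult: "p \<in> I \<Longrightarrow> p * q \<in> I"
proof -
  assume p: "p \<in> I"
  have "ks (p * q) \<subseteq> {a + b |a b. a \<in> ks p \<and> b \<in> ks q}" by (rule keys_mult)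
  also have "\<dots> \<subseteq> S" using p up by (auto simp: I_eq)
  finally show ?thesis by (simp add: I_eq)
qed

lemma I_mult': "p \<in> I \<Longrightarrow> q * p \<in> I"
  using I_mult by (simp add: mult.commute)

lemma ideal_I: "ideal I mpoly_ring"
proof (rule idealI)
  show "ring (mpoly_ring :: ('n, 'k) mpoly ring)" by (rule ring_from_type_algebra)
  show "subgroup I (add_monoid mpoly_ring)"
  proof (rule group.subgroupI)
    show "Group.group (add_monoid (mpoly_ring :: ('n, 'k) mpoly ring))"
      by (rule abelian_group.a_group) (rule ring.is_abelian_group[OF ring_from_type_algebra])
    show "I \<noteq> {}" using I_zero by blast
    show "inv\<^bsub>add_monoid mpoly_ring\<^esub> a \<in> I" if "a \<in> I" for a
    proof -
      have "inv\<^bsub>add_monoid mpoly_ring\<^esub> a = - a"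
        using \<open>Group.group (add_monoid (mpoly_ring :: ('n, 'k) mpoly ring))\<close>
        by (intro group.inv_equality) auto
      then show ?thesis using that by (simp add: I_uminus)
    qed
  qed (auto intro: I_add)
qed (auto intro: I_mult I_mult')

abbreviation "A \<equiv> quot_alg I"
abbreviation "cls \<equiv> residue_class I"

lemma cls_eq_iff: "cls p = cls q \<longleftrightarrow> p - q \<in> I"
proof
  assume "cls p = cls q"
  moreover have "p \<in> cls p" by (simp add: mem_residue_class)
  ultimately show "p - q \<in> I" by (simp add: mem_residue_class)
next
  assume pq: "p - q \<in> I"
  show "cls p = cls q"
  proof (rule Set.set_eqI)
    fix r
    show "r \<in> cls p \<longleftrightarrow> r \<in> cls q"
      using I_add[OF _ pq, of "r - p"] I_diff[OF _ pq, of "r - q"] by (auto simp: mem_residue_class)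
  qed
qed

lemma self_cls [simp]: "p \<in> cls p"
  by (simp add: mem_residue_class)

lemma carrier_A: "carrier A = range cls"
  by (auto simp: quot_alg_def FactRing_def A_RCOSETS_def RCOSETS_def a_r_coset_def residue_class_def
      ring_of_type_algebra_def)

lemma cls_closed [simp, intro]: "cls p \<in> carrier A"
  by (simp add: carrier_A)

lemma carrierE: assumes "a \<in> carrier A" obtains p where "a = cls p"
  using assms by (auto simp: carrier_A)

lemma add_cls [simp]: "cls p \<oplus>\<^bsub>A\<^esub> cls q = cls (p + q)"
proof -
  have "cls p \<oplus>\<^bsub>A\<^esub> cls q = cls p <+>\<^bsub>mpoly_ring\<^esub> cls q"
    by (simp add: quot_alg_def FactRing_def)
  also have "\<dots> = cls (p + q)"
    unfolding residue_class_def
    using abelian_subgroup.a_rcos_sum[OF abelian_subgroupI3, of I mpoly_ring p q] ideal_I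
    by (simp add: ideal.axioms(1) ring.is_abelian_group ring_from_type_algebra)
  finally show ?thesis .
qed

lemma mult_cls [simp]: "cls p \<otimes>\<^bsub>A\<^esub> cls q = cls (p * q)"
proof -
  have "cls p \<otimes>\<^bsub>A\<^esub> cls q = [mod I:] cls p \<Otimes>\<^bsub>mpoly_ring\<^esub> cls q"
    by (simp add: quot_alg_def FactRing_def)
  also have "\<dots> = cls (p * q)"
    unfolding residue_class_def using ideal.rcoset_mult_add[OF ideal_I, of p q] by simp
  finally show ?thesis .
qed

lemma one_A: "\<one>\<^bsub>A\<^esub> = cls 1"
  by (simp add: quot_alg_def FactRing_def residue_class_def)

lemma zero_A: "\<zero>\<^bsub>A\<^esub> = cls 0"
proof -
  have "\<zero>\<^bsub>A\<^esub> = I" by (simp add: quot_alg_def FactRing_def)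
  also have "\<dots> = cls 0" by (auto simp: mem_residue_class)
  finally show ?thesis .
qed

text \<open>Scalar multiplication and induced maps are defined as unions of cosets over all representatives; the
union collapses to one coset when representatives that differ by \<open>I\<close> have images that differ by \<open>J\<close>.\<close>

lemma UN_cls_eq:
  assumes "\<And>q. q - p \<in> I \<Longrightarrow> f q - f p \<in> J"
    and "\<And>x y. x \<in> J \<Longrightarrow> y \<in> J \<Longrightarrow> x + y \<in> J"
  shows "(\<Union>q\<in>cls p. residue_class J (f q)) = residue_class J (f p)"
proof (rule Set.set_eqI)
  fix r
  show "r \<in> (\<Union>q\<in>cls p. residue_class J (f q)) \<longleftrightarrow> r \<in> residue_class J (f p)"
  proof
    assume "r \<in> (\<Union>q\<in>cls p. residue_class J (f q))"
    then obtain q where q: "q - p \<in> I" "r - f q \<in> J" by (auto simp: mem_residue_class)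
    then have "(r - f q) + (f q - f p) \<in> J" using assms by blast
    then show "r \<in> residue_class J (f p)" by (simp add: mem_residue_class)
  next
    assume "r \<in> residue_class J (f p)"
    then show "r \<in> (\<Union>q\<in>cls p. residue_class J (f q))" using self_cls by blast
  qed
qed

lemma smult_cls [simp]: "c \<odot>\<^bsub>A\<^esub> cls p = cls (Poly_Mapping.single 0 c * p)"
proof -
  have "c \<odot>\<^bsub>A\<^esub> cls p = (\<Union>q\<in>cls p. cls (Poly_Mapping.single 0 c * q))"
    by (simp add: quot_alg_def)
  also have "\<dots> = cls (Poly_Mapping.single 0 c * p)"
    by (rule UN_cls_eq) (auto simp: right_diff_distrib[symmetric] intro: I_mult' I_add)
  finally show ?thesis .
qed

lemma cring_A: "cring A"
proof (rule cringI)
  show "abelian_group A"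
  proof (rule abelian_groupI)
    show "\<exists>y\<in>carrier A. y \<oplus>\<^bsub>A\<^esub> x = \<zero>\<^bsub>A\<^esub>" if x: "x \<in> carrier A" for x
    proof -
      obtain p where "x = cls p" using x by (rule carrierE)
      then show ?thesis by (intro bexI[of _ "cls (- p)"]) (simp_all add: zero_A)
    qed
  qed (auto simp: carrier_A zero_A ac_simps)
  show "comm_monoid A"
    by (rule comm_monoidI) (auto simp: carrier_A one_A ac_simps)
qed (auto simp: carrier_A distrib_right)

sublocale A: cring A by (rule cring_A)

section \<open>Coefficients of residue classes\<close>

text \<open>The value is set to \<open>0\<close> on \<open>S\<close>, where coefficients of representatives are not determined. With this
convention the rules for sums, scalars and \<open>e m\<close> hold for all exponents.\<close>

definition co :: "'n monom \<Rightarrow> ('n, 'k) mpoly set \<Rightarrow> 'k"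
  where "co m a = (if m \<in> S then 0 else lk (SOME p. p \<in> a) m)"

definition e :: "'n monom \<Rightarrow> ('n, 'k) mpoly set"
  where "e m = cls (xmon m)"

lemma co_cls: "co m (cls p) = (if m \<in> S then 0 else lk p m)"
proof -
  have "(SOME q. q \<in> cls p) \<in> cls p" by (rule someI[of _ p]) simp
  then have "(SOME q. q \<in> cls p) - p \<in> I" by (simp add: mem_residue_class)
  then show ?thesis by (auto simp: co_def I_iff lookup_minus)
qed

lemma co_S [simp]: "m \<in> S \<Longrightarrow> co m a = 0"
  by (simp add: co_def)

lemma co_eqI:
  assumes "a \<in> carrier A" "b \<in> carrier A" "\<And>m. m \<notin> S \<Longrightarrow> co m a = co m b"
  shows "a = b"
proof -
  obtain p q where "a = cls p" "b = cls q" using assms by (auto simp: carrier_A)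
  then show ?thesis using assms(3) by (auto simp: cls_eq_iff I_iff co_cls lookup_minus)
qed

lemma co_zero [simp]: "co m \<zero>\<^bsub>A\<^esub> = 0"
  by (simp add: zero_A co_cls)

lemma co_add [simp]:
  "a \<in> carrier A \<Longrightarrow> b \<in> carrier A \<Longrightarrow> co m (a \<oplus>\<^bsub>A\<^esub> b) = co m a + co m b"
  by (auto simp: carrier_A co_cls lookup_add)

lemma smult_closed [simp, intro]: "a \<in> carrier A \<Longrightarrow> c \<odot>\<^bsub>A\<^esub> a \<in> carrier A"
  by (auto simp: carrier_A)

lemma co_smult [simp]: "a \<in> carrier A \<Longrightarrow> co m (c \<odot>\<^bsub>A\<^esub> a) = c * co m a"
proof -
  have "lk (Poly_Mapping.single 0 c * p) m = c * lk p m" for p :: "('n, 'k) mpoly"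
  proof -
    have "lk (Poly_Mapping.single 0 c * p) m = lk (Poly_Mapping.map ((*) c) p) m"
      by (simp add: mult_map_scale_conv_mult)
    then show ?thesis by (simp add: Poly_Mapping.map.rep_eq "when_def")
  qed
  then show "a \<in> carrier A \<Longrightarrow> co m (c \<odot>\<^bsub>A\<^esub> a) = c * co m a"
    by (auto simp: carrier_A co_cls)
qed

text \<open>The pairs \<open>(q, r)\<close> with \<open>q + r = p\<close> avoid \<open>S\<close> since \<open>S\<close> absorbs addition, so no term is lost by the
convention for \<open>co\<close>.\<close>

lemma co_mult:
  assumes "a \<in> carrier A" "b \<in> carrier A" "p \<notin> S"
  shows "co p (a \<otimes>\<^bsub>A\<^esub> b) = (\<Sum>(q, r)\<in>splits p. co q a * co r b)"
proof -
  obtain x y where xy: "a = cls x" "b = cls y" using assms by (auto simp: carrier_A)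
  have "q \<notin> S \<and> r \<notin> S" if "(q, r) \<in> splits p" for q r
    using that assms(3) up up' by (auto simp: splits_def)
  then show ?thesis using assms(3) unfolding xy
    by (simp add: co_cls lookup_mult_splits) (intro sum.cong, auto)
qed

lemma e_closed [simp, intro]: "e m \<in> carrier A"
  by (simp add: e_def)

lemma co_e: "co m (e m') = (if m \<in> S then 0 else if m = m' then 1 else 0)"
  by (auto simp: e_def co_cls xmon_def lookup_single "when_def")

lemma e_mult: "e m \<otimes>\<^bsub>A\<^esub> e m' = e (m + m')"
  by (simp add: e_def xmon_def mult_single)

lemma e_zero_iff: "e m = \<zero>\<^bsub>A\<^esub> \<longleftrightarrow> m \<in> S"
proof -
  have "e m = \<zero>\<^bsub>A\<^esub> \<longleftrightarrow> xmon m - 0 \<in> I" by (simp only: e_def zero_A cls_eq_iff)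
  also have "\<dots> \<longleftrightarrow> m \<in> S" by (simp add: I_eq xmon_def)
  finally show ?thesis .
qed

lemma e_0: "e 0 = \<one>\<^bsub>A\<^esub>"
  by (simp add: e_def one_A xmon_def)

lemma co_mult_e:
  assumes "a \<in> carrier A" "p \<notin> S"
  shows "co (p + m) (a \<otimes>\<^bsub>A\<^esub> e m) = (if p + m \<in> S then 0 else co p a)"
proof (cases "p + m \<in> S")
  case False
  have "co (p + m) (a \<otimes>\<^bsub>A\<^esub> e m) = (\<Sum>x\<in>splits (p + m). if x = (p, m) then co p a else 0)"
    unfolding co_mult[OF assms(1) e_closed False]
    by (rule sum.cong) (use False up up' in \<open>auto simp: splits_def co_e split: if_splits\<close>)
  also have "\<dots> = co p a" by (subst sum.delta) (simp_all add: splits_def[of "p + m"] finite_splits[unfolded splits_def])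
  finally show ?thesis using False by simp
qed simp

lemma co_mult_e_not:
  assumes "a \<in> carrier A" "\<And>q. p \<noteq> q + m"
  shows "co p (a \<otimes>\<^bsub>A\<^esub> e m) = 0"
proof (cases "p \<in> S")
  case False
  show ?thesis unfolding co_mult[OF assms(1) e_closed False]
    by (rule sum.neutral) (use assms(2) in \<open>auto simp: splits_def co_e\<close>)
qed simp

section \<open>Linear forms and endomorphisms\<close>

lemma linear_form_co: "linear_form A (co m)"
  by (simp add: linear_form_def)

lemma linear_endo_closed: "linear_endo A f \<Longrightarrow> a \<in> carrier A \<Longrightarrow> f a \<in> carrier A"
  by (auto simp: linear_endo_def)

lemma linear_form_comp: "linear_form A l \<Longrightarrow> linear_endo A f \<Longrightarrow> linear_form A (\<lambda>a. l (f a))"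
  by (auto simp: linear_form_def linear_endo_def Pi_iff)

lemma linear_endo_comp: "linear_endo A f \<Longrightarrow> linear_endo A g \<Longrightarrow> linear_endo A (\<lambda>a. f (g a))"
  by (auto simp: linear_endo_def Pi_iff)

lemma linear_endo_mult_left: "b \<in> carrier A \<Longrightarrow> linear_endo A (\<lambda>a. b \<otimes>\<^bsub>A\<^esub> a)"
  by (auto simp: linear_endo_def carrier_A algebra_simps)

lemma linear_endo_mult_right: "b \<in> carrier A \<Longrightarrow> linear_endo A (\<lambda>a. a \<otimes>\<^bsub>A\<^esub> b)"
  by (auto simp: linear_endo_def carrier_A algebra_simps)

lemma linear_endo_id: "linear_endo A (\<lambda>a. a)"
  by (auto simp: linear_endo_def)

lemma linear_form_scale: "linear_form A l \<Longrightarrow> linear_form A (\<lambda>a. c * l a)"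
  by (auto simp: linear_form_def algebra_simps)

lemma linear_form_zero: "linear_form A l \<Longrightarrow> l \<zero>\<^bsub>A\<^esub> = 0"
proof -
  assume l: "linear_form A l"
  have "l (0 \<odot>\<^bsub>A\<^esub> \<zero>\<^bsub>A\<^esub>) = 0 * l \<zero>\<^bsub>A\<^esub>" using l by (auto simp: linear_form_def)
  moreover have "0 \<odot>\<^bsub>A\<^esub> \<zero>\<^bsub>A\<^esub> = \<zero>\<^bsub>A\<^esub>" by (simp add: zero_A)
  ultimately show ?thesis by simp
qed

lemma linear_endo_zero: "linear_endo A f \<Longrightarrow> f \<zero>\<^bsub>A\<^esub> = \<zero>\<^bsub>A\<^esub>"
  by (rule co_eqI) (auto simp: linear_endo_closed linear_form_zero[OF linear_form_comp[OF linear_form_co]])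

lemma linear_form_sum:
  assumes l: "linear_form A l" and "finite F"
  shows "l (cls (sum p F)) = (\<Sum>x\<in>F. l (cls (p x)))"
  using assms(2)
proof (induction F)
  case empty
  show ?case using linear_form_zero[OF l] by (simp add: zero_A)
next
  case (insert x F)
  have "l (cls (p x + sum p F)) = l (cls (p x)) + l (cls (sum p F))"
    using l unfolding linear_form_def by (metis add_cls cls_closed)
  then show ?case using insert by simp
qed

end

context monomial_quotient begin

abbreviation "C \<equiv> carrier A"

lemma linear_endoI:
  assumes "\<And>x. x \<in> C \<Longrightarrow> f x \<in> C"
    and "\<And>x y. x \<in> C \<Longrightarrow> y \<in> C \<Longrightarrow> f (x \<oplus>\<^bsub>A\<^esub> y) = f x \<oplus>\<^bsub>A\<^esub> f y"
    and "\<And>c x. x \<in> C \<Longrightarrow> f (c \<odot>\<^bsub>A\<^esub> x) = c \<odot>\<^bsub>A\<^esub> f x"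
  shows "linear_endo A f"
  using assms by (simp add: linear_endo_def)

section \<open>Finite dimension means finitely many standard monomials\<close>

text \<open>By induction on the dimension: adjoining a line \<open>k v\<close> enlarges the set of occurring exponents only by
those of one representative of \<open>v\<close>.\<close>

lemma finite_dimension_keys:
  assumes "A.dimension n K E" "K \<subseteq> range (\<lambda>c. c \<odot>\<^bsub>A\<^esub> \<one>\<^bsub>A\<^esub>)"
  shows "E \<subseteq> C \<and> (\<exists>F. finite F \<and> (\<forall>a\<in>E. \<forall>m. m \<notin> F \<longrightarrow> co m a = 0))"
  using assms
proof (induction rule: A.dimension.induct)
  case (zero_dim K)
  show ?case by (auto intro!: exI[of _ "{}"])
next
  case (Suc_dim v E n K)
  then obtain F where F: "finite F" "\<And>a m. a \<in> E \<Longrightarrow> m \<notin> F \<Longrightarrow> co m a = 0" and E: "E \<subseteq> C"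
    by blast
  obtain q where q: "v = cls q" using Suc_dim.hyps(1) by (auto simp: carrier_A)
  have K: "\<exists>c. k = c \<odot>\<^bsub>A\<^esub> \<one>\<^bsub>A\<^esub>" if "k \<in> K" for k
    using Suc_dim.prems that by blast
  have *: "\<exists>c b. b \<in> E \<and> a = (c \<odot>\<^bsub>A\<^esub> v) \<oplus>\<^bsub>A\<^esub> b" if *: "a \<in> A.line_extension K v E" for a
  proof -
    obtain k b where kb: "k \<in> K" "b \<in> E" "a = (k \<otimes>\<^bsub>A\<^esub> v) \<oplus>\<^bsub>A\<^esub> b"
      using * unfolding A.line_extension_def set_add_defs r_coset_def by auto
    moreover obtain c where "k = c \<odot>\<^bsub>A\<^esub> \<one>\<^bsub>A\<^esub>" using K kb(1) by blast
    ultimately have "a = (c \<odot>\<^bsub>A\<^esub> v) \<oplus>\<^bsub>A\<^esub> b" by (simp add: q one_A)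
    then show ?thesis using kb(2) by blast
  qed
  show ?case
  proof (intro conjI exI[of _ "F \<union> ks q"] ballI allI impI)
    show "A.line_extension K v E \<subseteq> C"
    proof
      fix a assume "a \<in> A.line_extension K v E"
      then obtain c b where "b \<in> E" "a = (c \<odot>\<^bsub>A\<^esub> v) \<oplus>\<^bsub>A\<^esub> b" using * by blast
      then show "a \<in> C" using E Suc_dim.hyps(1) by (simp add: subset_iff)
    qed
    show "finite (F \<union> ks q)" using F(1) by simp
    fix a m assume "a \<in> A.line_extension K v E" and m: "m \<notin> F \<union> ks q"
    then obtain c b where cb: "b \<in> E" "a = (c \<odot>\<^bsub>A\<^esub> v) \<oplus>\<^bsub>A\<^esub> b" using * by blast
    have "co m v = 0" using m by (simp add: q co_cls in_keys_iff)
    then show "co m a = 0" using cb E F(2)[OF cb(1)] m Suc_dim.hyps(1)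
      by (simp add: subset_iff)
  qed
qed

lemma finite_dimensional_imp_finite:
  assumes "finite_dimensional A"
  shows "finite (- S)"
proof -
  obtain n where n: "A.dimension n (range (\<lambda>c. c \<odot>\<^bsub>A\<^esub> \<one>\<^bsub>A\<^esub>)) C"
    using assms unfolding finite_dimensional_def A.finite_dimension_def by (elim exE)
  then obtain F where F: "finite F" "\<And>a m. a \<in> C \<Longrightarrow> m \<notin> F \<Longrightarrow> co m a = 0"
    using finite_dimension_keys[OF n order_refl] by (elim conjE exE) simp
  have "- S \<subseteq> F"
  proof
    fix m assume "m \<in> - S"
    then have "co m (e m) \<noteq> 0" by (simp add: co_e)
    then show "m \<in> F" using F(2)[of "e m" m] by auto
  qed
  then show ?thesis using F(1) finite_subset by blast
qed

section \<open>The groups of linear and of algebra automorphisms\<close>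

lemma GL_carrier_iff:
  "g \<in> carrier (GL A) \<longleftrightarrow> g \<in> extensional C \<and> bij_betw g C C \<and> linear_endo A g"
  by (auto simp: GL_def Bij_def)

lemma subgroup_GL: "subgroup (carrier (GL A)) (BijGroup C)"
proof (rule group.subgroupI[OF group_BijGroup])
  show "carrier (GL A) \<subseteq> carrier (BijGroup C)"
    by (auto simp: GL_def BijGroup_def)
  have "(\<lambda>x\<in>C. x) \<in> carrier (GL A)"
    by (auto simp: GL_def id_Bij linear_endo_def)
  then show "carrier (GL A) \<noteq> {}" by blast
next
  fix g assume g: "g \<in> carrier (GL A)"
  then have gB: "g \<in> Bij C" and lin: "linear_endo A g" by (auto simp: GL_def)
  let ?h = "inv_into C g"
  have h: "?h x \<in> C" "g (?h x) = x" if "x \<in> C" for x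
    using that gB by (auto simp: Bij_def bij_betw_def inv_into_into f_inv_into_f)
  have inj: "inj_on g C" using gB by (auto simp: Bij_def bij_betw_def)
  have 1: "?h (x \<oplus>\<^bsub>A\<^esub> y) = ?h x \<oplus>\<^bsub>A\<^esub> ?h y" if "x \<in> C" "y \<in> C" for x y
    using that h lin by (intro inv_into_f_eq[OF inj]) (auto simp: linear_endo_def)
  have 2: "?h (c \<odot>\<^bsub>A\<^esub> x) = c \<odot>\<^bsub>A\<^esub> ?h x" if "x \<in> C" for c x
    using that h lin by (intro inv_into_f_eq[OF inj]) (auto simp: linear_endo_def)
  have "linear_endo A (\<lambda>x\<in>C. ?h x)"
    using h 1 2 by (auto simp: linear_endo_def)
  then show "inv\<^bsub>BijGroup C\<^esub> g \<in> carrier (GL A)"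
    using gB by (simp add: inv_BijGroup GL_def restrict_inv_into_Bij)
next
  fix g h assume g: "g \<in> carrier (GL A)" and h: "h \<in> carrier (GL A)"
  have "linear_endo A (compose C g h)"
    using g h by (auto simp: linear_endo_def GL_def compose_def Pi_iff)
  then show "g \<otimes>\<^bsub>BijGroup C\<^esub> h \<in> carrier (GL A)"
    using g h by (auto simp: GL_def BijGroup_def compose_Bij)
qed

lemma group_GL: "Group.group (GL A)"
proof -
  have "GL A = BijGroup C \<lparr>carrier := carrier (GL A)\<rparr>" by (simp add: GL_def)
  then show ?thesis using group.subgroup_imp_group[OF group_BijGroup subgroup_GL] by simp
qed

sublocale GL: Group.group "GL A" by (rule group_GL)

abbreviation GL_comp (infixl "\<cdot>" 70)
  where "g \<cdot> h \<equiv> g \<otimes>\<^bsub>GL A\<^esub> h"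

abbreviation "ginv g \<equiv> inv\<^bsub>GL A\<^esub> g"

abbreviation A_mult (infixl "\<star>" 70)
  where "a \<star> b \<equiv> a \<otimes>\<^bsub>A\<^esub> b"

lemma GL_mult: "g \<in> carrier (GL A) \<Longrightarrow> h \<in> carrier (GL A) \<Longrightarrow> g \<cdot> h = compose C g h"
  by (auto simp: GL_def BijGroup_def)

lemma GL_mult_apply:
  "g \<in> carrier (GL A) \<Longrightarrow> h \<in> carrier (GL A) \<Longrightarrow> a \<in> C \<Longrightarrow> (g \<cdot> h) a = g (h a)"
  by (simp add: GL_mult compose_def)

lemma GL_one: "\<one>\<^bsub>GL A\<^esub> = (\<lambda>x\<in>C. x)"
  by (simp add: GL_def BijGroup_def)

lemma GL_linear: "g \<in> carrier (GL A) \<Longrightarrow> linear_endo A g"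
  by (simp add: GL_carrier_iff)

lemma GL_closed: "g \<in> carrier (GL A) \<Longrightarrow> a \<in> C \<Longrightarrow> g a \<in> C"
  by (rule linear_endo_closed[OF GL_linear])

lemma GL_inv_apply:
  assumes "g \<in> carrier (GL A)" "a \<in> C"
  shows "(ginv g) (g a) = a" "g ((ginv g) a) = a"
  using GL.l_inv[OF assms(1)] GL.r_inv[OF assms(1)] assms GL_mult_apply[of "ginv g" g a]
    GL_mult_apply[of g "ginv g" a] by (simp_all add: GL_one)

lemma GL_eqI:
  assumes "g \<in> carrier (GL A)" "h \<in> carrier (GL A)" "\<And>a. a \<in> C \<Longrightarrow> g a = h a"
  shows "g = h"
  using assms by (auto simp: GL_carrier_iff intro: extensionalityI)

text \<open>The usual way to exhibit elements of \<open>GL(A)\<close>: a two-sided inverse that is linear, but not necessarily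
extensional.\<close>

lemma GL_I:
  assumes "linear_endo A f" "linear_endo A f'" "f \<in> extensional C"
    and "\<And>a. a \<in> C \<Longrightarrow> f (f' a) = a" "\<And>a. a \<in> C \<Longrightarrow> f' (f a) = a"
  shows "f \<in> carrier (GL A)" "\<And>a. a \<in> C \<Longrightarrow> (ginv f) a = f' a"
proof -
  have cl: "\<And>a. a \<in> C \<Longrightarrow> f a \<in> C" "\<And>a. a \<in> C \<Longrightarrow> f' a \<in> C"
    using assms(1,2) by (auto simp: linear_endo_closed)
  have "bij_betw f C C"
    by (rule bij_betw_byWitness[where f' = f']) (use assms cl in auto)
  then show f: "f \<in> carrier (GL A)" using assms by (simp add: GL_carrier_iff)
  show "(ginv f) a = f' a" if "a \<in> C" for a
    using GL_inv_apply(1)[OF f cl(2)[OF that]] assms(4)[OF that] by simp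
qed

lemma Aut_eq: "Aut A = GL A \<lparr>carrier := carrier (Aut A)\<rparr>"
  by (simp add: Aut_def GL_def)

lemma Aut_iff:
  "g \<in> carrier (Aut A) \<longleftrightarrow> g \<in> carrier (GL A) \<and>
     (\<forall>a\<in>C. \<forall>b\<in>C. g (a \<star> b) = g a \<star> g b) \<and> g \<one>\<^bsub>A\<^esub> = \<one>\<^bsub>A\<^esub>"
  by (auto simp: Aut_def GL_def ring_hom_def linear_endo_def)

lemma Aut_GL: "g \<in> carrier (Aut A) \<Longrightarrow> g \<in> carrier (GL A)"
  by (simp add: Aut_iff)

lemma Aut_one: "g \<in> carrier (Aut A) \<Longrightarrow> g \<one>\<^bsub>A\<^esub> = \<one>\<^bsub>A\<^esub>"
  by (simp add: Aut_iff)

lemma Aut_mult: "g \<in> carrier (Aut A) \<Longrightarrow> a \<in> C \<Longrightarrow> b \<in> C \<Longrightarrow> g (a \<star> b) = g a \<star> g b"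
  by (simp add: Aut_iff)

text \<open>Bijectivity and multiplicativity force \<open>g 1 = 1\<close>: if \<open>g u = 1\<close>, then \<open>1 = g (1 u) = g 1\<close>.\<close>

lemma AutI:
  assumes g: "g \<in> carrier (GL A)"
    and "\<And>a b. a \<in> C \<Longrightarrow> b \<in> C \<Longrightarrow> g (a \<star> b) = g a \<star> g b"
  shows "g \<in> carrier (Aut A)"
proof -
  define u where "u = (ginv g) \<one>\<^bsub>A\<^esub>"
  have u: "u \<in> C" "g u = \<one>\<^bsub>A\<^esub>"
    using g GL_inv_apply(2)[OF g, of "\<one>\<^bsub>A\<^esub>"] by (simp_all add: u_def GL_closed)
  have "g (\<one>\<^bsub>A\<^esub> \<star> u) = g \<one>\<^bsub>A\<^esub> \<star> g u" using assms(2) u(1) by blast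
  then have "g \<one>\<^bsub>A\<^esub> = \<one>\<^bsub>A\<^esub>" using u GL_closed[OF g A.one_closed] by simp
  then show ?thesis using assms by (simp add: Aut_iff)
qed

lemma subgroup_Aut: "subgroup (carrier (Aut A)) (GL A)"
proof (rule GL.subgroupI)
  show "carrier (Aut A) \<subseteq> carrier (GL A)" using Aut_GL by blast
  have "\<one>\<^bsub>GL A\<^esub> \<in> carrier (Aut A)" by (rule AutI[OF GL.one_closed]) (simp add: GL_one)
  then show "carrier (Aut A) \<noteq> {}" by blast
next
  fix g assume g: "g \<in> carrier (Aut A)"
  let ?h = "ginv g"
  have h: "?h \<in> carrier (GL A)" using g by (simp add: Aut_GL)
  show "?h \<in> carrier (Aut A)"
  proof (rule AutI[OF h])
    fix a b assume ab: "a \<in> C" "b \<in> C"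
    have "g (?h a \<star> ?h b) = a \<star> b"
      using g ab h by (simp add: Aut_mult GL_closed GL_inv_apply Aut_GL)
    then show "?h (a \<star> b) = ?h a \<star> ?h b"
      using GL_inv_apply(1)[OF Aut_GL[OF g], of "?h a \<star> ?h b"] h ab by (simp add: GL_closed)
  qed
next
  fix g h assume "g \<in> carrier (Aut A)" "h \<in> carrier (Aut A)"
  then show "g \<cdot> h \<in> carrier (Aut A)"
    by (intro AutI) (auto simp: Aut_GL GL_mult_apply Aut_mult GL_closed)
qed

lemma group_Aut: "Group.group (Aut A)"
  using GL.subgroup_imp_group[OF subgroup_Aut] Aut_eq by simp

sublocale Aut: Group.group "Aut A" by (rule group_Aut)

lemma Aut_mult_eq: "g \<otimes>\<^bsub>Aut A\<^esub> h = g \<cdot> h"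
  by (simp add: Aut_def GL_def)

lemma Aut_inv_eq: "g \<in> carrier (Aut A) \<Longrightarrow> inv\<^bsub>Aut A\<^esub> g = ginv g"
  using GL.m_inv_consistent[OF subgroup_Aut] Aut_eq by simp

end

section \<open>Finite-dimensional quotients\<close>

locale artin_quotient = monomial_quotient S I
  for S :: "'n::finite monom set" and I :: "('n, 'k::field) mpoly set" +
  assumes fin: "finite (- S)"
    and vars: "Poly_Mapping.single i 1 \<notin> S"
begin

lemma zero_notin [simp]: "0 \<notin> S"
  using up[of 0 "Poly_Mapping.single i 1"] vars[of i] by auto

lemma expand: "a \<in> C \<Longrightarrow> a = cls (\<Sum>m\<in>- S. Poly_Mapping.single m (co m a))"
  by (rule co_eqI) (auto simp: co_cls lookup_sum lookup_single when_def fin sum.delta)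

lemma cls_single: "cls (Poly_Mapping.single m c) = c \<odot>\<^bsub>A\<^esub> e m"
  by (simp add: e_def xmon_def mult_single)

lemma linear_form_expand:
  assumes l: "linear_form A l" and a: "a \<in> C"
  shows "l a = (\<Sum>m\<in>- S. co m a * l (e m))"
proof -
  have "l a = l (cls (\<Sum>m\<in>- S. Poly_Mapping.single m (co m a)))" using expand[OF a] by simp
  also have "\<dots> = (\<Sum>m\<in>- S. l (cls (Poly_Mapping.single m (co m a))))"
    by (rule linear_form_sum[OF l fin])
  also have "\<dots> = (\<Sum>m\<in>- S. co m a * l (e m))"
    using l by (simp only: cls_single linear_form_def) simp
  finally show ?thesis .
qed

lemma linear_form_ext:
  assumes "linear_form A l" "linear_form A l'" "\<And>m. m \<notin> S \<Longrightarrow> l (e m) = l' (e m)" "a \<in> C"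
  shows "l a = l' a"
  unfolding linear_form_expand[OF assms(1,4)] linear_form_expand[OF assms(2,4)]
  by (rule sum.cong) (simp_all add: assms(3))

lemma linear_endo_ext:
  assumes "linear_endo A f" "linear_endo A g" "\<And>m. m \<notin> S \<Longrightarrow> f (e m) = g (e m)" "a \<in> C"
  shows "f a = g a"
proof (rule co_eqI)
  show "co m (f a) = co m (g a)" for m
    by (rule linear_form_ext[OF linear_form_comp linear_form_comp])
      (use assms linear_form_co in auto)
qed (use assms in \<open>auto simp: linear_endo_closed\<close>)

text \<open>Both sides are linear in each argument, so two applications of \<open>linear_endo_ext\<close> suffice.\<close>

lemma mult_basis:
  assumes f: "linear_endo A f"
    and *: "\<And>m m'. m \<notin> S \<Longrightarrow> m' \<notin> S \<Longrightarrow> f (e m \<star> e m') = f (e m) \<star> f (e m')"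
    and a: "a \<in> C" and b: "b \<in> C"
  shows "f (a \<star> b) = f a \<star> f b"
proof -
  have fe: "f x \<in> C" if "x \<in> C" for x using f that by (rule linear_endo_closed)
  have 1: "f (e m \<star> b) = f (e m) \<star> f b" if m: "m \<notin> S" for m
    by (rule linear_endo_ext[OF linear_endo_comp[OF f linear_endo_mult_left]
          linear_endo_comp[OF linear_endo_mult_left f]]) (simp_all add: m * b fe)
  show ?thesis
    by (rule linear_endo_ext[OF linear_endo_comp[OF f linear_endo_mult_right]
          linear_endo_comp[OF linear_endo_mult_right f]]) (simp_all add: 1 a b fe)
qed

definition mk :: "('n monom \<Rightarrow> 'k) \<Rightarrow> ('n, 'k) mpoly set"
  where "mk f = cls (\<Sum>m\<in>- S. Poly_Mapping.single m (f m))"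

lemma mk_closed [simp, intro]: "mk f \<in> C"
  by (simp add: mk_def)

lemma co_mk: "co m (mk f) = (if m \<in> S then 0 else f m)"
  by (auto simp: mk_def co_cls lookup_sum lookup_single when_def fin sum.delta)

text \<open>The endomorphism with a given matrix in the basis of standard monomials.\<close>

definition linmap :: "('n monom \<Rightarrow> 'n monom \<Rightarrow> 'k) \<Rightarrow> ('n, 'k) mpoly set \<Rightarrow> ('n, 'k) mpoly set"
  where "linmap M = (\<lambda>a\<in>C. mk (\<lambda>m'. \<Sum>m\<in>- S. M m' m * co m a))"

lemma linmap_linear: "linear_endo A (linmap M)"
proof (rule linear_endoI)
  fix x y c assume "x \<in> C" "y \<in> C"
  then show "linmap M (x \<oplus>\<^bsub>A\<^esub> y) = linmap M x \<oplus>\<^bsub>A\<^esub> linmap M y"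
    and "linmap M (c \<odot>\<^bsub>A\<^esub> x) = c \<odot>\<^bsub>A\<^esub> linmap M x"
    by (intro co_eqI; simp add: linmap_def co_mk sum.distrib distrib_left sum_distrib_left mult.left_commute)+
qed (simp add: linmap_def)

lemma linmap_ext [simp]: "linmap M \<in> extensional C"
  by (simp add: linmap_def)

lemma co_linmap_e: "m' \<notin> S \<Longrightarrow> m \<notin> S \<Longrightarrow> co m' (linmap M (e m)) = M m' m"
proof -
  assume m': "m' \<notin> S" and m: "m \<notin> S"
  have "co m' (linmap M (e m)) = (\<Sum>x\<in>- S. M m' x * co x (e m))"
    using m' by (simp add: linmap_def co_mk)
  also have "\<dots> = (\<Sum>x\<in>- S. if x = m then M m' m else 0)"
    by (rule sum.cong) (auto simp: co_e)
  also have "\<dots> = M m' m" using m fin by (simp add: sum.delta)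
  finally show ?thesis .
qed

lemma co_endo:
  assumes "linear_endo A f" "a \<in> C"
  shows "co m' (f a) = (\<Sum>m\<in>- S. co m a * co m' (f (e m)))"
  using linear_form_expand[OF linear_form_comp[OF linear_form_co assms(1)] assms(2)] .

lemma derivation_basis:
  assumes f: "linear_endo A f"
    and *: "\<And>m m'. m \<notin> S \<Longrightarrow> m' \<notin> S \<Longrightarrow>
      f (e m \<star> e m') = f (e m) \<star> e m' \<oplus>\<^bsub>A\<^esub> e m \<star> f (e m')"
  shows "derivation A f"
proof -
  have fe: "f x \<in> C" if "x \<in> C" for x using f that by (rule linear_endo_closed)
  have lin_add: "linear_endo A (\<lambda>x. p x \<oplus>\<^bsub>A\<^esub> q x)"
    if "linear_endo A p" "linear_endo A q" for p q
    using that by (intro linear_endoI co_eqI) (simp_all add: linear_endo_def Pi_iff algebra_simps)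
  have 1: "f (e m \<star> b) = f (e m) \<star> b \<oplus>\<^bsub>A\<^esub> e m \<star> f b"
    if m: "m \<notin> S" and b: "b \<in> C" for m b
    by (rule linear_endo_ext[OF linear_endo_comp[OF f linear_endo_mult_left]
          lin_add[OF linear_endo_mult_left linear_endo_comp[OF linear_endo_mult_left f]]])
      (simp_all add: m * b fe)
  have "f (a \<star> b) = f a \<star> b \<oplus>\<^bsub>A\<^esub> a \<star> f b" if a: "a \<in> C" and b: "b \<in> C" for a b
    by (rule linear_endo_ext[OF linear_endo_comp[OF f linear_endo_mult_right]
          lin_add[OF linear_endo_comp[OF linear_endo_mult_right f] linear_endo_mult_right]])
      (use a 1 b fe in auto)
  then show ?thesis using f by (simp add: derivation_def)
qed

end

context monomial_quotient begin

abbreviation "G \<equiv> carrier (GL A)"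

section \<open>The Zariski topology on the linear group\<close>

lemma regular_fun_sum:
  "finite F \<Longrightarrow> (\<And>i. i \<in> F \<Longrightarrow> f i \<in> regular_fun A) \<Longrightarrow> (\<lambda>g. \<Sum>i\<in>F. f i g) \<in> regular_fun A"
proof (induction F rule: finite_induct)
  case empty
  show ?case using regular_fun.const[of 0 A] by simp
next
  case (insert i F)
  then have "(\<lambda>g. f i g + (\<Sum>i\<in>F. f i g)) \<in> regular_fun A"
    by (intro regular_fun.add) simp_all
  then show ?case using insert by simp
qed

lemma regular_fun_prod:
  "finite F \<Longrightarrow> (\<And>i. i \<in> F \<Longrightarrow> f i \<in> regular_fun A) \<Longrightarrow> (\<lambda>g. \<Prod>i\<in>F. f i g) \<in> regular_fun A"
proof (induction F rule: finite_induct)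
  case empty
  show ?case using regular_fun.const[of 1 A] by simp
next
  case (insert i F)
  then have "(\<lambda>g. f i g * (\<Prod>i\<in>F. f i g)) \<in> regular_fun A"
    by (intro regular_fun.mult) simp_all
  then show ?case using insert by simp
qed

lemma regular_fun_power: "f \<in> regular_fun A \<Longrightarrow> (\<lambda>g. f g ^ n) \<in> regular_fun A"
proof (induction n)
  case 0
  show ?case using regular_fun.const[of 1 A] by simp
next
  case (Suc n)
  then show ?case using regular_fun.mult[of f A "\<lambda>g. f g ^ n"] by simp
qed

lemma regular_fun_uminus: "f \<in> regular_fun A \<Longrightarrow> (\<lambda>g. - f g) \<in> regular_fun A"
  using regular_fun.mult[OF regular_fun.const[of "-1"], of f A] by simp

lemma regular_fun_diff:
  "f \<in> regular_fun A \<Longrightarrow> h \<in> regular_fun A \<Longrightarrow> (\<lambda>g. f g - h g) \<in> regular_fun A"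
  using regular_fun.add[OF _ regular_fun_uminus, of f h] by simp

lemma topspace_zariski: "topspace (zariski A) = G"
proof -
  have "G \<in> {{g \<in> G. f g \<noteq> 0} |f. f \<in> regular_fun A}"
    by (rule CollectI, rule exI[of _ "\<lambda>_. 1"]) (simp add: regular_fun.const)
  then have "\<Union>{{g \<in> G. f g \<noteq> 0} |f. f \<in> regular_fun A} = G" by (intro equalityI Union_least Union_upper) auto
  then show ?thesis by (simp add: zariski_def topology_generated_by_topspace)
qed

text \<open>Nonvanishing loci are closed under finite intersections, since regular functions can be multiplied;
so they form a base of the topology and not only a subbase.\<close>

lemma openin_zariski:
  "openin (zariski A) U \<longleftrightarrow>
    U \<subseteq> G \<and> (\<forall>g\<in>U. \<exists>f\<in>regular_fun A. f g \<noteq> 0 \<and> (\<forall>x\<in>G. f x \<noteq> 0 \<longrightarrow> x \<in> U))"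
  (is "_ \<longleftrightarrow> ?R U")
proof
  assume "openin (zariski A) U"
  then have "generate_topology_on {{g \<in> G. f g \<noteq> 0} |f. f \<in> regular_fun A} U"
    by (simp add: zariski_def openin_topology_generated_by_iff)
  then show "?R U"
  proof (induction rule: generate_topology_on.induct)
    case (Int a b)
    show ?case
    proof (intro conjI ballI)
      show "a \<inter> b \<subseteq> G" using Int.IH by blast
      fix g assume "g \<in> a \<inter> b"
      then have "g \<in> a" "g \<in> b" by simp_all
      obtain f where f: "f \<in> regular_fun A" "f g \<noteq> 0" "\<forall>x\<in>G. f x \<noteq> 0 \<longrightarrow> x \<in> a"
        using bspec[OF conjunct2[OF Int.IH(1)] \<open>g \<in> a\<close>] by (elim bexE conjE)
      obtain h where h: "h \<in> regular_fun A" "h g \<noteq> 0" "\<forall>x\<in>G. h x \<noteq> 0 \<longrightarrow> x \<in> b"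
        using bspec[OF conjunct2[OF Int.IH(2)] \<open>g \<in> b\<close>] by (elim bexE conjE)
      show "\<exists>f\<in>regular_fun A. f g \<noteq> 0 \<and> (\<forall>x\<in>G. f x \<noteq> 0 \<longrightarrow> x \<in> a \<inter> b)"
        using f h by (intro bexI[OF _ regular_fun.mult[OF f(1) h(1)]]) simp
    qed
  next
    case (UN K)
    show ?case
    proof (intro conjI ballI Union_least)
      show "k \<subseteq> G" if "k \<in> K" for k using UN.IH[OF that] by simp
      fix g assume "g \<in> \<Union>K"
      then obtain k where k: "k \<in> K" "g \<in> k" by (elim UnionE)
      then obtain f where "f \<in> regular_fun A" "f g \<noteq> 0" "\<forall>x\<in>G. f x \<noteq> 0 \<longrightarrow> x \<in> k"
        using UN.IH by meson
      then show "\<exists>f\<in>regular_fun A. f g \<noteq> 0 \<and> (\<forall>x\<in>G. f x \<noteq> 0 \<longrightarrow> x \<in> \<Union>K)"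
        using k(1) by (intro bexI[of _ f] conjI ballI impI) (simp_all, metis)
    qed
  next
    case (Basis s)
    then obtain f where "f \<in> regular_fun A" "s = {g \<in> G. f g \<noteq> 0}"
      by (elim CollectE exE conjE)
    then show ?case by (intro conjI ballI bexI[of _ f]) simp_all
  qed simp
next
  assume R: "?R U"
  have "openin (zariski A) V"
    if V: "V \<in> {{g \<in> G. f g \<noteq> 0} |f. f \<in> regular_fun A \<and> {g \<in> G. f g \<noteq> 0} \<subseteq> U}" for V
  proof -
    obtain f where "V = {g \<in> G. f g \<noteq> 0}" "f \<in> regular_fun A"
      using V by (elim CollectE exE conjE)
    then show ?thesis unfolding zariski_def by (intro topology_generated_by_Basis CollectI exI[of _ f]) simp
  qed
  then have "openin (zariski A) (\<Union>{{g \<in> G. f g \<noteq> 0} |f. f \<in> regular_fun A \<and> {g \<in> G. f g \<noteq> 0} \<subseteq> U})"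
    by (rule openin_Union)
  moreover have "\<Union>{{g \<in> G. f g \<noteq> 0} |f. f \<in> regular_fun A \<and> {g \<in> G. f g \<noteq> 0} \<subseteq> U} = U"
  proof (intro equalityI Union_least subsetI)
    fix g assume g: "g \<in> U"
    then obtain f where f: "f \<in> regular_fun A" "f g \<noteq> 0" "\<forall>x\<in>G. f x \<noteq> 0 \<longrightarrow> x \<in> U"
      using R by meson
    have "g \<in> G" using R g by (meson subsetD)
    then have "g \<in> {g \<in> G. f g \<noteq> 0}" "{g \<in> G. f g \<noteq> 0} \<subseteq> U" using f by simp_all blast
    then show "g \<in> \<Union>{{g \<in> G. f g \<noteq> 0} |f. f \<in> regular_fun A \<and> {g \<in> G. f g \<noteq> 0} \<subseteq> U}"
      using f(1) by (intro UnionI[of "{g \<in> G. f g \<noteq> 0}"]) auto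
  qed auto
  ultimately show "openin (zariski A) U" by simp
qed

lemma closedin_zariski:
  "closedin (zariski A) K \<longleftrightarrow>
    K \<subseteq> G \<and> (\<forall>g\<in>G - K. \<exists>f\<in>regular_fun A. f g \<noteq> 0 \<and> (\<forall>x\<in>K. f x = 0))"
proof -
  have "(\<forall>x\<in>G. f x \<noteq> 0 \<longrightarrow> x \<in> G - K) \<longleftrightarrow> (\<forall>x\<in>K. f x = 0)" if "K \<subseteq> G" for f :: "_ \<Rightarrow> 'k"
    using that by blast
  then show ?thesis
    unfolding closedin_def topspace_zariski openin_zariski by (simp cong: conj_cong)
qed

lemma closedin_zeros:
  assumes "F \<subseteq> regular_fun A"
  shows "closedin (zariski A) {g \<in> G. \<forall>f\<in>F. f g = 0}"
  unfolding closedin_zariski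
proof (intro conjI ballI)
  fix g assume "g \<in> G - {g \<in> G. \<forall>f\<in>F. f g = 0}"
  then obtain f where "f \<in> F" "f g \<noteq> 0" by blast
  then show "\<exists>f\<in>regular_fun A. f g \<noteq> 0 \<and> (\<forall>x\<in>{g \<in> G. \<forall>f\<in>F. f g = 0}. f x = 0)"
    using assms by (intro bexI[of _ f]) (simp_all add: subset_iff)
qed simp

lemma continuous_map_zariski:
  assumes "\<And>g. g \<in> G \<Longrightarrow> \<phi> g \<in> G"
    and "\<And>f. f \<in> regular_fun A \<Longrightarrow> \<exists>f'\<in>regular_fun A. \<forall>g\<in>G. f' g = f (\<phi> g)"
  shows "continuous_map (zariski A) (zariski A) \<phi>"
  unfolding continuous_map_alt
proof (intro conjI allI impI)
  show "\<phi> \<in> topspace (zariski A) \<rightarrow> topspace (zariski A)"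
    using assms(1) by (simp add: topspace_zariski Pi_def)
  fix U assume U: "openin (zariski A) U"
  show "openin (zariski A) (\<phi> -` U \<inter> topspace (zariski A))"
    unfolding openin_zariski
  proof (intro conjI ballI)
    fix g assume g: "g \<in> \<phi> -` U \<inter> topspace (zariski A)"
    then have gG: "g \<in> G" and gU: "\<phi> g \<in> U" by (simp_all add: topspace_zariski)
    obtain f where f: "f \<in> regular_fun A" "f (\<phi> g) \<noteq> 0" "\<forall>x\<in>G. f x \<noteq> 0 \<longrightarrow> x \<in> U"
      using U gU unfolding openin_zariski by meson
    obtain f' where "f' \<in> regular_fun A" "\<forall>g\<in>G. f' g = f (\<phi> g)" using assms(2) f(1) by meson
    then show "\<exists>f\<in>regular_fun A. f g \<noteq> 0 \<and>
        (\<forall>x\<in>G. f x \<noteq> 0 \<longrightarrow> x \<in> \<phi> -` U \<inter> topspace (zariski A))"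
      using f gG assms(1) by (intro bexI[of _ f']) (simp_all add: topspace_zariski)
  qed (simp add: topspace_zariski)
qed

lemma regular_pullback:
  assumes f: "f \<in> regular_fun A"
    and 1: "\<And>l v. linear_form A l \<Longrightarrow> v \<in> C \<Longrightarrow> \<exists>f'\<in>regular_fun A. \<forall>g\<in>G. f' g = l (\<phi> g v)"
    and 2: "\<And>l v. linear_form A l \<Longrightarrow> v \<in> C \<Longrightarrow>
      \<exists>f'\<in>regular_fun A. \<forall>g\<in>G. f' g = l ((ginv (\<phi> g)) v)"
  shows "\<exists>f'\<in>regular_fun A. \<forall>g\<in>G. f' g = f (\<phi> g)"
  using f
proof induction
  case (const c)
  show ?case by (rule bexI[OF _ regular_fun.const[of c]]) simp
next
  case (add f k)
  then obtain f' k' where "f' \<in> regular_fun A" "\<forall>g\<in>G. f' g = f (\<phi> g)"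
    "k' \<in> regular_fun A" "\<forall>g\<in>G. k' g = k (\<phi> g)" by meson
  then show ?case by (intro bexI[OF _ regular_fun.add[of f' A k']]) simp_all
next
  case (mult f k)
  then obtain f' k' where "f' \<in> regular_fun A" "\<forall>g\<in>G. f' g = f (\<phi> g)"
    "k' \<in> regular_fun A" "\<forall>g\<in>G. k' g = k (\<phi> g)" by meson
  then show ?case by (intro bexI[OF _ regular_fun.mult[of f' A k']]) simp_all
qed (use 1 2 in simp_all)

lemma regular_left_translate:
  assumes h: "h \<in> G" and f: "f \<in> regular_fun A"
  shows "\<exists>f'\<in>regular_fun A. \<forall>g\<in>G. f' g = f (h \<cdot> g)"
proof (rule regular_pullback[OF f])
  fix l v assume lv: "linear_form A l" "v \<in> C"
  show "\<exists>f'\<in>regular_fun A. \<forall>g\<in>G. f' g = l ((h \<cdot> g) v)"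
    using h lv by (intro bexI[OF _ regular_fun.coeff[OF linear_form_comp[OF lv(1) GL_linear[OF h]] lv(2)]])
      (simp add: GL_mult_apply)
  have w: "(ginv h) v \<in> C" using lv h by (simp add: GL_closed)
  show "\<exists>f'\<in>regular_fun A. \<forall>g\<in>G. f' g = l ((ginv (h \<cdot> g)) v)"
    using h lv by (intro bexI[OF _ regular_fun.inv_coeff[OF lv(1) w]])
      (simp add: GL_mult_apply GL.inv_mult_group)
qed

lemma regular_inverse:
  assumes f: "f \<in> regular_fun A"
  shows "\<exists>f'\<in>regular_fun A. \<forall>g\<in>G. f' g = f (ginv g)"
proof (rule regular_pullback[OF f])
  fix l v assume lv: "linear_form A l" "v \<in> C"
  show "\<exists>f'\<in>regular_fun A. \<forall>g\<in>G. f' g = l ((ginv g) v)"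
    by (rule bexI[OF _ regular_fun.inv_coeff[OF lv]]) simp
  show "\<exists>f'\<in>regular_fun A. \<forall>g\<in>G. f' g = l ((ginv (ginv g)) v)"
    by (rule bexI[OF _ regular_fun.coeff[OF lv]]) simp
qed

lemma continuous_left:
  "h \<in> G \<Longrightarrow> continuous_map (zariski A) (zariski A) (\<lambda>g. h \<cdot> g)"
  by (rule continuous_map_zariski) (simp_all add: regular_left_translate)

lemma continuous_inverse:
  "continuous_map (zariski A) (zariski A) (\<lambda>g. ginv g)"
  by (rule continuous_map_zariski) (simp_all add: regular_inverse)

text \<open>Right translation is left translation conjugated by inversion.\<close>

lemma continuous_right:
  assumes h: "h \<in> G"
  shows "continuous_map (zariski A) (zariski A) (\<lambda>g. g \<cdot> h)"
proof (rule continuous_map_eq)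
  show "continuous_map (zariski A) (zariski A)
      ((\<lambda>g. ginv g) \<circ> ((\<lambda>g. ginv h \<cdot> g) \<circ> (\<lambda>g. ginv g)))"
    by (rule continuous_map_compose[OF continuous_map_compose[OF continuous_inverse
        continuous_left[OF GL.inv_closed[OF h]]] continuous_inverse])
qed (use h in \<open>simp add: topspace_zariski GL.inv_mult_group\<close>)

section \<open>Rational curves\<close>

text \<open>Quotients of two polynomials without poles on \<open>D\<close>; this covers polynomial curves as well as the
Laurent polynomials that occur on one-parameter subgroups of the torus.\<close>

definition rational_on :: "'k set \<Rightarrow> ('k \<Rightarrow> 'k) \<Rightarrow> bool"
  where "rational_on D \<phi> \<longleftrightarrow> (\<exists>p q. \<forall>s\<in>D. poly q s \<noteq> 0 \<and> poly q s * \<phi> s = poly p s)"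

lemma rational_on_add:
  assumes "rational_on D \<phi>" "rational_on D \<psi>"
  shows "rational_on D (\<lambda>s. \<phi> s + \<psi> s)"
proof -
  obtain p q p' q' where "\<forall>s\<in>D. poly q s \<noteq> 0 \<and> poly q s * \<phi> s = poly p s"
      "\<forall>s\<in>D. poly q' s \<noteq> 0 \<and> poly q' s * \<psi> s = poly p' s"
    using assms by (auto simp: rational_on_def)
  then have "\<forall>s\<in>D. poly (q * q') s \<noteq> 0 \<and> poly (q * q') s * (\<phi> s + \<psi> s) = poly (p * q' + p' * q) s"
    by (auto simp: algebra_simps)
  then show ?thesis unfolding rational_on_def by blast
qed

lemma rational_on_mult:
  assumes "rational_on D \<phi>" "rational_on D \<psi>"
  shows "rational_on D (\<lambda>s. \<phi> s * \<psi> s)"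
proof -
  obtain p q p' q' where *: "\<forall>s\<in>D. poly q s \<noteq> 0 \<and> poly q s * \<phi> s = poly p s"
      "\<forall>s\<in>D. poly q' s \<noteq> 0 \<and> poly q' s * \<psi> s = poly p' s"
    using assms by (auto simp: rational_on_def)
  have "\<forall>s\<in>D. poly (q * q') s \<noteq> 0 \<and> poly (q * q') s * (\<phi> s * \<psi> s) = poly (p * p') s"
  proof (intro ballI conjI)
    fix s assume s: "s \<in> D"
    have "poly (q * q') s * (\<phi> s * \<psi> s) = (poly q s * \<phi> s) * (poly q' s * \<psi> s)"
      by (simp add: mult.assoc mult.left_commute)
    then show "poly (q * q') s * (\<phi> s * \<psi> s) = poly (p * p') s" using * s by simp
  qed (use * in simp)
  then show ?thesis unfolding rational_on_def by blast
qed

lemma rational_on_poly: "(\<And>s. s \<in> D \<Longrightarrow> \<phi> s = poly p s) \<Longrightarrow> rational_on D \<phi>"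
  unfolding rational_on_def by (rule exI[of _ p], rule exI[of _ 1]) simp

lemma rational_on_sum:
  "finite F \<Longrightarrow> (\<And>i. i \<in> F \<Longrightarrow> rational_on D (\<phi> i)) \<Longrightarrow> rational_on D (\<lambda>s. \<Sum>i\<in>F. \<phi> i s)"
proof (induction F rule: finite_induct)
  case empty
  show ?case by (rule rational_on_poly[of _ _ 0]) simp
next
  case (insert i F)
  then have "rational_on D (\<lambda>s. \<phi> i s + (\<Sum>i\<in>F. \<phi> i s))" by (intro rational_on_add) simp_all
  then show ?case using insert by simp
qed

lemma rational_on_const: "rational_on D (\<lambda>s. c)"
  by (rule rational_on_poly[of _ _ "[:c:]"]) simp

lemma rational_curve:
  assumes "\<And>l v. linear_form A l \<Longrightarrow> v \<in> C \<Longrightarrow> rational_on D (\<lambda>s. l (\<gamma> s v))"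
    and "\<And>l v. linear_form A l \<Longrightarrow> v \<in> C \<Longrightarrow> rational_on D (\<lambda>s. l ((ginv (\<gamma> s)) v))"
    and "f \<in> regular_fun A"
  shows "rational_on D (\<lambda>s. f (\<gamma> s))"
  using assms(3)
  by induction (use assms(1,2) rational_on_add rational_on_mult rational_on_const in auto)

text \<open>Two open sets that meet the curve contain nonvanishing loci of regular functions; pulled back to the
parameter these have nonzero numerators, whose product has only finitely many roots. Hence the open
sets meet on the curve.\<close>

lemma connectedin_curve:
  assumes inf: "infinite D" and \<gamma>: "\<And>s. s \<in> D \<Longrightarrow> \<gamma> s \<in> G"
    and rat: "\<And>f. f \<in> regular_fun A \<Longrightarrow> rational_on D (\<lambda>s. f (\<gamma> s))"
  shows "connectedin (zariski A) (\<gamma> ` D)"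
  unfolding connectedin
proof (intro conjI notI)
  show "\<gamma> ` D \<subseteq> topspace (zariski A)" using \<gamma> by (auto simp: topspace_zariski)
  assume "\<exists>E1 E2. openin (zariski A) E1 \<and> openin (zariski A) E2 \<and> \<gamma> ` D \<subseteq> E1 \<union> E2 \<and>
      E1 \<inter> E2 \<inter> \<gamma> ` D = {} \<and> E1 \<inter> \<gamma> ` D \<noteq> {} \<and> E2 \<inter> \<gamma> ` D \<noteq> {}"
  then obtain E1 E2 where E: "openin (zariski A) E1" "openin (zariski A) E2"
    "E1 \<inter> E2 \<inter> \<gamma> ` D = {}" "E1 \<inter> \<gamma> ` D \<noteq> {}" "E2 \<inter> \<gamma> ` D \<noteq> {}" by (elim exE conjE) simp
  have *: "\<exists>p. p \<noteq> 0 \<and> (\<forall>s\<in>D. poly p s \<noteq> 0 \<longrightarrow> \<gamma> s \<in> E)"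
    if op: "openin (zariski A) E" and ne: "E \<inter> \<gamma> ` D \<noteq> {}" for E
  proof -
    obtain s where s: "s \<in> D" "\<gamma> s \<in> E" using ne by blast
    obtain f where f: "f \<in> regular_fun A" "f (\<gamma> s) \<noteq> 0" "\<forall>x\<in>G. f x \<noteq> 0 \<longrightarrow> x \<in> E"
      using op s(2) unfolding openin_zariski by meson
    obtain p q where pq: "\<forall>s\<in>D. poly q s \<noteq> 0 \<and> poly q s * f (\<gamma> s) = poly p s"
      using rat[OF f(1)] by (auto simp: rational_on_def)
    have "poly p s \<noteq> 0" using pq s(1) f(2) by (metis mult_eq_0_iff)
    then have "p \<noteq> 0" by auto
    moreover have "\<gamma> t \<in> E" if t: "t \<in> D" "poly p t \<noteq> 0" for t
    proof -
      have "f (\<gamma> t) \<noteq> 0" using t pq by (metis mult_zero_right)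
      then show ?thesis using f(3) \<gamma>[OF t(1)] by simp
    qed
    ultimately show ?thesis by blast
  qed
  obtain p1 p2 where p: "p1 \<noteq> 0" "\<forall>s\<in>D. poly p1 s \<noteq> 0 \<longrightarrow> \<gamma> s \<in> E1"
    "p2 \<noteq> 0" "\<forall>s\<in>D. poly p2 s \<noteq> 0 \<longrightarrow> \<gamma> s \<in> E2"
    using *[OF E(1,4)] *[OF E(2,5)] by meson
  have "finite {s. poly (p1 * p2) s = 0}" using p by (intro poly_roots_finite) simp
  then have "\<not> D \<subseteq> {s. poly (p1 * p2) s = 0}" using inf finite_subset by blast
  then obtain s where "s \<in> D" "poly (p1 * p2) s \<noteq> 0" by blast
  then have "\<gamma> s \<in> E1 \<inter> E2 \<inter> \<gamma> ` D" using p by simp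
  then show False using E(3) by simp
qed

section \<open>The identity component of a subgroup\<close>

lemma identity_component_maximal:
  assumes "connectedin (zariski A) K" "K \<subseteq> H" "\<one>\<^bsub>GL A\<^esub> \<in> K"
  shows "K \<subseteq> identity_component A H"
  unfolding identity_component_def
  by (rule connected_component_of_maximal) (simp_all add: connectedin_subtopology assms)

lemma
  assumes "subgroup H (GL A)"
  shows identity_component_connected: "connectedin (zariski A) (identity_component A H)"
    and identity_component_subset: "identity_component A H \<subseteq> H"
    and one_identity_component: "\<one>\<^bsub>GL A\<^esub> \<in> identity_component A H"
proof -
  have 1: "\<one>\<^bsub>GL A\<^esub> \<in> topspace (subtopology (zariski A) H)"
    using assms by (simp add: topspace_zariski subgroup.one_closed)
  have "connectedin (subtopology (zariski A) H) (identity_component A H)"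
    unfolding identity_component_def by (rule connectedin_connected_component_of)
  then show "connectedin (zariski A) (identity_component A H)" "identity_component A H \<subseteq> H"
    by (simp_all add: connectedin_subtopology)
  show "\<one>\<^bsub>GL A\<^esub> \<in> identity_component A H"
    unfolding identity_component_def using 1 by (simp add: connected_component_of_refl)
qed

text \<open>Left translation by \<open>h\<close> maps the component onto a connected set; when this set contains \<open>1\<close> it is
contained in the component.\<close>

lemma subgroup_identity_component:
  assumes H: "subgroup H (GL A)"
  shows "subgroup (identity_component A H) (GL A)"
proof (rule GL.subgroupI)
  note sub = identity_component_subset[OF H] and conn = identity_component_connected[OF H]
    and one = one_identity_component[OF H]
  have HG: "H \<subseteq> G" using H by (rule subgroup.subset)
  show "identity_component A H \<subseteq> G" using sub HG by simp
  show "identity_component A H \<noteq> {}" using one by blast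
  fix g assume g: "g \<in> identity_component A H"
  have gH: "g \<in> H" and gG: "g \<in> G" using g sub HG by blast+
  have 1: "(\<lambda>x. h \<cdot> x) ` identity_component A H \<subseteq> identity_component A H"
    if h: "h \<in> H" and one': "\<one>\<^bsub>GL A\<^esub> \<in> (\<lambda>x. h \<cdot> x) ` identity_component A H" for h
  proof (rule identity_component_maximal)
    have hG: "h \<in> G" using h HG by blast
    show "connectedin (zariski A) ((\<lambda>x. h \<cdot> x) ` identity_component A H)"
      by (rule connectedin_continuous_map_image[OF continuous_left[OF hG] conn])
    show "(\<lambda>x. h \<cdot> x) ` identity_component A H \<subseteq> H"
      using h sub H by (auto intro: subgroup.m_closed)
  qed (rule one')
  have "\<one>\<^bsub>GL A\<^esub> = ginv g \<cdot> g" using gG by simp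
  then have "\<one>\<^bsub>GL A\<^esub> \<in> (\<lambda>x. ginv g \<cdot> x) ` identity_component A H" using g by (rule image_eqI)
  then have *: "(\<lambda>x. ginv g \<cdot> x) ` identity_component A H \<subseteq> identity_component A H"
    using 1[of "ginv g"] gH H by (simp add: subgroup.m_inv_closed)
  have "ginv g \<cdot> \<one>\<^bsub>GL A\<^esub> \<in> identity_component A H"
    using * one by blast
  then show ig: "ginv g \<in> identity_component A H" using gG by simp
  have "\<one>\<^bsub>GL A\<^esub> = g \<cdot> ginv g" using gG by simp
  then have "\<one>\<^bsub>GL A\<^esub> \<in> (\<lambda>x. g \<cdot> x) ` identity_component A H" using ig by (rule image_eqI)
  then show "g \<cdot> h \<in> identity_component A H" if "h \<in> identity_component A H" for h
    using 1[OF gH] that by blast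
qed

lemma identity_component_conj:
  assumes H: "subgroup H (GL A)" and g: "g \<in> H" and h: "h \<in> identity_component A H"
  shows "g \<cdot> h \<cdot> ginv g \<in> identity_component A H"
proof -
  let ?\<phi> = "(\<lambda>x. x \<cdot> ginv g) \<circ> (\<lambda>x. g \<cdot> x)"
  have gG: "g \<in> G" using g H by (rule subgroup.mem_carrier[rotated])
  have "?\<phi> ` identity_component A H \<subseteq> identity_component A H"
  proof (rule identity_component_maximal)
    show "connectedin (zariski A) (?\<phi> ` identity_component A H)"
      using gG by (intro connectedin_continuous_map_image[OF
          continuous_map_compose[OF continuous_left continuous_right]
          identity_component_connected[OF H]]) simp_all
    show "?\<phi> ` identity_component A H \<subseteq> H"
    proof (intro image_subsetI)
      fix x assume "x \<in> identity_component A H"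
      then have "x \<in> H" using identity_component_subset[OF H] by blast
      then show "?\<phi> x \<in> H" using g H by (simp add: subgroup.m_closed subgroup.m_inv_closed)
    qed
    have "\<one>\<^bsub>GL A\<^esub> = ?\<phi> \<one>\<^bsub>GL A\<^esub>" using gG by simp
    then show "\<one>\<^bsub>GL A\<^esub> \<in> ?\<phi> ` identity_component A H"
      using one_identity_component[OF H] by (rule image_eqI)
  qed
  then have "?\<phi> h \<in> identity_component A H" using h by blast
  then show ?thesis by simp
qed

end

section \<open>Monomials\<close>

definition deg :: "'n::finite monom \<Rightarrow> nat"
  where "deg m = (\<Sum>i\<in>UNIV. lk m i)"

definition X1 :: "'n \<Rightarrow> 'n monom"
  where "X1 i = Poly_Mapping.single i 1"

lemma lookup_X1: "lk (X1 i) j = (if j = i then 1 else 0)"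
  by (simp add: X1_def lookup_single when_def)

lemma deg_add: "deg (m + m') = deg m + deg m'"
  by (simp add: deg_def lookup_add sum.distrib)

lemma deg_X1: "deg (X1 i) = 1"
  by (simp add: deg_def lookup_X1)

lemma deg_zero [simp]: "deg 0 = 0"
  by (simp add: deg_def)

lemma deg_eq_0_iff: "deg m = 0 \<longleftrightarrow> m = 0"
  by (auto simp: deg_def intro: poly_mapping_eqI)

lemma monom_minus: assumes "lk m i > 0" obtains m' where "m = X1 i + m'"
proof
  show "m = X1 i + (m - X1 i)"
    by (rule poly_mapping_eqI) (use assms in \<open>simp add: lookup_add lookup_minus lookup_X1\<close>)
qed

lemma deg_pos: "deg m \<noteq> 0 \<Longrightarrow> \<exists>i. lk m i > 0"
  by (rule ccontr) (simp add: deg_def)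

lemma monom_induct [case_names zero single]:
  fixes m :: "'n::finite monom"
  assumes "P 0" and "\<And>i m. P m \<Longrightarrow> P (X1 i + m)"
  shows "P m"
proof (induction "deg m" arbitrary: m)
  case 0
  then show ?case using assms(1) by (simp add: deg_eq_0_iff)
next
  case (Suc k)
  then have "\<exists>i. lk m i > 0" by (intro deg_pos) simp
  then obtain i m' where m: "m = X1 i + m'" by (elim exE) (erule monom_minus)
  then have "P m'" using Suc by (simp add: deg_add deg_X1)
  then show ?case using m assms(2) by simp
qed

lemma deg_one_iff: "deg m = 1 \<longleftrightarrow> (\<exists>i. m = X1 i)"
proof
  assume d: "deg m = 1"
  then have "\<exists>i. lk m i > 0" by (intro deg_pos) simp
  then obtain i m' where m: "m = X1 i + m'" by (elim exE) (erule monom_minus)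
  then have "m' = 0" using d by (simp add: deg_add deg_X1 deg_eq_0_iff)
  then show "\<exists>i. m = X1 i" using m by auto
qed (auto simp: deg_X1)

lemma X1_eq_iff: "X1 i = X1 j \<longleftrightarrow> i = j"
  by (metis lookup_X1 one_neq_zero)

text \<open>The value of the monomial with exponent \<open>m\<close> at the point \<open>c\<close>.\<close>

definition cmon :: "('n::finite \<Rightarrow> 'k::field) \<Rightarrow> 'n monom \<Rightarrow> 'k"
  where "cmon c m = (\<Prod>i\<in>UNIV. c i ^ lk m i)"

lemma cmon_add: "cmon c (m + m') = cmon c m * cmon c m'"
  by (simp add: cmon_def lookup_add power_add prod.distrib)

lemma cmon_zero [simp]: "cmon c 0 = 1"
  by (simp add: cmon_def)

lemma cmon_X1: "cmon c (X1 i) = c i"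
proof -
  have "cmon c (X1 i) = (\<Prod>j\<in>UNIV. if j = i then c j else 1)"
    unfolding cmon_def by (rule prod.cong) (auto simp: lookup_X1)
  then show ?thesis by (simp add: prod.delta)
qed

lemma cmon_mult: "cmon (\<lambda>i. c i * d i) m = cmon c m * cmon d m"
  by (simp add: cmon_def power_mult_distrib prod.distrib)

lemma cmon_one [simp]: "cmon (\<lambda>_. 1) m = 1"
  by (simp add: cmon_def)

lemma cmon_nonzero: "(\<And>i. c i \<noteq> 0) \<Longrightarrow> cmon c m \<noteq> 0"
  by (simp add: cmon_def)

lemma cmon_upd_one: "cmon ((\<lambda>_. 1)(i := s)) m = s ^ lk m i"
proof -
  have "cmon ((\<lambda>_. 1)(i := s)) m = (\<Prod>j\<in>UNIV. if j = i then s ^ lk m j else 1)"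
    unfolding cmon_def by (rule prod.cong) auto
  then show ?thesis by (simp add: prod.delta)
qed

section \<open>Characters of the split torus\<close>

lemma exp_lattice_UNIV [simp]: "exp_lattice UNIV = UNIV"
  by (simp add: exp_lattice_def)

text \<open>The character of \<open>\<int>\<^sup>n\<close> with prescribed values \<open>c i\<close> on the standard basis.\<close>

definition ichar :: "('n::finite \<Rightarrow> 'k::field) \<Rightarrow> ('n \<Rightarrow>\<^sub>0 int) \<Rightarrow> 'k"
  where "ichar c m = (\<Prod>i\<in>UNIV. c i powi lk m i)"

lemma ichar_in_torus: "(\<And>i. c i \<noteq> 0) \<Longrightarrow> ichar c \<in> carrier (split_torus UNIV)"
  by (simp add: split_torus_def ichar_def lookup_add power_int_add prod.distrib)

lemma ichar_single: "ichar c (Poly_Mapping.single i 1) = c i"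
proof -
  have "ichar c (Poly_Mapping.single i 1) = (\<Prod>j\<in>UNIV. if j = i then c j else 1)"
    unfolding ichar_def by (rule prod.cong) (auto simp: lookup_single when_def)
  then show ?thesis by (simp add: prod.delta)
qed

lemma torus_charD:
  assumes "t \<in> carrier (split_torus (UNIV :: 'n set))"
  shows "t (m + m') = t m * t m'" "t m \<noteq> 0" "t 0 = (1 :: 'k::field)" "t (- m) = inverse (t m)"
proof -
  show 1: "t (m + m') = t m * t m'" "t m \<noteq> 0" for m m' using assms by (simp_all add: split_torus_def)
  show 0: "t 0 = 1" using 1(1)[of 0 0] 1(2)[of 0] by simp
  show "t (- m) = inverse (t m)" using 1(1)[of m "- m"] 0 1(2)[of m] by (simp add: field_simps)
qed

lemma torus_char_single:
  assumes t: "t \<in> carrier (split_torus (UNIV :: 'n set))"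
  shows "t (Poly_Mapping.single i z) = (t (Poly_Mapping.single i 1) :: 'k::field) powi z"
proof (induction z rule: int_induct[of _ 0])
  case base
  show ?case using torus_charD(3)[OF t] by simp
next
  case (step1 z)
  have "t (Poly_Mapping.single i (z + 1)) = t (Poly_Mapping.single i z) * t (Poly_Mapping.single i 1)"
    using torus_charD(1)[OF t] by (simp add: single_add)
  then show ?case using step1 torus_charD(2)[OF t] by (simp add: power_int_add_1)
next
  case (step2 z)
  have "t (Poly_Mapping.single i (z - 1)) * t (Poly_Mapping.single i 1) = t (Poly_Mapping.single i z)"
    using torus_charD(1)[OF t, of "Poly_Mapping.single i (z - 1)" "Poly_Mapping.single i 1"]
    by (simp add: single_add[symmetric])
  moreover have "t (Poly_Mapping.single i 1) powi z =
      t (Poly_Mapping.single i 1) powi (z - 1) * t (Poly_Mapping.single i 1)"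
    using power_int_add_1[of "t (Poly_Mapping.single i 1)" "z - 1"] torus_charD(2)[OF t] by simp
  ultimately have "t (Poly_Mapping.single i (z - 1)) * t (Poly_Mapping.single i 1) =
      t (Poly_Mapping.single i 1) powi (z - 1) * t (Poly_Mapping.single i 1)"
    using step2 by argo
  then show ?case by (rule iffD1[OF mult_right_cancel[OF torus_charD(2)[OF t]]])
qed

lemma poly_mapping_expand:
  fixes m :: "'n::finite \<Rightarrow>\<^sub>0 'b::comm_monoid_add"
  shows "m = (\<Sum>i\<in>UNIV. Poly_Mapping.single i (lk m i))"
proof (rule poly_mapping_eqI)
  fix k
  have "lk (\<Sum>i\<in>UNIV. Poly_Mapping.single i (lk m i)) k = (\<Sum>i\<in>UNIV. if i = k then lk m i else 0)"
    by (simp add: lookup_sum lookup_single when_def)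
  also have "\<dots> = lk m k" by (subst sum.delta) simp_all
  finally show "lk m k = lk (\<Sum>i\<in>UNIV. Poly_Mapping.single i (lk m i)) k" ..
qed

text \<open>A point of the torus is determined by its values on the standard basis of \<open>\<int>\<^sup>n\<close>.\<close>

lemma torus_char_prod:
  fixes t :: "('n::finite \<Rightarrow>\<^sub>0 int) \<Rightarrow> 'k::field"
  assumes t: "t \<in> carrier (split_torus UNIV)"
  shows "t m = ichar (\<lambda>i. t (Poly_Mapping.single i 1)) m"
proof -
  define u where "u = (\<lambda>i. t (Poly_Mapping.single i 1))"
  have tu: "t (Poly_Mapping.single i z) = u i powi z" for i z
    unfolding u_def by (rule torus_char_single[OF t])
  have "t (\<Sum>i\<in>F. Poly_Mapping.single i (lk m i)) = (\<Prod>i\<in>F. u i powi lk m i)" if "finite F" for F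
    using that by (induction F rule: finite_induct) (simp_all add: torus_charD(1,3)[OF t] tu)
  from trans[OF arg_cong[OF poly_mapping_expand[of m], of t] this[OF finite, of UNIV]]
  show ?thesis unfolding ichar_def u_def .
qed

lemma torus_char_eqI:
  fixes t :: "('n::finite \<Rightarrow>\<^sub>0 int) \<Rightarrow> 'k::field"
  assumes "t \<in> carrier (split_torus UNIV)" "t' \<in> carrier (split_torus UNIV)"
    and "\<And>i. t (Poly_Mapping.single i 1) = t' (Poly_Mapping.single i 1)"
  shows "t = t'"
proof
  fix m
  have "t m = ichar (\<lambda>i. t (Poly_Mapping.single i 1)) m" by (rule torus_char_prod[OF assms(1)])
  also have "\<dots> = ichar (\<lambda>i. t' (Poly_Mapping.single i 1)) m" by (simp only: assms(3))
  also have "\<dots> = t' m" by (rule torus_char_prod[OF assms(2), symmetric])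
  finally show "t m = t' m" .
qed

lemma lookup_map_int: "lk (Poly_Mapping.map int m) i = int (lk m i)"
  by (simp add: Poly_Mapping.map.rep_eq when_def)

lemma torus_char_nat:
  fixes t :: "('n::finite \<Rightarrow>\<^sub>0 int) \<Rightarrow> 'k::field"
  assumes t: "t \<in> carrier (split_torus UNIV)"
  shows "t (Poly_Mapping.map int m) = cmon (\<lambda>i. t (Poly_Mapping.single i 1)) m"
  using torus_char_prod[OF t, of "Poly_Mapping.map int m"]
  by (simp add: ichar_def cmon_def lookup_map_int)

text \<open>Membership in the group algebra, without the restriction to the carrier that is built into
\<^const>\<open>split_torus_ring\<close>; this form is closed under pointwise operations.\<close>

definition laurent :: "((('n \<Rightarrow>\<^sub>0 int) \<Rightarrow> 'k::field) \<Rightarrow> 'k) \<Rightarrow> bool"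
  where "laurent \<phi> \<longleftrightarrow> (\<exists>M c. finite M \<and> (\<forall>t\<in>carrier (split_torus UNIV). \<phi> t = (\<Sum>m\<in>M. c m * t m)))"

lemma laurent_monomial: "laurent (\<lambda>t. c * t m)"
  unfolding laurent_def by (rule exI[of _ "{m}"], rule exI[of _ "\<lambda>_. c"]) simp

lemma laurent_cong:
  "laurent \<phi> \<Longrightarrow> (\<And>t. t \<in> carrier (split_torus UNIV) \<Longrightarrow> \<psi> t = \<phi> t) \<Longrightarrow> laurent \<psi>"
  by (simp add: laurent_def)

lemma laurent_add:
  assumes "laurent \<phi>" "laurent \<psi>"
  shows "laurent (\<lambda>t. \<phi> t + \<psi> t)"
proof -
  obtain M c N d where M: "finite M" "\<forall>t\<in>carrier (split_torus UNIV). \<phi> t = (\<Sum>m\<in>M. c m * t m)"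
    and N: "finite N" "\<forall>t\<in>carrier (split_torus UNIV). \<psi> t = (\<Sum>m\<in>N. d m * t m)"
    using assms unfolding laurent_def by blast
  let ?b = "\<lambda>m. (if m \<in> M then c m else 0) + (if m \<in> N then d m else 0)"
  have "\<phi> t + \<psi> t = (\<Sum>m\<in>M \<union> N. ?b m * t m)" if t: "t \<in> carrier (split_torus UNIV)" for t
  proof -
    have "(\<Sum>m\<in>M \<union> N. ?b m * t m) =
        (\<Sum>m\<in>M \<union> N. if m \<in> M then c m * t m else 0) + (\<Sum>m\<in>M \<union> N. if m \<in> N then d m * t m else 0)"
      by (simp add: sum.distrib[symmetric] distrib_right if_distrib[of "\<lambda>x. x * _"] cong: if_cong)
    also have "(\<Sum>m\<in>M \<union> N. if m \<in> M then c m * t m else 0) = \<phi> t"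
      unfolding M(2)[rule_format, OF t] using M(1) N(1) by (intro sum.mono_neutral_cong_right) auto
    also have "(\<Sum>m\<in>M \<union> N. if m \<in> N then d m * t m else 0) = \<psi> t"
      unfolding N(2)[rule_format, OF t] using M(1) N(1) by (intro sum.mono_neutral_cong_right) auto
    finally show ?thesis by simp
  qed
  then show ?thesis unfolding laurent_def using M(1) N(1) by (intro exI[of _ "M \<union> N"] exI[of _ ?b]) simp
qed

lemma laurent_sum:
  "finite F \<Longrightarrow> (\<And>i. i \<in> F \<Longrightarrow> laurent (\<phi> i)) \<Longrightarrow> laurent (\<lambda>t. \<Sum>i\<in>F. \<phi> i t)"
proof (induction F rule: finite_induct)
  case empty
  show ?case by (rule laurent_cong[OF laurent_monomial[of 0 0]]) simp
next
  case (insert i F)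
  then have "laurent (\<lambda>t. \<phi> i t + (\<Sum>i\<in>F. \<phi> i t))" by (intro laurent_add) simp_all
  then show ?case using insert by simp
qed

lemma laurent_mult:
  assumes "laurent \<phi>" "laurent \<psi>"
  shows "laurent (\<lambda>t. \<phi> t * \<psi> t)"
proof -
  obtain M c N d where M: "finite M" "\<forall>t\<in>carrier (split_torus UNIV). \<phi> t = (\<Sum>m\<in>M. c m * t m)"
    and N: "finite N" "\<forall>t\<in>carrier (split_torus UNIV). \<psi> t = (\<Sum>m\<in>N. d m * t m)"
    using assms unfolding laurent_def by blast
  have "laurent (\<lambda>t. \<Sum>m\<in>M. \<Sum>n\<in>N. (c m * d n) * t (m + n))"
    by (intro laurent_sum M(1) N(1) laurent_monomial)
  then show ?thesis
    by (rule laurent_cong)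
      (simp add: M N sum_product torus_charD(1) mult.assoc mult.left_commute)
qed

lemma split_torus_ring_UNIV:
  "split_torus_ring UNIV = {\<lambda>t\<in>carrier (split_torus UNIV). \<phi> t | \<phi>. laurent \<phi>}"
proof (intro equalityI subsetI)
  fix f :: "(('a \<Rightarrow>\<^sub>0 int) \<Rightarrow> 'b) \<Rightarrow> 'b"
  assume "f \<in> split_torus_ring UNIV"
  then obtain M c where f: "f = (\<lambda>t\<in>carrier (split_torus UNIV). (\<Sum>m\<in>M. c m * t m))" "finite M"
    unfolding split_torus_ring_def by blast
  then have "laurent (\<lambda>t. \<Sum>m\<in>M. c m * t m)" by (intro laurent_sum laurent_monomial)
  then show "f \<in> {\<lambda>t\<in>carrier (split_torus UNIV). \<phi> t | \<phi>. laurent \<phi>}" using f by blast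
next
  fix f :: "(('a \<Rightarrow>\<^sub>0 int) \<Rightarrow> 'b) \<Rightarrow> 'b"
  assume "f \<in> {\<lambda>t\<in>carrier (split_torus UNIV). \<phi> t | \<phi>. laurent \<phi>}"
  then obtain \<phi> M c where f: "f = (\<lambda>t\<in>carrier (split_torus UNIV). \<phi> t)" "finite M"
      "\<forall>t\<in>carrier (split_torus UNIV). \<phi> t = (\<Sum>m\<in>M. c m * t m)"
    unfolding laurent_def by blast
  then have "f = (\<lambda>t\<in>carrier (split_torus UNIV). (\<Sum>m\<in>M. c m * t m))"
    by (simp add: restrict_def fun_eq_iff)
  then show "f \<in> split_torus_ring UNIV" using f(2) unfolding split_torus_ring_def by auto
qed

context artin_quotient begin

section \<open>The torus acting on the quotient\<close>

abbreviation "xg i \<equiv> e (X1 i)"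

lemma X1_notin [simp]: "X1 i \<notin> S"
  using vars by (simp add: X1_def)

lemma smult_mult:
  assumes "a \<in> C" "b \<in> C"
  shows "(c \<odot>\<^bsub>A\<^esub> a) \<star> (d \<odot>\<^bsub>A\<^esub> b) = (c * d) \<odot>\<^bsub>A\<^esub> (a \<star> b)"
proof -
  obtain p q where "a = cls p" "b = cls q" using assms by (auto elim!: carrierE)
  moreover have "Poly_Mapping.single 0 c * p * (Poly_Mapping.single 0 d * q) = Poly_Mapping.single 0 (c * d) * (p * q)"
    using mult_single[of 0 c "0 :: 'n monom" d] by (simp add: ac_simps)
  ultimately show ?thesis by simp
qed

lemma Aut_eqI:
  assumes g: "g \<in> carrier (Aut A)" and h: "h \<in> carrier (Aut A)" and eq: "\<And>i. g (xg i) = h (xg i)"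
  shows "g = h"
proof (rule GL_eqI[OF Aut_GL[OF g] Aut_GL[OF h]])
  have "g (e m) = h (e m)" for m
  proof (induction m rule: monom_induct)
    case zero
    then show ?case using g h by (simp add: e_0 Aut_one)
  next
    case (single i m)
    then show ?case using g h eq by (simp add: e_mult[symmetric] Aut_mult)
  qed
  then show "g a = h a" if "a \<in> C" for a
    by (rule linear_endo_ext[OF GL_linear[OF Aut_GL[OF g]] GL_linear[OF Aut_GL[OF h]] _ that])
qed

text \<open>Multiplicativity of \<open>g\<close> is expressed by the vanishing of the coefficients of \<open>g (a b) - g a * g b\<close>,
which are polynomials in matrix coefficients.\<close>

lemma Aut_closed: "closedin (zariski A) (carrier (Aut A))"
proof -
  let ?F = "(\<lambda>(a, b, p) g. co p (g (a \<star> b)) - (\<Sum>(q, r)\<in>splits p. co q (g a) * co r (g b))) ` (C \<times> C \<times> - S)"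
  have *: "(\<lambda>g. co p (g (a \<star> b)) - (\<Sum>(q, r)\<in>splits p. co q (g a) * co r (g b))) \<in> regular_fun A"
    if "a \<in> C" "b \<in> C" for a b p
    unfolding case_prod_unfold using that
    by (intro regular_fun_diff regular_fun_sum regular_fun.mult regular_fun.coeff linear_form_co finite_splits)
      simp_all
  have "?F \<subseteq> regular_fun A"
    by (rule image_subsetI) (clarify, rule *, assumption+)
  moreover have "carrier (Aut A) = {g \<in> G. \<forall>f\<in>?F. f g = 0}"
  proof (intro equalityI subsetI CollectI conjI)
    fix g assume g: "g \<in> carrier (Aut A)"
    then show "g \<in> G" by (rule Aut_GL)
    show "\<forall>f\<in>?F. f g = 0"
      using g by (simp add: Aut_mult co_mult[symmetric] GL_closed Aut_GL)
  next
    fix g assume g: "g \<in> {g \<in> G. \<forall>f\<in>?F. f g = 0}"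
    show "g \<in> carrier (Aut A)"
    proof (rule AutI)
      fix a b assume ab: "a \<in> C" "b \<in> C"
      show "g (a \<star> b) = g a \<star> g b"
        using g ab by (intro co_eqI) (simp_all add: co_mult GL_closed)
    qed (use g in simp)
  qed
  ultimately show ?thesis using closedin_zeros[of ?F] by simp
qed

text \<open>The diagonal automorphism \<open>x\<^sub>i \<mapsto> c i * x\<^sub>i\<close>.\<close>

definition tor :: "('n \<Rightarrow> 'k) \<Rightarrow> ('n, 'k) mpoly set \<Rightarrow> ('n, 'k) mpoly set"
  where "tor c = (\<lambda>a\<in>C. mk (\<lambda>m. cmon c m * co m a))"

lemma co_tor: "a \<in> C \<Longrightarrow> co m (tor c a) = cmon c m * co m a"
  by (simp add: tor_def co_mk)

lemma tor_closed: "a \<in> C \<Longrightarrow> tor c a \<in> C"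
  by (simp add: tor_def)

lemma tor_linear: "linear_endo A (tor c)"
  by (intro linear_endoI co_eqI) (simp_all add: tor_closed co_tor algebra_simps)

lemma tor_e: "tor c (e m) = cmon c m \<odot>\<^bsub>A\<^esub> e m"
  by (rule co_eqI) (simp_all add: tor_closed co_tor co_e)

lemma tor_tor: "a \<in> C \<Longrightarrow> tor c (tor d a) = tor (\<lambda>i. c i * d i) a"
  by (rule co_eqI) (simp_all add: tor_closed co_tor cmon_mult)

lemma tor_one: "a \<in> C \<Longrightarrow> tor (\<lambda>_. 1) a = a"
  by (rule co_eqI) (simp_all add: tor_closed co_tor)

lemma
  assumes "\<And>i. c i \<noteq> 0"
  shows tor_GL: "tor c \<in> G"
    and tor_inv: "a \<in> C \<Longrightarrow> (ginv (tor c)) a = tor (\<lambda>i. inverse (c i)) a"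
proof -
  have ext: "tor c \<in> extensional C" by (simp add: tor_def)
  have 1: "tor c (tor (\<lambda>i. inverse (c i)) a) = a" "tor (\<lambda>i. inverse (c i)) (tor c a) = a" if "a \<in> C" for a
    using that assms by (simp_all add: tor_tor tor_one)
  show "tor c \<in> G" by (rule GL_I(1)[OF tor_linear tor_linear ext 1])
  show "a \<in> C \<Longrightarrow> (ginv (tor c)) a = tor (\<lambda>i. inverse (c i)) a"
    by (rule GL_I(2)[OF tor_linear tor_linear ext 1])
qed

lemma tor_inv_eq:
  assumes "\<And>i. c i \<noteq> 0"
  shows "ginv (tor c) = tor (\<lambda>i. inverse (c i))"
  using assms by (intro GL_eqI) (simp_all add: tor_GL tor_inv)

lemma tor_Aut: assumes "\<And>i. c i \<noteq> 0" shows "tor c \<in> carrier (Aut A)"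
proof (rule AutI)
  show "tor c \<in> G" using assms by (rule tor_GL)
  have "tor c (e m \<star> e m') = tor c (e m) \<star> tor c (e m')" for m m'
    by (simp add: e_mult tor_e smult_mult cmon_add)
  then show "tor c (a \<star> b) = tor c a \<star> tor c b" if "a \<in> C" "b \<in> C" for a b
    by (rule mult_basis[OF tor_linear _ that])
qed

lemma tor_mult:
  "(\<And>i. c i \<noteq> 0) \<Longrightarrow> (\<And>i. d i \<noteq> 0) \<Longrightarrow> tor c \<cdot> tor d = tor (\<lambda>i. c i * d i)"
  by (rule GL_eqI) (simp_all add: tor_GL GL_mult_apply tor_tor)

lemma tor_one_eq: "tor (\<lambda>_. 1) = \<one>\<^bsub>GL A\<^esub>"
  by (rule GL_eqI) (simp_all add: tor_GL tor_one, simp add: GL_one)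

lemma torus_action_eq:
  assumes t: "t \<in> carrier (split_torus UNIV)"
  shows "torus_action I t = tor (\<lambda>i. t (Poly_Mapping.single i 1))"
proof -
  let ?f = "Poly_Mapping.mapp (\<lambda>m c. t (Poly_Mapping.map int m) * c) :: ('n, 'k) mpoly \<Rightarrow> _"
  have lkf: "lk (?f p) m = t (Poly_Mapping.map int m) * lk p m" for p m
    by (simp add: lookup_mapp when_def in_keys_iff)
  have "torus_action I t a = tor (\<lambda>i. t (Poly_Mapping.single i 1)) a" if a: "a \<in> C" for a
  proof -
    obtain p where p: "a = cls p" using a by (rule carrierE)
    have co_f: "co m (cls (?f p)) = cmon (\<lambda>i. t (Poly_Mapping.single i 1)) m * co m (cls p)" for m
      unfolding torus_char_nat[OF t, symmetric]
      by (simp only: co_cls lkf mult_zero_right split: if_split) simp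
    have "torus_action I t a = cls (?f p)"
      unfolding torus_action_def induced_map_def p
      by (simp, rule UN_cls_eq) (simp_all add: I_iff lookup_minus lkf lookup_add)
    also have "\<dots> = tor (\<lambda>i. t (Poly_Mapping.single i 1)) a"
      unfolding p by (rule co_eqI) (simp_all only: tor_closed cls_closed co_tor co_f)
    finally show ?thesis .
  qed
  moreover have "torus_action I t \<in> extensional C" "tor (\<lambda>i. t (Poly_Mapping.single i 1)) \<in> extensional C"
    by (simp_all add: torus_action_def induced_map_def tor_def)
  ultimately show ?thesis by (intro extensionalityI) simp_all
qed

abbreviation "T \<equiv> torus_image I"

lemma torus_image_eq: "T = {tor c | c. \<forall>i. c i \<noteq> 0}"
proof (intro equalityI subsetI)
  fix g assume "g \<in> T"
  then obtain t where "t \<in> carrier (split_torus UNIV)" "g = torus_action I t"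
    unfolding torus_image_def by (elim imageE)
  then show "g \<in> {tor c | c. \<forall>i. c i \<noteq> 0}"
    by (intro CollectI exI[of _ "\<lambda>i. t (Poly_Mapping.single i 1)"]) (simp add: torus_action_eq torus_charD(2))
next
  fix g assume "g \<in> {tor c | c. \<forall>i. c i \<noteq> 0}"
  then obtain c where c: "g = tor c" "\<forall>i. c i \<noteq> 0" by (elim CollectE exE conjE)
  then have "g = torus_action I (ichar c)" by (simp add: torus_action_eq ichar_in_torus ichar_single)
  then show "g \<in> T" unfolding torus_image_def using c(2) ichar_in_torus[of c] by (intro image_eqI[of _ _ "ichar c"]) simp_all
qed

lemma torI: "(\<And>i. c i \<noteq> 0) \<Longrightarrow> tor c \<in> T"
  unfolding torus_image_eq by (intro CollectI exI[of _ c]) simp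

lemma torE: assumes "g \<in> T" obtains c where "g = tor c" "\<And>i. c i \<noteq> 0"
  using assms unfolding torus_image_eq by (elim CollectE exE conjE) simp

lemma T_Aut: "g \<in> T \<Longrightarrow> g \<in> carrier (Aut A)"
  by (elim torE) (simp add: tor_Aut)

lemma T_GL: "g \<in> T \<Longrightarrow> g \<in> G"
  by (simp add: T_Aut Aut_GL)

lemma subgroup_T: "subgroup T (GL A)"
proof (rule GL.subgroupI)
  show "T \<subseteq> G" using T_GL by (rule subsetI)
  have "tor (\<lambda>_. 1) \<in> T" by (rule torI) simp
  then show "T \<noteq> {}" by (metis empty_iff)
  show "ginv g \<in> T" if "g \<in> T" for g
    using that by (elim torE) (simp add: tor_inv_eq torI)
  show "g \<cdot> h \<in> T" if "g \<in> T" "h \<in> T" for g h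
    using that by (elim torE) (simp add: tor_mult torI)
qed

text \<open>The diagonal entries cannot vanish, because \<open>g\<close> is injective and the variables are nonzero in \<open>A\<close>.\<close>

lemma Aut_diag_in_T:
  assumes g: "g \<in> carrier (Aut A)" and d: "\<And>i m. m \<notin> S \<Longrightarrow> m \<noteq> X1 i \<Longrightarrow> co m (g (xg i)) = 0"
  shows "g \<in> T"
proof -
  let ?c = "\<lambda>i. co (X1 i) (g (xg i))"
  have gx: "g (xg i) = ?c i \<odot>\<^bsub>A\<^esub> xg i" for i
    by (rule co_eqI) (use d g in \<open>simp_all add: GL_closed Aut_GL co_e\<close>)
  have c: "?c i \<noteq> 0" for i
  proof
    assume "?c i = 0"
    then have "g (xg i) = \<zero>\<^bsub>A\<^esub>" using gx[of i] by (intro co_eqI) (simp_all add: GL_closed Aut_GL g)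
    then have "xg i = \<zero>\<^bsub>A\<^esub>"
      using GL_inv_apply(1)[OF Aut_GL[OF g], of "xg i"] g by (simp add: linear_endo_zero GL_linear Aut_GL)
    then show False by (simp add: e_zero_iff)
  qed
  have "g = tor ?c"
    by (rule Aut_eqI[OF g tor_Aut]) (use c gx in \<open>simp_all add: tor_e cmon_X1\<close>)
  then show ?thesis using c torI[of ?c] by simp
qed

lemma T_closed: "closedin (zariski A) T"
proof -
  let ?F = "(\<lambda>(i, m) g. co m (g (xg i))) ` {(i, m). m \<notin> S \<and> m \<noteq> X1 i}"
  have "?F \<subseteq> regular_fun A"
    by (rule image_subsetI) (clarify, intro regular_fun.coeff linear_form_co e_closed)
  then have "closedin (zariski A) (carrier (Aut A) \<inter> {g \<in> G. \<forall>f\<in>?F. f g = 0})"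
    by (intro closedin_Int Aut_closed closedin_zeros)
  moreover have "carrier (Aut A) \<inter> {g \<in> G. \<forall>f\<in>?F. f g = 0} = T"
  proof (intro equalityI subsetI)
    fix g assume "g \<in> carrier (Aut A) \<inter> {g \<in> G. \<forall>f\<in>?F. f g = 0}"
    then show "g \<in> T" by (intro Aut_diag_in_T) auto
  next
    fix g assume g: "g \<in> T"
    then obtain c where "g = tor c" by (rule torE)
    then show "g \<in> carrier (Aut A) \<inter> {g \<in> G. \<forall>f\<in>?F. f g = 0}"
      using g by (auto simp: T_Aut T_GL co_tor co_e)
  qed
  ultimately show ?thesis by simp
qed

lemma torus_iso: "torus_action I \<in> iso (split_torus UNIV) (GL A\<lparr>carrier := T\<rparr>)"
proof (rule isoI)
  let ?Sp = "split_torus UNIV :: (('n \<Rightarrow>\<^sub>0 int) \<Rightarrow> 'k) monoid"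
  show "torus_action I \<in> hom ?Sp (GL A\<lparr>carrier := T\<rparr>)"
  proof (rule homI)
    show "torus_action I t \<in> carrier (GL A\<lparr>carrier := T\<rparr>)" if "t \<in> carrier ?Sp" for t
      using that by (simp add: torus_image_def)
    fix s t assume s: "s \<in> carrier ?Sp" and t: "t \<in> carrier ?Sp"
    then have st: "s \<otimes>\<^bsub>?Sp\<^esub> t \<in> carrier ?Sp" and eq: "s \<otimes>\<^bsub>?Sp\<^esub> t = (\<lambda>m. s m * t m)"
      by (simp_all add: split_torus_def restrict_UNIV)
    show "torus_action I (s \<otimes>\<^bsub>?Sp\<^esub> t) =
        torus_action I s \<otimes>\<^bsub>GL A\<lparr>carrier := T\<rparr>\<^esub> torus_action I t"
      using torus_action_eq[OF s] torus_action_eq[OF t] torus_action_eq[OF st]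
        torus_charD(2)[OF s] torus_charD(2)[OF t] by (simp add: eq tor_mult)
  qed
  show "bij_betw (torus_action I) (carrier ?Sp) (carrier (GL A\<lparr>carrier := T\<rparr>))"
  proof (rule bij_betwI')
    fix s t assume s: "s \<in> carrier ?Sp" and t: "t \<in> carrier ?Sp"
    show "torus_action I s = torus_action I t \<longleftrightarrow> s = t"
    proof
      assume eq: "torus_action I s = torus_action I t"
      show "s = t"
      proof (rule torus_char_eqI[OF s t])
        fix i
        have "co (X1 i) (torus_action I s (xg i)) = co (X1 i) (torus_action I t (xg i))" by (simp add: eq)
        then show "s (Poly_Mapping.single i 1) = t (Poly_Mapping.single i 1)"
          by (simp add: torus_action_eq s t co_tor cmon_X1 co_e)
      qed
    qed simp
  qed (auto simp: torus_image_def)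
qed

lemma laurent_pullback:
  assumes "f \<in> regular_fun A"
  shows "laurent (\<lambda>t. f (torus_action I t))"
  using assms
proof induction
  case (const c)
  show ?case by (rule laurent_cong[OF laurent_monomial[of c 0]]) (simp add: torus_charD(3))
next
  case (coeff l v)
  have "laurent (\<lambda>t. \<Sum>m\<in>- S. (co m v * l (e m)) * t (Poly_Mapping.map int m))"
    by (intro laurent_sum fin laurent_monomial)
  then show ?case
  proof (rule laurent_cong)
    fix t :: "('n \<Rightarrow>\<^sub>0 int) \<Rightarrow> 'k" assume t: "t \<in> carrier (split_torus UNIV)"
    show "l (torus_action I t v) = (\<Sum>m\<in>- S. (co m v * l (e m)) * t (Poly_Mapping.map int m))"
      using linear_form_expand[OF coeff(1) tor_closed[OF coeff(2)]] coeff(2)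
      by (simp add: torus_action_eq[OF t] co_tor torus_char_nat[OF t] mult_ac)
  qed
next
  case (inv_coeff l v)
  have "laurent (\<lambda>t. \<Sum>m\<in>- S. (co m v * l (e m)) * t (- Poly_Mapping.map int m))"
    by (intro laurent_sum fin laurent_monomial)
  then show ?case
  proof (rule laurent_cong)
    fix t :: "('n \<Rightarrow>\<^sub>0 int) \<Rightarrow> 'k" assume t: "t \<in> carrier (split_torus UNIV)"
    have i: "cmon (\<lambda>i. inverse (t (Poly_Mapping.single i 1))) m = t (- Poly_Mapping.map int m)" for m
      by (simp add: torus_charD(4)[OF t] torus_char_nat[OF t] cmon_def power_inverse prod_inversef[symmetric])
    show "l ((ginv (torus_action I t)) v) = (\<Sum>m\<in>- S. (co m v * l (e m)) * t (- Poly_Mapping.map int m))"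
      using linear_form_expand[OF inv_coeff(1) tor_closed[OF inv_coeff(2)]] inv_coeff(2)
      by (simp add: torus_action_eq[OF t] tor_inv torus_charD(2)[OF t] co_tor i mult_ac)
  qed
qed (simp_all add: laurent_add laurent_mult)

text \<open>The coordinate \<open>t(e\<^sub>i)\<close> is the matrix coefficient of \<open>x\<^sub>i\<close>, and its inverse is the same coefficient of
the inverse; a general character is a monomial in these.\<close>

lemma character_regular:
  "\<exists>f\<in>regular_fun A. \<forall>t\<in>carrier (split_torus UNIV). f (torus_action I t) = t m"
proof
  let ?u = "\<lambda>i g. if 0 \<le> lk m i then co (X1 i) (g (xg i)) ^ nat (lk m i)
      else co (X1 i) ((ginv g) (xg i)) ^ nat (- lk m i)"
  have "?u i \<in> regular_fun A" for i
    by (cases "0 \<le> lk m i")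
      (simp_all add: regular_fun_power regular_fun.coeff regular_fun.inv_coeff linear_form_co)
  then show "(\<lambda>g. \<Prod>i\<in>UNIV. ?u i g) \<in> regular_fun A"
    by (intro regular_fun_prod) simp_all
  show "\<forall>t\<in>carrier (split_torus UNIV). (\<Prod>i\<in>UNIV. ?u i (torus_action I t)) = t m"
  proof
    fix t :: "('n \<Rightarrow>\<^sub>0 int) \<Rightarrow> 'k" assume t: "t \<in> carrier (split_torus UNIV)"
    have "?u i (torus_action I t) = t (Poly_Mapping.single i 1) powi lk m i" for i
      by (simp add: torus_action_eq[OF t] tor_inv torus_charD(2)[OF t] co_tor co_e cmon_X1 power_int_def power_inverse)
    then show "(\<Prod>i\<in>UNIV. ?u i (torus_action I t)) = t m"
      using torus_char_prod[OF t, of m] by (simp add: ichar_def)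
  qed
qed

lemma torus_alg_group_iso:
  "alg_group_iso (split_torus UNIV) (split_torus_ring UNIV) (GL A\<lparr>carrier := T\<rparr>) (coord_ring A T) (torus_action I)"
  unfolding alg_group_iso_def
proof (intro conjI torus_iso)
  let ?Sp = "carrier (split_torus UNIV) :: (('n \<Rightarrow>\<^sub>0 int) \<Rightarrow> 'k) set"
  have tT: "torus_action I t \<in> T" if "t \<in> ?Sp" for t using that by (simp add: torus_image_def)
  show "split_torus_ring UNIV = {\<lambda>x\<in>?Sp. f (torus_action I x) |f. f \<in> coord_ring A T}"
    unfolding split_torus_ring_UNIV
  proof (intro equalityI subsetI)
    fix f assume "f \<in> {\<lambda>t\<in>?Sp. \<phi> t | \<phi>. laurent \<phi>}"
    then obtain \<phi> M c where f: "f = (\<lambda>t\<in>?Sp. \<phi> t)" "finite M"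
        "\<forall>t\<in>?Sp. \<phi> t = (\<Sum>m\<in>M. c m * t m)"
      unfolding laurent_def by blast
    obtain F where F: "\<And>m. F m \<in> regular_fun A" "\<And>m t. t \<in> ?Sp \<Longrightarrow> F m (torus_action I t) = t m"
      using character_regular by metis
    let ?g = "\<lambda>g. \<Sum>m\<in>M. c m * F m g"
    have g: "?g \<in> regular_fun A"
      by (intro regular_fun_sum regular_fun.mult regular_fun.const F(1) f(2))
    have "f = (\<lambda>x\<in>?Sp. restrict ?g T (torus_action I x))"
      unfolding f(1) by (rule restrict_ext) (simp add: f(3) F(2) tT)
    then show "f \<in> {\<lambda>x\<in>?Sp. f (torus_action I x) |f. f \<in> coord_ring A T}"
      using g unfolding coord_ring_def by (intro CollectI exI[of _ "restrict ?g T"] conjI exI[of _ ?g]) simp_all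
  next
    fix f assume "f \<in> {\<lambda>x\<in>?Sp. f (torus_action I x) |f. f \<in> coord_ring A T}"
    then obtain g where g: "g \<in> regular_fun A" "f = (\<lambda>x\<in>?Sp. restrict g T (torus_action I x))"
      unfolding coord_ring_def by (elim CollectE exE conjE) simp
    have "f = (\<lambda>x\<in>?Sp. g (torus_action I x))"
      unfolding g(2) by (rule restrict_ext) (simp add: tT)
    then show "f \<in> {\<lambda>t\<in>?Sp. \<phi> t | \<phi>. laurent \<phi>}"
      using laurent_pullback[OF g(1)] by (intro CollectI exI[of _ "\<lambda>x. g (torus_action I x)"]) simp
  qed
qed

end

section \<open>Exponentials of nilpotent derivations\<close>

text \<open>Reindexes a finite double sum by antidiagonals; the range \<open>2 * N\<close> is large enough to contain every
antidiagonal that meets the square.\<close>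

lemma sum_square_triangle:
  fixes B :: "nat \<Rightarrow> nat \<Rightarrow> 'a::comm_monoid_add"
  assumes "\<And>i j. N \<le> i \<or> N \<le> j \<Longrightarrow> B i j = 0"
  shows "(\<Sum>i<N. \<Sum>j<N. B i j) = (\<Sum>n<2 * N. \<Sum>i\<le>n. B i (n - i))"
proof -
  have fin: "finite {(i, j). i + j < 2 * N}"
    by (rule finite_subset[of _ "{..<2 * N} \<times> {..<2 * N}"]) auto
  have "(\<Sum>i<N. \<Sum>j<N. B i j) = (\<Sum>(i, j)\<in>{..<N} \<times> {..<N}. B i j)"
    by (rule sum.cartesian_product)
  also have "\<dots> = (\<Sum>(i, j)\<in>{(i, j). i + j < 2 * N}. B i j)"
  proof (rule sum.mono_neutral_left[OF fin])
    have "i < N \<and> j < N" if "B i j \<noteq> 0" for i j using assms[of i j] that by (meson not_le)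
    then show "\<forall>x\<in>{(i, j). i + j < 2 * N} - {..<N} \<times> {..<N}. (case x of (i, j) \<Rightarrow> B i j) = 0"
      by fastforce
  qed auto
  also have "\<dots> = (\<Sum>n<2 * N. \<Sum>i\<le>n. B i (n - i))" by (rule sum.triangle_reindex)
  finally show ?thesis .
qed

context artin_quotient begin

lemma linear_endo_of_forms:
  assumes "\<And>a. a \<in> C \<Longrightarrow> f a \<in> C" "\<And>m. linear_form A (\<lambda>a. co m (f a))"
  shows "linear_endo A f"
proof (intro linear_endoI co_eqI)
  fix x y m c assume xy: "x \<in> C" "y \<in> C"
  show "co m (f (x \<oplus>\<^bsub>A\<^esub> y)) = co m (f x \<oplus>\<^bsub>A\<^esub> f y)"
    using assms(2)[of m] xy assms(1) by (simp add: linear_form_def)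
  show "co m (f (c \<odot>\<^bsub>A\<^esub> x)) = co m (c \<odot>\<^bsub>A\<^esub> f x)"
    using assms(2)[of m] xy assms(1) by (simp add: linear_form_def)
qed (simp_all add: assms(1))

lemma linear_form_sum_fun:
  assumes "finite F" "\<And>i. i \<in> F \<Longrightarrow> linear_form A (l i)"
  shows "linear_form A (\<lambda>a. \<Sum>i\<in>F. l i a)"
  using assms by (simp add: linear_form_def sum.distrib sum_distrib_left)

lemma linear_form_finsum:
  assumes l: "linear_form A l" and "finite F" and "\<And>i. i \<in> F \<Longrightarrow> f i \<in> C"
  shows "l (\<Oplus>\<^bsub>A\<^esub>i\<in>F. f i) = (\<Sum>i\<in>F. l (f i))"
  using assms(2,3)
proof (induction F rule: finite_induct)
  case empty
  show ?case by (simp add: linear_form_zero[OF l])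
next
  case (insert i F)
  have cl: "(\<Oplus>\<^bsub>A\<^esub>i\<in>F. f i) \<in> C" using insert by (intro A.finsum_closed) simp
  have "(\<Oplus>\<^bsub>A\<^esub>i\<in>insert i F. f i) = f i \<oplus>\<^bsub>A\<^esub> (\<Oplus>\<^bsub>A\<^esub>i\<in>F. f i)"
    using insert by (intro A.finsum_insert) simp_all
  then have "l (\<Oplus>\<^bsub>A\<^esub>i\<in>insert i F. f i) = l (f i) + l (\<Oplus>\<^bsub>A\<^esub>i\<in>F. f i)"
    using l cl insert.prems by (simp add: linear_form_def)
  then show ?case using insert by simp
qed

lemma linear_endo_funpow: "linear_endo A D \<Longrightarrow> linear_endo A (D ^^ i)"
proof (induction i)
  case 0
  then show ?case using linear_endo_id by (simp add: id_def)
next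
  case (Suc i)
  then show ?case using linear_endo_comp[of D "D ^^ i"] by (simp add: comp_def)
qed

end

locale artin_quotient_char0 = artin_quotient S I
  for S :: "'n::finite monom set" and I :: "('n, 'k::field_char_0) mpoly set"

locale nilpotent_derivation = artin_quotient_char0 S I
  for S :: "'n::finite monom set" and I :: "('n, 'k::field_char_0) mpoly set" +
  fixes D :: "('n, 'k) mpoly set \<Rightarrow> ('n, 'k) mpoly set"
  assumes der: "derivation (quot_alg I) D" and nil: "nilpotent (quot_alg I) D"
begin

abbreviation "E \<equiv> exp_action A D"

text \<open>An index of nilpotency, which bounds all exponential sums uniformly.\<close>

definition idx :: nat where "idx = (SOME N. \<forall>x\<in>C. (D ^^ N) x = \<zero>\<^bsub>A\<^esub>)"

lemma D_linear: "linear_endo A D"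
  using der by (simp add: derivation_def)

lemma Dn_linear: "linear_endo A (D ^^ i)"
  by (rule linear_endo_funpow[OF D_linear])

lemma Dn_closed: "a \<in> C \<Longrightarrow> (D ^^ i) a \<in> C"
  by (rule linear_endo_closed[OF Dn_linear])

lemma D_mult: "a \<in> C \<Longrightarrow> b \<in> C \<Longrightarrow> D (a \<star> b) = D a \<star> b \<oplus>\<^bsub>A\<^esub> a \<star> D b"
  using der by (simp add: derivation_def)

lemma Dn_zero: assumes "a \<in> C" "idx \<le> i" shows "(D ^^ i) a = \<zero>\<^bsub>A\<^esub>"
proof -
  have "\<exists>N. \<forall>x\<in>C. (D ^^ N) x = \<zero>\<^bsub>A\<^esub>" using nil by (simp add: nilpotent_def)
  then have "\<forall>x\<in>C. (D ^^ idx) x = \<zero>\<^bsub>A\<^esub>" unfolding idx_def by (rule someI_ex)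
  then have "(D ^^ (i - idx)) ((D ^^ idx) a) = \<zero>\<^bsub>A\<^esub>"
    using assms(1) linear_endo_zero[OF Dn_linear] by simp
  moreover have "D ^^ i = D ^^ (i - idx) \<circ> D ^^ idx" using assms(2) by (simp flip: funpow_add)
  ultimately show ?thesis by simp
qed

text \<open>Linear forms turn the exponential, a sum in \<open>A\<close> whose range depends on the argument, into a sum in
the field over a fixed range. All identities for \<open>E\<close> below are proved after applying a linear form.\<close>

lemma E_form:
  assumes l: "linear_form A l" and a: "a \<in> C" and R: "idx \<le> R"
  shows "l (E s a) = (\<Sum>i<R. s ^ i / fact i * l ((D ^^ i) a))"
proof -
  let ?F = "{i. (D ^^ i) a \<noteq> \<zero>\<^bsub>A\<^esub>}"
  have sub: "?F \<subseteq> {..<R}"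
  proof
    fix i assume "i \<in> ?F"
    then have "(D ^^ i) a \<noteq> \<zero>\<^bsub>A\<^esub>" by (rule CollectD)
    then have "\<not> idx \<le> i" by (rule contrapos_nn) (rule Dn_zero[OF a])
    then show "i \<in> {..<R}" using R by simp
  qed
  have "l (E s a) = (\<Sum>i\<in>?F. l ((s ^ i / fact i) \<odot>\<^bsub>A\<^esub> (D ^^ i) a))"
    unfolding exp_action_def using a finite_subset[OF sub]
    by (simp add: linear_form_finsum[OF l] Dn_closed)
  also have "\<dots> = (\<Sum>i\<in>?F. s ^ i / fact i * l ((D ^^ i) a))"
    using l a by (simp add: linear_form_def Dn_closed)
  also have "\<dots> = (\<Sum>i<R. s ^ i / fact i * l ((D ^^ i) a))"
    by (rule sum.mono_neutral_left[OF _ sub]) (simp_all add: linear_form_zero[OF l])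
  finally show ?thesis .
qed

lemma E_closed: assumes "a \<in> C" shows "E s a \<in> C"
  unfolding exp_action_def using assms by (simp add: Dn_closed A.finsum_closed)

lemma E_linear: "linear_endo A (E s)"
proof (rule linear_endo_of_forms)
  fix m
  have *: "linear_form A (\<lambda>a. \<Sum>i<idx. s ^ i / fact i * co m ((D ^^ i) a))"
    by (intro linear_form_sum_fun linear_form_scale linear_form_comp[OF linear_form_co Dn_linear]) simp
  have eq: "co m (E s a) = (\<Sum>i<idx. s ^ i / fact i * co m ((D ^^ i) a))" if "a \<in> C" for a
    using that by (intro E_form linear_form_co) simp_all
  show "linear_form A (\<lambda>a. co m (E s a))"
    using * unfolding linear_form_def by (simp add: eq)
qed (rule E_closed)

lemma E_zero: assumes a: "a \<in> C" shows "E 0 a = a"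
proof (rule co_eqI[OF E_closed[OF a] a])
  fix m
  have "co m (E 0 a) = (\<Sum>i<Suc idx. 0 ^ i / fact i * co m ((D ^^ i) a))"
    using a by (intro E_form linear_form_co) simp_all
  also have "\<dots> = co m a" unfolding sum.lessThan_Suc_shift by simp
  finally show "co m (E 0 a) = co m a" .
qed

lemma E_add: assumes a: "a \<in> C" shows "E s (E t a) = E (s + t) a"
proof (rule co_eqI)
  fix m
  define B where "B = (\<lambda>i j. (s ^ i / fact i) * (t ^ j / fact j) * co m ((D ^^ (i + j)) a))"
  have "co m (E s (E t a)) = (\<Sum>i<idx. s ^ i / fact i * co m ((D ^^ i) (E t a)))"
    using a by (intro E_form linear_form_co E_closed) simp_all
  also have "\<dots> = (\<Sum>i<idx. \<Sum>j<idx. B i j)"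
  proof (rule sum.cong[OF refl])
    fix i
    have "co m ((D ^^ i) (E t a)) = (\<Sum>j<idx. t ^ j / fact j * co m ((D ^^ i) ((D ^^ j) a)))"
      using a by (intro E_form linear_form_comp[OF linear_form_co Dn_linear]) simp_all
    then show "s ^ i / fact i * co m ((D ^^ i) (E t a)) = (\<Sum>j<idx. B i j)"
      by (simp add: B_def sum_distrib_left funpow_add mult.assoc)
  qed
  also have "\<dots> = (\<Sum>n<2 * idx. \<Sum>i\<le>n. B i (n - i))"
    by (rule sum_square_triangle) (use a in \<open>auto simp: B_def Dn_zero\<close>)
  also have "\<dots> = (\<Sum>n<2 * idx. (s + t) ^ n / fact n * co m ((D ^^ n) a))"
  proof (rule sum.cong[OF refl])
    fix n
    have "(s + t) ^ n / fact n = (\<Sum>i\<le>n. (s ^ i / fact i) * (t ^ (n - i) / fact (n - i)))"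
      unfolding binomial_ring sum_divide_distrib
      by (rule sum.cong) (simp_all add: binomial_fact)
    then show "(\<Sum>i\<le>n. B i (n - i)) = (s + t) ^ n / fact n * co m ((D ^^ n) a)"
      by (simp add: B_def sum_distrib_right)
  qed
  also have "\<dots> = co m (E (s + t) a)"
    using a by (intro E_form[symmetric] linear_form_co) simp_all
  finally show "co m (E s (E t a)) = co m (E (s + t) a)" .
qed (use a in \<open>simp_all add: E_closed\<close>)

text \<open>Leibniz rule; stated for all linear forms so that the induction can replace \<open>l\<close> by \<open>l \<circ> D\<close>.\<close>

lemma Dn_mult:
  assumes ab: "a \<in> C" "b \<in> C" and "linear_form A l"
  shows "l ((D ^^ n) (a \<star> b)) =
    (\<Sum>i\<le>n. of_nat (n choose i) * l ((D ^^ i) a \<star> (D ^^ (n - i)) b))"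
  using assms(3)
proof (induction n arbitrary: l)
  case 0
  then show ?case by simp
next
  case (Suc n)
  define P where "P = (\<lambda>i j. l ((D ^^ i) a \<star> (D ^^ j) b))"
  have "l ((D ^^ Suc n) (a \<star> b)) = l (D ((D ^^ n) (a \<star> b)))" by simp
  also have "\<dots> = (\<Sum>i\<le>n. of_nat (n choose i) * l (D ((D ^^ i) a \<star> (D ^^ (n - i)) b)))"
    by (rule Suc.IH[OF linear_form_comp[OF Suc.prems D_linear]])
  also have "\<dots> = (\<Sum>i\<le>n. of_nat (n choose i) * (P (Suc i) (n - i) + P i (Suc n - i)))"
  proof (rule sum.cong[OF refl])
    fix i assume "i \<in> {..n}"
    then have "Suc n - i = Suc (n - i)" by (simp add: Suc_diff_le)
    moreover have "D ((D ^^ i) a \<star> (D ^^ (n - i)) b) =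
        (D ^^ Suc i) a \<star> (D ^^ (n - i)) b \<oplus>\<^bsub>A\<^esub> (D ^^ i) a \<star> (D ^^ Suc (n - i)) b"
      using ab by (simp add: D_mult Dn_closed)
    ultimately show "of_nat (n choose i) * l (D ((D ^^ i) a \<star> (D ^^ (n - i)) b)) =
        of_nat (n choose i) * (P (Suc i) (n - i) + P i (Suc n - i))"
      using Suc.prems ab Dn_closed[OF ab(1), of "Suc i"] Dn_closed[OF ab(2), of "Suc (n - i)"]
        Dn_closed[OF ab(1), of i] Dn_closed[OF ab(2), of "n - i"]
      by (simp only: P_def linear_form_def A.m_closed)
  qed
  also have "\<dots> = (\<Sum>i\<le>n. of_nat (n choose i) * P (Suc i) (n - i)) +
      (\<Sum>i\<le>n. of_nat (n choose i) * P i (Suc n - i))"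
    by (simp add: distrib_left sum.distrib)
  also have "(\<Sum>i\<le>n. of_nat (n choose i) * P i (Suc n - i)) =
      (\<Sum>i\<le>Suc n. of_nat (n choose i) * P i (Suc n - i))" by simp
  also have "\<dots> = P 0 (Suc n) + (\<Sum>i\<le>n. of_nat (n choose Suc i) * P (Suc i) (n - i))"
    by (subst sum.atMost_Suc_shift) simp
  also have "(\<Sum>i\<le>n. of_nat (n choose i) * P (Suc i) (n - i)) + (P 0 (Suc n) +
        (\<Sum>i\<le>n. of_nat (n choose Suc i) * P (Suc i) (n - i))) =
      P 0 (Suc n) + (\<Sum>i\<le>n. of_nat (Suc n choose Suc i) * P (Suc i) (n - i))"
    by (simp add: distrib_right sum.distrib)
  also have "\<dots> = (\<Sum>i\<le>Suc n. of_nat (Suc n choose i) * P i (Suc n - i))"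
    by (subst sum.atMost_Suc_shift) simp
  finally show ?case unfolding P_def .
qed

lemma E_mult: assumes ab: "a \<in> C" "b \<in> C" shows "E s (a \<star> b) = E s a \<star> E s b"
proof (rule co_eqI)
  fix m
  define B where "B = (\<lambda>i j. (s ^ i / fact i) * (s ^ j / fact j) * co m ((D ^^ i) a \<star> (D ^^ j) b))"
  have "co m (E s a \<star> E s b) = (\<Sum>i<idx. s ^ i / fact i * co m ((D ^^ i) a \<star> E s b))"
    using ab linear_form_comp[OF linear_form_co linear_endo_mult_right[OF E_closed[OF ab(2)]]]
    by (intro E_form) simp_all
  also have "\<dots> = (\<Sum>i<idx. \<Sum>j<idx. B i j)"
  proof (rule sum.cong[OF refl])
    fix i
    have "co m ((D ^^ i) a \<star> E s b) = (\<Sum>j<idx. s ^ j / fact j * co m ((D ^^ i) a \<star> (D ^^ j) b))"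
      using ab linear_form_comp[OF linear_form_co linear_endo_mult_left[OF Dn_closed[OF ab(1)]]]
      by (intro E_form) simp_all
    then show "s ^ i / fact i * co m ((D ^^ i) a \<star> E s b) = (\<Sum>j<idx. B i j)"
      by (simp add: B_def sum_distrib_left mult.assoc)
  qed
  also have "\<dots> = (\<Sum>n<2 * idx. \<Sum>i\<le>n. B i (n - i))"
    by (rule sum_square_triangle) (use ab in \<open>auto simp: B_def Dn_zero Dn_closed\<close>)
  also have "\<dots> = (\<Sum>n<2 * idx. s ^ n / fact n * co m ((D ^^ n) (a \<star> b)))"
  proof (rule sum.cong[OF refl])
    fix n
    have "(\<Sum>i\<le>n. B i (n - i)) = (\<Sum>i\<le>n. s ^ n / fact n *
        (of_nat (n choose i) * co m ((D ^^ i) a \<star> (D ^^ (n - i)) b)))"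
    proof (rule sum.cong[OF refl])
      fix i assume "i \<in> {..n}"
      then have i: "i \<le> n" by simp
      then have "s ^ n = s ^ i * s ^ (n - i)" by (simp flip: power_add)
      then show "B i (n - i) = s ^ n / fact n *
          (of_nat (n choose i) * co m ((D ^^ i) a \<star> (D ^^ (n - i)) b))"
        using i by (simp add: B_def binomial_fact)
    qed
    also have "\<dots> = s ^ n / fact n * co m ((D ^^ n) (a \<star> b))"
      unfolding sum_distrib_left[symmetric] using Dn_mult[OF ab linear_form_co] by simp
    finally show "(\<Sum>i\<le>n. B i (n - i)) = s ^ n / fact n * co m ((D ^^ n) (a \<star> b))" .
  qed
  also have "\<dots> = co m (E s (a \<star> b))"
    using ab by (intro E_form[symmetric] linear_form_co A.m_closed) simp_all
  finally show "co m (E s (a \<star> b)) = co m (E s a \<star> E s b)" ..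
qed (use ab in \<open>simp_all add: E_closed\<close>)

lemma
  shows E_GL: "E s \<in> G" and E_inv: "a \<in> C \<Longrightarrow> (ginv (E s)) a = E (- s) a"
proof -
  have ext: "E s \<in> extensional C" by (simp add: exp_action_def)
  have 1: "E s (E (- s) a) = a" "E (- s) (E s a) = a" if "a \<in> C" for a
    using that by (simp_all add: E_add E_zero)
  show "E s \<in> G" by (rule GL_I(1)[OF E_linear E_linear ext 1])
  show "a \<in> C \<Longrightarrow> (ginv (E s)) a = E (- s) a"
    by (rule GL_I(2)[OF E_linear E_linear ext 1])
qed

lemma E_inv_eq: "ginv (E s) = E (- s)"
  by (rule GL_eqI) (simp_all add: E_GL E_inv)

lemma E_Aut: "E s \<in> carrier (Aut A)"
  by (rule AutI[OF E_GL E_mult])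

lemma E_zero_eq: "E 0 = \<one>\<^bsub>GL A\<^esub>"
  by (rule GL_eqI) (simp_all add: E_GL E_zero, simp add: GL_one)

lemma E_connected: "connectedin (zariski A) (range E)"
proof (rule connectedin_curve[OF infinite_UNIV_char_0 E_GL])
  have r: "rational_on UNIV (\<lambda>s :: 'k. (c * s) ^ i / fact i * d)" for c i d
    by (rule rational_on_poly[of _ _ "monom (c ^ i * d / fact i) i"])
      (simp add: poly_monom power_mult_distrib)
  have *: "rational_on UNIV (\<lambda>s :: 'k. l (E (c * s) v))" if "linear_form A l" "v \<in> C" for l v c
    unfolding E_form[OF that order_refl] by (intro rational_on_sum r) simp
  fix f assume "f \<in> regular_fun A"
  then show "rational_on UNIV (\<lambda>s. f (E s))"
  proof (rule rational_curve[rotated 2])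
    fix l v assume lv: "linear_form A l" "v \<in> C"
    show "rational_on UNIV (\<lambda>s. l (E s v))" using *[OF lv, of 1] by simp
    show "rational_on UNIV (\<lambda>s. l ((ginv (E s)) v))"
      using *[OF lv, of "-1"] lv by (simp add: E_inv)
  qed
qed

text \<open>The parameter \<open>s = 0\<close> gives the identity, so the whole curve lies in the component of \<open>1\<close>.\<close>

lemma E_identity_component:
  assumes "\<And>s. E s \<in> H"
  shows "E s \<in> identity_component A H"
proof -
  have "range E \<subseteq> identity_component A H"
  proof (rule identity_component_maximal[OF E_connected])
    show "range E \<subseteq> H" using assms by (rule image_subsetI)
    show "\<one>\<^bsub>GL A\<^esub> \<in> range E" using E_zero_eq by (rule range_eqI[OF sym])
  qed
  then show ?thesis by (simp add: image_subset_iff)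
qed

end

context artin_quotient_char0 begin

section \<open>The torus lies in the identity component\<close>

lemma torus_curve_rational:
  assumes "f \<in> regular_fun A"
  shows "rational_on (- {0}) (\<lambda>s. f (tor ((\<lambda>_. 1)(i := s))))"
proof -
  have nz: "((\<lambda>_. 1 :: 'k)(i := s)) j \<noteq> 0" if "s \<noteq> 0" for s j using that by simp
  show ?thesis
  proof (rule rational_curve[OF _ _ assms])
    fix l v assume lv: "linear_form A l" "v \<in> C"
    have eq: "l (tor ((\<lambda>_. 1)(i := s)) v) = (\<Sum>m\<in>- S. s ^ lk m i * co m v * l (e m))" for s
      using linear_form_expand[OF lv(1) tor_closed[OF lv(2)]] lv(2) by (simp add: co_tor cmon_upd_one)
    show "rational_on (- {0}) (\<lambda>s. l (tor ((\<lambda>_. 1)(i := s)) v))"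
      unfolding eq
    proof (intro rational_on_sum fin)
      fix m
      show "rational_on (- {0}) (\<lambda>s. s ^ lk m i * co m v * l (e m))"
        by (rule rational_on_poly[of _ _ "monom (co m v * l (e m)) (lk m i)"]) (simp add: poly_monom)
    qed
    have eq': "l ((ginv (tor ((\<lambda>_. 1)(i := s)))) v) = (\<Sum>m\<in>- S. inverse s ^ lk m i * co m v * l (e m))"
      if s: "s \<noteq> 0" for s
    proof -
      have "(\<lambda>j. inverse (((\<lambda>_. 1)(i := s)) j)) = (\<lambda>_. 1)(i := inverse s)" by auto
      then have "(ginv (tor ((\<lambda>_. 1)(i := s)))) v = tor ((\<lambda>_. 1)(i := inverse s)) v"
        using tor_inv[of "(\<lambda>_. 1)(i := s)", OF nz[OF s] lv(2)] by (simp only:)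
      then show ?thesis by (simp only: eq)
    qed
    have "rational_on (- {0}) (\<lambda>s. \<Sum>m\<in>- S. inverse s ^ lk m i * co m v * l (e m))"
    proof (intro rational_on_sum fin)
      fix m
      show "rational_on (- {0}) (\<lambda>s. inverse s ^ lk m i * co m v * l (e m))"
        unfolding rational_on_def
        by (rule exI[of _ "[:co m v * l (e m):]"], rule exI[of _ "monom 1 (lk m i)"])
          (simp add: poly_monom power_inverse field_simps)
    qed
    then show "rational_on (- {0}) (\<lambda>s. l ((ginv (tor ((\<lambda>_. 1)(i := s)))) v))"
      unfolding rational_on_def by (simp add: eq')
  qed
qed

lemma torus_curve_connected: "connectedin (zariski A) ((\<lambda>s. tor ((\<lambda>_. 1)(i := s))) ` (- {0}))"
proof (rule connectedin_curve)
  have inf: "infinite (UNIV :: 'k set)" by (rule infinite_UNIV_char_0)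
  then show "infinite (- {0 :: 'k})" using finite_compl[of "{0 :: 'k}"] by simp
  show "tor ((\<lambda>_. 1)(i := s)) \<in> G" if "s \<in> - {0}" for s
    using that by (intro tor_GL) simp
  show "rational_on (- {0}) (\<lambda>s. f (tor ((\<lambda>_. 1)(i := s))))" if "f \<in> regular_fun A" for f
    using that by (rule torus_curve_rational)
qed

text \<open>A diagonal automorphism is a product of elements of the coordinate one-parameter subgroups, each of
which is a rational curve through \<open>1\<close>.\<close>

lemma T_identity_component:
  assumes H: "subgroup H (GL A)" and TH: "T \<subseteq> H"
  shows "T \<subseteq> identity_component A H"
proof
  fix g assume "g \<in> T"
  then obtain c where c: "g = tor c" "\<And>i. c i \<noteq> 0" by (rule torE) simp
  note sub = subgroup_identity_component[OF H]
  have 1: "tor ((\<lambda>_. 1)(i := s)) \<in> identity_component A H" if "s \<noteq> 0" for i s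
  proof -
    have "(\<lambda>s. tor ((\<lambda>_. 1)(i := s))) ` (- {0}) \<subseteq> identity_component A H"
    proof (rule identity_component_maximal[OF torus_curve_connected])
      show "(\<lambda>s. tor ((\<lambda>_. 1)(i := s))) ` (- {0}) \<subseteq> H"
      proof (rule image_subsetI)
        fix s :: 'k assume "s \<in> - {0}"
        then have "tor ((\<lambda>_. 1)(i := s)) \<in> T" by (intro torI) simp
        then show "tor ((\<lambda>_. 1)(i := s)) \<in> H" using TH by (rule subsetD[rotated])
      qed
      have "(\<lambda>_. 1)(i := 1) = (\<lambda>_. 1 :: 'k)" by auto
      then show "\<one>\<^bsub>GL A\<^esub> \<in> (\<lambda>s. tor ((\<lambda>_. 1)(i := s))) ` (- {0})"
        by (intro image_eqI[of _ _ 1]) (simp_all add: tor_one_eq)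
    qed
    then show ?thesis using that by (simp add: image_subset_iff)
  qed
  have "tor (\<lambda>i. if i \<in> F then c i else 1) \<in> identity_component A H" if "finite F" for F
    using that
  proof (induction F rule: finite_induct)
    case empty
    then show ?case using one_identity_component[OF H] by (simp add: tor_one_eq)
  next
    case (insert j F)
    have "tor (\<lambda>i. if i \<in> insert j F then c i else 1) =
        tor ((\<lambda>_. 1)(j := c j)) \<cdot> tor (\<lambda>i. if i \<in> F then c i else 1)"
    proof (subst tor_mult)
      show "tor (\<lambda>i. if i \<in> insert j F then c i else 1) =
          tor (\<lambda>i. ((\<lambda>_. 1)(j := c j)) i * (if i \<in> F then c i else 1))"
        using insert(2) by (intro arg_cong[of _ _ tor]) auto
    qed (use c(2) in simp_all)
    then show ?case using insert.IH 1[OF c(2)] sub by (simp add: subgroup.m_closed)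
  qed
  from this[of UNIV] show "g \<in> identity_component A H" by (simp add: c(1))
qed

end

context artin_quotient begin

section \<open>Linear parts of automorphisms\<close>

lemma deg_bound: obtains R where "\<And>m. m \<notin> S \<Longrightarrow> deg m < R"
proof
  show "deg m < Suc (Max (deg ` (- S)))" if "m \<notin> S" for m
    using that fin by (simp add: less_Suc_eq_le)
qed

lemma co_zero_mult: "a \<in> C \<Longrightarrow> b \<in> C \<Longrightarrow> co 0 (a \<star> b) = co 0 a * co 0 b"
proof -
  assume ab: "a \<in> C" "b \<in> C"
  have "splits (0 :: 'n monom) = {(0, 0)}"
  proof (intro equalityI subsetI)
    fix x :: "'n monom \<times> 'n monom" assume "x \<in> splits 0"
    then obtain q r where qr: "x = (q, r)" "q + r = 0" by (auto simp: splits_def)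
    then have "deg q + deg r = 0" using deg_add[of q r] by simp
    then show "x \<in> {(0, 0)}" using qr by (simp add: deg_eq_0_iff)
  qed (simp add: splits_def)
  then show ?thesis using co_mult[OF ab zero_notin] by simp
qed

text \<open>A high power of a variable vanishes in \<open>A\<close>, and taking the constant coefficient is multiplicative; so
\<open>g x\<^sub>i\<close> has no constant term.\<close>

lemma Aut_co_zero:
  assumes g: "g \<in> carrier (Aut A)"
  shows "co 0 (g (xg i)) = 0"
proof -
  obtain R where R: "\<And>m. m \<notin> S \<Longrightarrow> deg m < R" by (rule deg_bound) blast
  \<comment> \<open>\<open>M n\<close> is the exponent of \<open>x\<^sub>i\<^sup>n\<close>.\<close>
  define M where "M n = ((+) (X1 i) ^^ n) 0" for n
  have "co 0 (g (e (M n))) = co 0 (g (xg i)) ^ n \<and> deg (M n) = n" for n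
  proof (induction n)
    case 0
    have "co 0 (g \<one>\<^bsub>A\<^esub>) = 1" using co_e[of 0 0] by (simp add: Aut_one[OF g] e_0)
    then show ?case by (simp add: M_def e_0)
  next
    case (Suc n)
    have "M (Suc n) = X1 i + M n" by (simp add: M_def)
    then show ?case using Suc g
      by (simp add: e_mult[symmetric] Aut_mult co_zero_mult GL_closed Aut_GL deg_add deg_X1)
  qed
  then have *: "co 0 (g (e (M R))) = co 0 (g (xg i)) ^ R" "deg (M R) = R" by simp_all
  then have "M R \<in> S" using R[of "M R"] by (cases "M R \<in> S") simp_all
  then have "e (M R) = \<zero>\<^bsub>A\<^esub>" by (simp add: e_zero_iff)
  then have "co 0 (g (e (M R))) = 0" by (simp add: linear_endo_zero GL_linear Aut_GL g)
  then show ?thesis using * by simp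
qed

text \<open>Since no \<open>g x\<^sub>i\<close> has a constant term, automorphisms never lower the degree.\<close>

lemma Aut_filtration:
  assumes g: "g \<in> carrier (Aut A)" and "deg p < deg m"
  shows "co p (g (e m)) = 0"
  using assms(2)
proof (induction m arbitrary: p rule: monom_induct)
  case zero
  then show ?case by simp
next
  case (single i m)
  show ?case
  proof (cases "p \<in> S")
    case False
    have "co p (g (e (X1 i + m))) = (\<Sum>(q, r)\<in>splits p. co q (g (xg i)) * co r (g (e m)))"
      using g False by (simp add: e_mult[symmetric] Aut_mult co_mult GL_closed Aut_GL)
    also have "\<dots> = 0"
    proof (rule sum.neutral, clarify)
      fix q r assume "(q, r) \<in> splits p"
      then have "deg q + deg r < Suc (deg m)"
        using single.prems deg_add[of q r] by (simp add: splits_def deg_add deg_X1)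
      then have "deg q = 0 \<or> deg r < deg m" by linarith
      then show "co q (g (xg i)) * co r (g (e m)) = 0"
        using Aut_co_zero[OF g] single.IH by (auto simp: deg_eq_0_iff)
    qed
    finally show ?thesis .
  qed simp
qed

text \<open>Row \<open>k\<close> contains the coefficients of \<open>g x\<^sub>k\<close>. With this choice \<open>lin\<close> reverses products, and composing
with an automorphism on the left acts on the columns.\<close>

definition lin :: "(('n, 'k) mpoly set \<Rightarrow> ('n, 'k) mpoly set) \<Rightarrow> 'n \<Rightarrow> 'n \<Rightarrow> 'k"
  where "lin g k l = co (X1 l) (g (xg k))"

lemma sum_X1:
  assumes "\<And>m. m \<notin> S \<Longrightarrow> deg m \<noteq> 1 \<Longrightarrow> f m = 0"
  shows "(\<Sum>m\<in>- S. f m) = (\<Sum>p\<in>UNIV. f (X1 p))"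
proof -
  have "(\<Sum>m\<in>- S. f m) = (\<Sum>m\<in>range X1. f m)"
  proof (rule sum.mono_neutral_right[OF fin])
    show "range X1 \<subseteq> - S" by (simp add: image_subset_iff)
    show "\<forall>m\<in>- S - range X1. f m = 0" using assms deg_one_iff by fastforce
  qed
  also have "\<dots> = (\<Sum>p\<in>UNIV. f (X1 p))"
    by (subst sum.reindex) (simp_all add: inj_on_def X1_eq_iff)
  finally show ?thesis .
qed

lemma lin_apply:
  assumes g: "g \<in> carrier (Aut A)" and a: "a \<in> C" and a0: "co 0 a = 0"
  shows "co (X1 l) (g a) = (\<Sum>p\<in>UNIV. co (X1 p) a * lin g p l)"
proof -
  have "co (X1 l) (g a) = (\<Sum>m\<in>- S. co m a * co (X1 l) (g (e m)))"
    by (rule co_endo[OF GL_linear[OF Aut_GL[OF g]] a])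
  also have "\<dots> = (\<Sum>p\<in>UNIV. co (X1 p) a * co (X1 l) (g (e (X1 p))))"
  proof (rule sum_X1)
    fix m :: "'n monom" assume "deg m \<noteq> 1"
    then consider "m = 0" | "1 < deg m" using deg_eq_0_iff[of m] by linarith
    then show "co m a * co (X1 l) (g (e m)) = 0"
      by cases (simp_all add: a0 Aut_filtration[OF g] deg_X1)
  qed
  finally show ?thesis by (simp add: lin_def)
qed

lemma lin_mult:
  assumes "g \<in> carrier (Aut A)" "h \<in> carrier (Aut A)"
  shows "lin (g \<cdot> h) k l = (\<Sum>p\<in>UNIV. lin h k p * lin g p l)"
  using assms lin_apply[OF assms(1), of "h (xg k)" l]
  by (simp add: lin_def GL_mult_apply Aut_GL GL_closed Aut_co_zero)

lemma lin_one: "lin \<one>\<^bsub>GL A\<^esub> k l = (if k = l then 1 else 0)"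
  by (auto simp: lin_def GL_one co_e X1_eq_iff)

lemma Aut_inv_closed: "g \<in> carrier (Aut A) \<Longrightarrow> ginv g \<in> carrier (Aut A)"
  using subgroup_Aut by (rule subgroup.m_inv_closed)

lemma Aut_mult_closed:
  "g \<in> carrier (Aut A) \<Longrightarrow> h \<in> carrier (Aut A) \<Longrightarrow> g \<cdot> h \<in> carrier (Aut A)"
  using subgroup_Aut by (rule subgroup.m_closed)

lemma lin_inv:
  assumes g: "g \<in> carrier (Aut A)"
  shows "(\<Sum>p\<in>UNIV. lin g k p * lin (ginv g) p l) = (if k = l then 1 else 0)"
  using lin_mult[OF Aut_inv_closed[OF g] g, of k l] by (simp add: GL.l_inv Aut_GL g lin_one)

section \<open>Roots\<close>

text \<open>In characteristic zero this means that \<open>x\<^sub>j \<partial>/\<partial>x\<^sub>i\<close> maps the monomial ideal with exponents \<open>S\<close> into itself. Writing the exponents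
that contain \<open>x\<^sub>i\<close> as \<open>x\<^sub>i\<close> times another one makes transitivity immediate.\<close>

definition root_le :: "'n \<Rightarrow> 'n \<Rightarrow> bool"
  where "root_le i j \<longleftrightarrow> (\<forall>m. X1 i + m \<in> S \<longrightarrow> X1 j + m \<in> S)"

lemma root_le_refl [simp]: "root_le i i"
  by (simp add: root_le_def)

lemma root_le_trans: "root_le i j \<Longrightarrow> root_le j k \<Longrightarrow> root_le i k"
  by (simp add: root_le_def)

lemma derivation_mult:
  "derivation A D \<Longrightarrow> a \<in> C \<Longrightarrow> b \<in> C \<Longrightarrow> D (a \<star> b) = D a \<star> b \<oplus>\<^bsub>A\<^esub> a \<star> D b"
  by (simp add: derivation_def)

lemma derivation_linear: "derivation A D \<Longrightarrow> linear_endo A D"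
  by (simp add: derivation_def)

lemma derivation_closed: "derivation A D \<Longrightarrow> a \<in> C \<Longrightarrow> D a \<in> C"
  by (rule linear_endo_closed[OF derivation_linear])

text \<open>The component of degree \<open>e\<^sub>j - e\<^sub>i\<close> of \<open>D\<close> is a multiple of \<open>x\<^sub>j \<partial>/\<partial>x\<^sub>i\<close>: among the variables, only \<open>x\<^sub>i\<close>
can be shifted by this degree, because the exponent of \<open>x\<^sub>i\<close> drops. The equation \<open>X1 i + p = m + X1 j\<close>
expresses \<open>p = m - e\<^sub>i + e\<^sub>j\<close> without subtraction.\<close>

lemma derivation_component:
  assumes D: "derivation A D" and ij: "i \<noteq> j"
    and "p \<notin> S" "X1 i + p = m + X1 j"
  shows "co p (D (e m)) = of_nat (lk m i) * co (X1 j) (D (xg i))"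
  using assms(3,4)
proof (induction m arbitrary: p rule: monom_induct)
  case zero
  from arg_cong[OF zero(2), of "\<lambda>x. lk x i"] ij show ?case by (simp add: lookup_add lookup_X1)
next
  case (single l m)
  let ?c = "co (X1 j) (D (xg i))"
  have D1: "D (xg l) \<in> C" "D (e m) \<in> C" by (simp_all add: derivation_closed[OF D])
  have "D (e (X1 l + m)) = D (xg l) \<star> e m \<oplus>\<^bsub>A\<^esub> xg l \<star> D (e m)"
    by (simp add: e_mult[symmetric] derivation_mult[OF D])
  also have "xg l \<star> D (e m) = D (e m) \<star> xg l"
    using D1 by (intro A.m_comm) simp_all
  finally have "D (e (X1 l + m)) = D (xg l) \<star> e m \<oplus>\<^bsub>A\<^esub> D (e m) \<star> xg l" .
  then have "co p (D (e (X1 l + m))) = co p (D (xg l) \<star> e m) + co p (D (e m) \<star> xg l)"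
    using D1 by simp
  also have "co p (D (xg l) \<star> e m) = (if l = i then ?c else 0)"
  proof (cases "l = i")
    case True
    then have "X1 i + p = X1 i + (X1 j + m)" using single.prems(2) by (simp add: ac_simps)
    then have p: "p = X1 j + m" by simp
    then show ?thesis using True single.prems(1) D1 by (simp add: co_mult_e)
  next
    case False
    have "p \<noteq> q + m" for q
    proof
      assume "p = q + m"
      then have "X1 i + q + m = X1 l + X1 j + m" using single.prems(2) by (simp add: ac_simps)
      then have "X1 i + q = X1 l + X1 j" by simp
      from arg_cong[OF this, of "\<lambda>x. lk x i"] show False
        using False ij by (simp add: lookup_add lookup_X1)
    qed
    then show ?thesis using False D1 by (simp add: co_mult_e_not)
  qed
  also have "co p (D (e m) \<star> xg l) = of_nat (lk m i) * ?c"
  proof (cases "\<exists>q. p = q + X1 l")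
    case True
    then obtain q where q: "p = q + X1 l" by (elim exE)
    have qS: "q \<notin> S" using single.prems(1) q up by (metis)
    have "X1 l + (X1 i + q) = X1 l + (m + X1 j)" using single.prems(2) q by (simp add: ac_simps)
    then have "X1 i + q = m + X1 j" by simp
    then show ?thesis using single.IH[OF qS] D1 single.prems(1) qS q by (simp add: co_mult_e)
  next
    case False
    have "lk p l = 0"
    proof (rule ccontr)
      assume "lk p l \<noteq> 0"
      then obtain q where "p = X1 l + q" using monom_minus[of p l] by (metis neq0_conv)
      then show False using False by (metis add.commute)
    qed
    then have "l = i \<and> lk m i = 0"
      using arg_cong[OF single.prems(2), of "\<lambda>x. lk x l"]
      by (simp add: lookup_add lookup_X1 split: if_splits)
    then show ?thesis using False D1 by (simp add: co_mult_e_not)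
  qed
  finally show ?case using ij by (simp add: lookup_add lookup_X1 distrib_right)
qed

text \<open>The derivation \<open>x\<^sub>k \<partial>/\<partial>x\<^sub>k\<close>, which preserves every monomial ideal.\<close>

definition euler :: "'n \<Rightarrow> ('n, 'k) mpoly set \<Rightarrow> ('n, 'k) mpoly set"
  where "euler k = (\<lambda>a\<in>C. mk (\<lambda>m. of_nat (lk m k) * co m a))"

lemma co_euler: "a \<in> C \<Longrightarrow> co m (euler k a) = of_nat (lk m k) * co m a"
  by (simp add: euler_def co_mk)

lemma euler_closed: "a \<in> C \<Longrightarrow> euler k a \<in> C"
  by (simp add: euler_def)

lemma euler_derivation: "derivation A (euler k)"
proof (rule derivation_basis)
  show "linear_endo A (euler k)"
    by (intro linear_endoI co_eqI) (simp_all add: euler_closed co_euler algebra_simps)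
  have eu: "euler k (e m) = of_nat (lk m k) \<odot>\<^bsub>A\<^esub> e m" for m
    by (rule co_eqI) (simp_all add: euler_closed co_euler co_e)
  show "euler k (e m \<star> e m') = euler k (e m) \<star> e m' \<oplus>\<^bsub>A\<^esub> e m \<star> euler k (e m')" for m m'
  proof -
    have "(c \<odot>\<^bsub>A\<^esub> e m) \<star> e m' = c \<odot>\<^bsub>A\<^esub> e (m + m')" "e m \<star> (c \<odot>\<^bsub>A\<^esub> e m') = c \<odot>\<^bsub>A\<^esub> e (m + m')" for c
    proof -
      have one: "1 \<odot>\<^bsub>A\<^esub> a = a" if "a \<in> C" for a by (rule co_eqI) (simp_all add: that)
      show "(c \<odot>\<^bsub>A\<^esub> e m) \<star> e m' = c \<odot>\<^bsub>A\<^esub> e (m + m')"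
        using smult_mult[of "e m" "e m'" c 1] by (simp add: one e_mult)
      show "e m \<star> (c \<odot>\<^bsub>A\<^esub> e m') = c \<odot>\<^bsub>A\<^esub> e (m + m')"
        using smult_mult[of "e m" "e m'" 1 c] by (simp add: one e_mult)
    qed
    then show ?thesis
      by (intro co_eqI) (simp_all add: e_mult eu lookup_add distrib_right)
  qed
qed

lemma conj_derivation:
  assumes g: "g \<in> carrier (Aut A)" and D: "derivation A D"
  shows "derivation A (\<lambda>a. g (D ((ginv g) a)))"
  unfolding derivation_def
proof (intro conjI ballI)
  let ?h = "ginv g"
  have h: "?h \<in> carrier (Aut A)" using g by (rule Aut_inv_closed)
  show "linear_endo A (\<lambda>a. g (D (?h a)))"
    by (rule linear_endo_comp[OF GL_linear[OF Aut_GL[OF g]]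
          linear_endo_comp[OF derivation_linear[OF D] GL_linear[OF Aut_GL[OF h]]]])
  fix a b assume ab: "a \<in> C" "b \<in> C"
  then have hab: "?h a \<in> C" "?h b \<in> C" using h by (simp_all add: GL_closed Aut_GL)
  have lin: "g (x \<oplus>\<^bsub>A\<^esub> y) = g x \<oplus>\<^bsub>A\<^esub> g y" if "x \<in> C" "y \<in> C" for x y
    using GL_linear[OF Aut_GL[OF g]] that by (simp add: linear_endo_def)
  show "g (D (?h (a \<star> b))) = g (D (?h a)) \<star> b \<oplus>\<^bsub>A\<^esub> a \<star> g (D (?h b))"
    using ab hab by (simp add: Aut_mult[OF h] derivation_mult[OF D] lin derivation_closed[OF D]
        Aut_mult[OF g] GL_inv_apply(2)[OF Aut_GL[OF g]])
qed

end

context artin_quotient_char0 begin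

text \<open>The conjugate of \<open>x\<^sub>k \<partial>/\<partial>x\<^sub>k\<close> by \<open>g\<close> is a derivation of \<open>A\<close>, so it kills the monomials in \<open>I\<close>; its
component of degree \<open>e\<^sub>j - e\<^sub>i\<close> then shows that \<open>x\<^sub>j \<partial>/\<partial>x\<^sub>i\<close> does so as well. Characteristic zero enters
through the coefficient \<open>m\<^sub>i > 0\<close>, which must be invertible.\<close>

lemma root_of_automorphism:
  assumes g: "g \<in> carrier (Aut A)" and 1: "lin (ginv g) i k \<noteq> 0" and 2: "lin g k j \<noteq> 0"
  shows "root_le i j"
proof (cases "i = j")
  case False
  let ?h = "ginv g"
  \<comment> \<open>The conjugate of the Euler derivation; its entry \<open>(i, j)\<close> is \<open>lin g\<^sup>-\<^sup>1 i k * lin g k j\<close>.\<close>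
  let ?D = "\<lambda>a. g (euler k (?h a))"
  have D: "derivation A ?D" by (rule conj_derivation[OF g euler_derivation])
  have hx: "?h (xg i) \<in> C" using g by (simp add: GL_closed Aut_GL)
  have "co (X1 j) (?D (xg i)) = (\<Sum>p\<in>UNIV. co (X1 p) (euler k (?h (xg i))) * lin g p j)"
    using hx by (intro lin_apply[OF g]) (simp_all add: euler_closed co_euler)
  also have "\<dots> = (\<Sum>p\<in>UNIV. if p = k then lin ?h i k * lin g k j else 0)"
    by (rule sum.cong) (use hx in \<open>auto simp: co_euler lookup_X1 lin_def\<close>)
  also have "\<dots> = lin ?h i k * lin g k j" by (simp add: sum.delta)
  finally have c: "co (X1 j) (?D (xg i)) \<noteq> 0" using 1 2 by simp
  show ?thesis unfolding root_le_def
  proof (intro allI impI, rule ccontr)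
    fix m assume mS: "X1 i + m \<in> S" and n: "X1 j + m \<notin> S"
    have "co (X1 j + m) (?D (e (X1 i + m))) = of_nat (lk (X1 i + m) i) * co (X1 j) (?D (xg i))"
      by (rule derivation_component[OF D False n]) (simp add: ac_simps)
    moreover have "e (X1 i + m) = \<zero>\<^bsub>A\<^esub>" using mS by (simp add: e_zero_iff)
    moreover have "?D \<zero>\<^bsub>A\<^esub> = \<zero>\<^bsub>A\<^esub>" by (rule linear_endo_zero[OF derivation_linear[OF D]])
    moreover have "of_nat (lk (X1 i + m) i) \<noteq> (0 :: 'k)" by (simp add: lookup_add lookup_X1 del: of_nat_Suc of_nat_add)
    ultimately show False using c by simp
  qed
qed simp

lemma nilpotent_by_weight:
  assumes lin: "linear_endo A D"
    and w: "\<And>m p. m \<notin> S \<Longrightarrow> p \<notin> S \<Longrightarrow> co p (D (e m)) \<noteq> 0 \<Longrightarrow> w m < (w p :: nat)"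
  shows "nilpotent A D"
  unfolding nilpotent_def
proof (intro exI ballI)
  let ?N = "Suc (Max (w ` (- S)))"
  have *: "n \<le> w p" if "p \<notin> S" "co p ((D ^^ n) a) \<noteq> 0" "a \<in> C" for n p a
    using that
  proof (induction n arbitrary: p)
    case (Suc n)
    have cl: "(D ^^ n) a \<in> C" by (rule linear_endo_closed[OF linear_endo_funpow[OF lin] Suc.prems(3)])
    have "(\<Sum>m\<in>- S. co m ((D ^^ n) a) * co p (D (e m))) \<noteq> 0"
      using Suc.prems(2) co_endo[OF lin cl] by simp
    then obtain m where m: "m \<in> - S" "co m ((D ^^ n) a) * co p (D (e m)) \<noteq> 0"
      by (rule sum.not_neutral_contains_not_neutral)
    then have "n \<le> w m" using Suc by simp
    moreover have "w m < w p" using m Suc.prems(1) by (intro w) simp_all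
    ultimately show ?case by simp
  qed simp
  fix a assume a: "a \<in> C"
  show "(D ^^ ?N) a = \<zero>\<^bsub>A\<^esub>"
  proof (rule co_eqI)
    show "(D ^^ ?N) a \<in> C" by (rule linear_endo_closed[OF linear_endo_funpow[OF lin] a])
    fix p assume p: "p \<notin> S"
    have "w p < ?N" using p fin by (simp add: less_Suc_eq_le)
    then show "co p ((D ^^ ?N) a) = co p \<zero>\<^bsub>A\<^esub>" using *[OF p _ a, of ?N] by (metis co_zero not_le)
  qed simp
qed

lemma homogeneousI:
  assumes lin: "linear_endo A D"
    and u: "\<And>m p q. m \<notin> S \<Longrightarrow> p \<notin> S \<Longrightarrow> q \<notin> S \<Longrightarrow> co p (D (e m)) \<noteq> 0 \<Longrightarrow> co q (D (e m)) \<noteq> 0 \<Longrightarrow> p = q"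
  shows "homogeneous I D"
proof -
  have h: "homogeneous_elems I = {c \<odot>\<^bsub>A\<^esub> e m |c m. True}"
    by (simp add: homogeneous_elems_def e_def)
  have De: "D (e m) \<in> C" for m by (rule linear_endo_closed[OF lin e_closed])
  have 1: "\<exists>c p. D (e m) = c \<odot>\<^bsub>A\<^esub> e p" for m
  proof (cases "\<exists>p. p \<notin> S \<and> co p (D (e m)) \<noteq> 0 \<and> m \<notin> S")
    case True
    then obtain p where p: "p \<notin> S" "co p (D (e m)) \<noteq> 0" "m \<notin> S" by (elim exE conjE)
    have "D (e m) = co p (D (e m)) \<odot>\<^bsub>A\<^esub> e p"
    proof (rule co_eqI[OF De])
      show "co q (D (e m)) = co q (co p (D (e m)) \<odot>\<^bsub>A\<^esub> e p)" if q: "q \<notin> S" for q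
        using u[OF p(3,1) q p(2)] q by (cases "p = q") (auto simp: co_e)
    qed simp
    then show ?thesis by (intro exI)
  next
    case False
    have "D (e m) = 0 \<odot>\<^bsub>A\<^esub> e 0"
    proof (rule co_eqI[OF De])
      show "co q (D (e m)) = co q (0 \<odot>\<^bsub>A\<^esub> e 0)" if q: "q \<notin> S" for q
      proof (cases "m \<in> S")
        case True
        then have "e m = \<zero>\<^bsub>A\<^esub>" by (simp add: e_zero_iff)
        then show ?thesis by (simp add: linear_endo_zero[OF lin])
      next
        case m: False
        then have "co q (D (e m)) = 0" using False q by metis
        then show ?thesis by simp
      qed
    qed simp
    then show ?thesis by (intro exI)
  qed
  show ?thesis unfolding homogeneous_def h
  proof (rule image_subsetI)
    fix x assume "x \<in> {c \<odot>\<^bsub>A\<^esub> e m |c m. True}"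
    then obtain c m where x: "x = c \<odot>\<^bsub>A\<^esub> e m" by (elim CollectE exE conjE)
    obtain d p where d: "D (e m) = d \<odot>\<^bsub>A\<^esub> e p" using 1[of m] by (elim exE)
    have "D x = c \<odot>\<^bsub>A\<^esub> D (e m)" using lin by (simp add: x linear_endo_def)
    also have "\<dots> = (c * d) \<odot>\<^bsub>A\<^esub> e p" by (rule co_eqI) (simp_all add: d)
    finally show "D x \<in> {c \<odot>\<^bsub>A\<^esub> e m |c m. True}" by (intro CollectI exI conjI TrueI)
  qed
qed

lemma ga_imageI:
  "derivation A D \<Longrightarrow> nilpotent A D \<Longrightarrow> homogeneous I D \<Longrightarrow> exp_action A D s \<in> ga_images I"
  unfolding ga_images_def by (intro CollectI exI[of _ D] exI[of _ s]) simp

lemma nilpotent_derivation_intro: "derivation A D \<Longrightarrow> nilpotent A D \<Longrightarrow> nilpotent_derivation S I D"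
  by unfold_locales

section \<open>The derivations \<open>x\<^sub>j \<partial>/\<partial>x\<^sub>i\<close>\<close>

text \<open>The matrix of \<open>x\<^sub>j \<partial>/\<partial>x\<^sub>i\<close>.\<close>

definition root_der :: "'n \<Rightarrow> 'n \<Rightarrow> ('n, 'k) mpoly set \<Rightarrow> ('n, 'k) mpoly set"
  where "root_der i j = linmap (\<lambda>p m. if X1 i + p = m + X1 j then of_nat (lk m i) else 0)"

context
  fixes i j assumes ij: "i \<noteq> j" "root_le i j"
begin

lemma co_root_der:
  assumes p: "p \<notin> S"
  shows "co p (root_der i j (e m)) = (if X1 i + p = m + X1 j then of_nat (lk m i) else 0)"
proof (cases "m \<in> S")
  case True
  then have "e m = \<zero>\<^bsub>A\<^esub>" by (simp add: e_zero_iff)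
  then have l: "co p (root_der i j (e m)) = 0"
    by (simp add: root_der_def linear_endo_zero[OF linmap_linear])
  have "lk m i = 0" if eq: "X1 i + p = m + X1 j"
  proof (rule ccontr)
    assume "lk m i \<noteq> 0"
    then obtain m' where m': "m = X1 i + m'" using monom_minus[of m i] by (metis neq0_conv)
    then have "X1 i + p = X1 i + (X1 j + m')" using eq by (simp add: ac_simps)
    then have "p = X1 j + m'" by simp
    then show False using p ij(2) True m' by (simp add: root_le_def)
  qed
  then show ?thesis by (simp add: l)
next
  case False
  then show ?thesis using p by (simp add: root_der_def co_linmap_e)
qed

lemma root_der_linear: "linear_endo A (root_der i j)"
  by (simp add: root_der_def linmap_linear)

lemma root_der_closed: "a \<in> C \<Longrightarrow> root_der i j a \<in> C"
  by (rule linear_endo_closed[OF root_der_linear])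

lemma co_root_der_mult:
  assumes p: "p \<notin> S"
  shows "co p (root_der i j (e m) \<star> e m') = (if X1 i + p = m + m' + X1 j then of_nat (lk m i) else 0)"
proof (cases "\<exists>q. p = q + m'")
  case True
  then obtain q where q: "p = q + m'" by (elim exE)
  then have qS: "q \<notin> S" using p up by metis
  have "X1 i + p = m + m' + X1 j \<longleftrightarrow> X1 i + q = m + X1 j"
  proof -
    have "X1 i + p = (X1 i + q) + m'" "m + m' + X1 j = (m + X1 j) + m'" by (simp_all add: q ac_simps)
    then show ?thesis by simp
  qed
  then show ?thesis using p qS co_mult_e[OF root_der_closed[OF e_closed[of m]] qS, of m'] co_root_der[OF qS, of m]
    by (simp add: q)
next
  case False
  have "lk m i = 0" if eq: "X1 i + p = m + m' + X1 j"
  proof (rule ccontr)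
    assume "lk m i \<noteq> 0"
    then obtain m1 where m1: "m = X1 i + m1" using monom_minus[of m i] by (metis neq0_conv)
    then have "X1 i + p = X1 i + (m1 + X1 j + m')" using eq by (simp add: ac_simps)
    then have "p = m1 + X1 j + m'" by simp
    then show False using False by metis
  qed
  then show ?thesis using False by (simp add: co_mult_e_not root_der_closed)
qed

lemma root_der_derivation: "derivation A (root_der i j)"
proof (rule derivation_basis[OF root_der_linear])
  fix m m'
  have cl: "root_der i j (e m) \<in> C" "root_der i j (e m') \<in> C" by (simp_all add: root_der_closed)
  show "root_der i j (e m \<star> e m') = root_der i j (e m) \<star> e m' \<oplus>\<^bsub>A\<^esub> e m \<star> root_der i j (e m')"
  proof (rule co_eqI)
    fix p assume p: "p \<notin> S"
    have "co p (e m \<star> root_der i j (e m')) = co p (root_der i j (e m') \<star> e m)"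
      using cl by (simp add: A.m_comm)
    then show "co p (root_der i j (e m \<star> e m')) =
        co p (root_der i j (e m) \<star> e m' \<oplus>\<^bsub>A\<^esub> e m \<star> root_der i j (e m'))"
      using cl by (simp add: e_mult co_root_der[OF p] co_root_der_mult[OF p] add.commute[of m' m] lookup_add)
  qed (use cl in \<open>simp_all add: e_mult root_der_closed\<close>)
qed

lemma root_der_nilpotent: "nilpotent A (root_der i j)"
proof (rule nilpotent_by_weight[OF root_der_linear, of "\<lambda>m. lk m j"])
  fix m p assume p: "p \<notin> S" and "co p (root_der i j (e m)) \<noteq> 0"
  then have "X1 i + p = m + X1 j" by (simp add: co_root_der split: if_splits)
  from arg_cong[OF this, of "\<lambda>x. lk x j"] ij(1) show "lk m j < lk p j"
    by (simp add: lookup_add lookup_X1)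
qed

lemma root_der_homogeneous: "homogeneous I (root_der i j)"
proof (rule homogeneousI[OF root_der_linear])
  fix m p q assume "p \<notin> S" "q \<notin> S" "co p (root_der i j (e m)) \<noteq> 0" "co q (root_der i j (e m)) \<noteq> 0"
  then have "X1 i + p = m + X1 j" "X1 i + q = m + X1 j" by (simp_all add: co_root_der split: if_splits)
  then have "X1 i + p = X1 i + q" by (rule trans[OF _ sym])
  then show "p = q" by simp
qed

interpretation root_der: nilpotent_derivation S I "root_der i j"
  by (rule nilpotent_derivation_intro[OF root_der_derivation root_der_nilpotent])

lemma exp_root_der_ga: "exp_action A (root_der i j) s \<in> ga_images I"
  by (rule ga_imageI[OF root_der_derivation root_der_nilpotent root_der_homogeneous])

lemma exp_root_der_Aut: "exp_action A (root_der i j) s \<in> carrier (Aut A)"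
  by (rule root_der.E_Aut)

lemma exp_root_der_inv: "ginv (exp_action A (root_der i j) s) = exp_action A (root_der i j) (- s)"
  by (rule root_der.E_inv_eq)

text \<open>The exponential series stops after the linear term on variables, since \<open>x\<^sub>i \<mapsto> x\<^sub>j \<mapsto> 0\<close>.\<close>

lemma lin_exp_root_der:
  "lin (exp_action A (root_der i j) s) k l = (if k = l then 1 else 0) + (if k = i \<and> l = j then s else 0)"
proof -
  have X: "X1 i + p = X1 k + X1 j \<and> k = i \<longleftrightarrow> p = X1 j \<and> k = i" for p k by auto
  have ex: "root_der i j (xg k) = (if k = i then xg j else \<zero>\<^bsub>A\<^esub>)" for k
  proof (rule co_eqI)
    fix p assume p: "p \<notin> S"
    show "co p (root_der i j (xg k)) = co p (if k = i then xg j else \<zero>\<^bsub>A\<^esub>)"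
      using X[of p k] by (auto simp: co_root_der[OF p] co_e p lookup_X1)
  qed (simp_all add: root_der_closed)
  have e2: "(root_der i j ^^ Suc (Suc n)) (xg k) = \<zero>\<^bsub>A\<^esub>" for n
  proof -
    have z: "root_der i j \<zero>\<^bsub>A\<^esub> = \<zero>\<^bsub>A\<^esub>" by (rule linear_endo_zero[OF root_der_linear])
    have "(root_der i j ^^ Suc (Suc n)) (xg k) = (root_der i j ^^ n) (root_der i j (root_der i j (xg k)))"
      by (simp only: funpow_Suc_right comp_def)
    also have "root_der i j (root_der i j (xg k)) = \<zero>\<^bsub>A\<^esub>" using ij by (simp add: ex z)
    finally show ?thesis by (simp add: linear_endo_zero[OF linear_endo_funpow[OF root_der_linear]])
  qed
  have "lin (exp_action A (root_der i j) s) k l =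
      (\<Sum>n<Suc (Suc root_der.idx). s ^ n / fact n * co (X1 l) ((root_der i j ^^ n) (xg k)))"
    unfolding lin_def by (rule root_der.E_form[OF linear_form_co e_closed]) simp
  also have "\<dots> = co (X1 l) (xg k) + s * co (X1 l) (root_der i j (xg k))"
    unfolding sum.lessThan_Suc_shift e2 by simp
  also have "\<dots> = (if k = l then 1 else 0) + (if k = i \<and> l = j then s else 0)"
    by (auto simp: ex co_e X1_eq_iff)
  finally show ?thesis .
qed

end

end

section \<open>Unipotent automorphisms\<close>

definition int_exp :: "'n::finite monom \<Rightarrow> 'n \<Rightarrow>\<^sub>0 int"
  where "int_exp m = Poly_Mapping.map int m"

lemma lookup_int_exp: "lk (int_exp m) i = int (lk m i)"
  by (simp add: int_exp_def lookup_map_int)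

lemma int_exp_add: "int_exp (m + m') = int_exp m + int_exp m'"
  by (rule poly_mapping_eqI) (simp add: lookup_int_exp lookup_add)

lemma int_exp_inj: "int_exp m = int_exp m' \<longleftrightarrow> m = m'"
proof
  assume "int_exp m = int_exp m'"
  then have "lk (int_exp m) i = lk (int_exp m') i" for i by simp
  then show "m = m'" by (intro poly_mapping_eqI) (simp add: lookup_int_exp)
qed simp

lemma deg_int_exp: "int (deg m) = (\<Sum>i\<in>UNIV. lk (int_exp m) i)"
  by (simp add: deg_def lookup_int_exp)

lemma int_exp_deg_shift:
  assumes "deg p = deg m + d" "int_exp p' - int_exp m' = int_exp p - int_exp m"
  shows "deg p' = deg m' + d"
proof -
  have "int (deg p') - int (deg m') = (\<Sum>i\<in>UNIV. lk (int_exp p' - int_exp m') i)"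
    by (simp add: deg_int_exp lookup_minus sum_subtractf)
  also have "\<dots> = int (deg p) - int (deg m)"
    by (simp add: deg_int_exp lookup_minus sum_subtractf assms(2))
  finally show ?thesis using assms(1) by linarith
qed

context artin_quotient_char0 begin

definition gen_group :: "(('n, 'k) mpoly set \<Rightarrow> ('n, 'k) mpoly set) set"
  where "gen_group = generate (Aut A) (T \<union> ga_images I)"

lemma ga_imageE:
  assumes "g \<in> ga_images I"
  obtains D s where "nilpotent_derivation S I D" "homogeneous I D" "g = exp_action A D s"
proof -
  obtain D s where "g = exp_action A D s" "derivation A D" "nilpotent A D" "homogeneous I D"
    using assms unfolding ga_images_def by (elim CollectE exE conjE)
  then show ?thesis by (intro that[of D s] nilpotent_derivation_intro)
qed

lemma ga_Aut: "g \<in> ga_images I \<Longrightarrow> g \<in> carrier (Aut A)"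
  by (elim ga_imageE) (simp add: nilpotent_derivation.E_Aut)

lemma subgroup_gen_group: "subgroup gen_group (GL A)"
proof -
  have "T \<union> ga_images I \<subseteq> carrier (Aut A)"
    by (intro Un_least subsetI) (simp_all add: T_Aut ga_Aut)
  then have "subgroup gen_group (Aut A)" unfolding gen_group_def by (rule Aut.generate_is_subgroup)
  then have "subgroup gen_group (GL A\<lparr>carrier := carrier (Aut A)\<rparr>)" using Aut_eq by simp
  then show ?thesis by (rule GL.incl_subgroup[OF subgroup_Aut])
qed

lemma T_gen_group: "g \<in> T \<Longrightarrow> g \<in> gen_group"
  unfolding gen_group_def by (intro generate.incl) simp

lemma ga_gen_group: "g \<in> ga_images I \<Longrightarrow> g \<in> gen_group"
  unfolding gen_group_def by (intro generate.incl) simp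

lemmas gen_group_mult = subgroup.m_closed[OF subgroup_gen_group]
lemmas gen_group_inv = subgroup.m_inv_closed[OF subgroup_gen_group]
lemmas gen_group_one = subgroup.one_closed[OF subgroup_gen_group]

text \<open>Automorphisms that are the identity up to terms raising the degree by at least \<open>d\<close>.\<close>

definition unipotent :: "nat \<Rightarrow> (('n, 'k) mpoly set \<Rightarrow> ('n, 'k) mpoly set) set"
  where "unipotent d = {u \<in> carrier (Aut A). \<forall>m p. m \<notin> S \<longrightarrow> p \<notin> S \<longrightarrow> deg p < deg m + d \<longrightarrow>
    co p (u (e m)) = (if p = m then 1 else 0)}"

text \<open>The \<open>\<int>\<^sup>n\<close>-degrees of the homogeneous pieces of \<open>u\<close> that raise the total degree by exactly \<open>d\<close>.\<close>

definition leading_degrees :: "nat \<Rightarrow> (('n, 'k) mpoly set \<Rightarrow> ('n, 'k) mpoly set) \<Rightarrow> ('n \<Rightarrow>\<^sub>0 int) set"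
  where "leading_degrees d u = {int_exp p - int_exp m | p m. p \<notin> S \<and> m \<notin> S \<and> deg p = deg m + d \<and> co p (u (e m)) \<noteq> 0}"

lemma finite_leading_degrees: "finite (leading_degrees d u)"
proof (rule finite_subset)
  show "leading_degrees d u \<subseteq> (\<lambda>(p, m). int_exp p - int_exp m) ` ((- S) \<times> (- S))"
    unfolding leading_degrees_def by auto
  show "finite ((\<lambda>(p, m). int_exp p - int_exp m) ` ((- S) \<times> (- S)))" using fin by simp
qed

context
  fixes u :: "('n, 'k) mpoly set \<Rightarrow> ('n, 'k) mpoly set" and d :: nat and \<alpha> :: "'n \<Rightarrow>\<^sub>0 int"
  assumes u: "u \<in> unipotent d" and d: "1 \<le> d"
    and \<alpha>: "\<And>p m. int_exp p = int_exp m + \<alpha> \<Longrightarrow> deg p = deg m + d"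
begin

definition leading_part :: "('n, 'k) mpoly set \<Rightarrow> ('n, 'k) mpoly set"
  where "leading_part = linmap (\<lambda>p m. if int_exp p = int_exp m + \<alpha> then co p (u (e m)) else 0)"

lemma u_Aut: "u \<in> carrier (Aut A)"
  using u by (simp add: unipotent_def)

lemma u_zero: "m \<in> S \<Longrightarrow> co p (u (e m)) = 0"
proof -
  assume "m \<in> S"
  then have "e m = \<zero>\<^bsub>A\<^esub>" by (simp add: e_zero_iff)
  then show ?thesis by (simp add: linear_endo_zero[OF GL_linear[OF Aut_GL[OF u_Aut]]])
qed

lemma u_low: "m \<notin> S \<Longrightarrow> p \<notin> S \<Longrightarrow> deg p < deg m + d \<Longrightarrow> co p (u (e m)) = (if p = m then 1 else 0)"
  using u by (simp add: unipotent_def)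

lemma leading_part_linear: "linear_endo A leading_part"
  by (simp add: leading_part_def linmap_linear)

lemma leading_part_closed: "a \<in> C \<Longrightarrow> leading_part a \<in> C"
  by (rule linear_endo_closed[OF leading_part_linear])

lemma co_leading_part: assumes p: "p \<notin> S"
  shows "co p (leading_part (e m)) = (if int_exp p = int_exp m + \<alpha> then co p (u (e m)) else 0)"
proof (cases "m \<in> S")
  case True
  then have "e m = \<zero>\<^bsub>A\<^esub>" by (simp add: e_zero_iff)
  then show ?thesis using u_zero[OF True, of p] by (simp add: linear_endo_zero[OF leading_part_linear])
next
  case False
  then show ?thesis using p by (simp add: leading_part_def co_linmap_e)
qed

text \<open>Compare the coefficients of \<open>u (e m e m') = u (e m) u (e m')\<close> at an exponent of degree
\<open>deg m + deg m' + d\<close>. Below its leading degree \<open>u\<close> is the identity, so a product of coefficients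
contributes only if one of its factors belongs to the identity, and the rule for \<open>u\<close> becomes the Leibniz rule.\<close>

lemma leading_part_derivation: "derivation A leading_part"
proof (rule derivation_basis[OF leading_part_linear])
  fix m m' assume m: "m \<notin> S" "m' \<notin> S"
  have cl: "leading_part (e m) \<in> C" "leading_part (e m') \<in> C" by (simp_all add: leading_part_closed)
  have ucl: "u (e m) \<in> C" "u (e m') \<in> C" by (simp_all add: GL_closed Aut_GL u_Aut)
  show "leading_part (e m \<star> e m') = leading_part (e m) \<star> e m' \<oplus>\<^bsub>A\<^esub> e m \<star> leading_part (e m')"
  proof (rule co_eqI)
    fix p assume p: "p \<notin> S"
    have "co p (leading_part (e m) \<star> e m' \<oplus>\<^bsub>A\<^esub> e m \<star> leading_part (e m')) =
        (\<Sum>x\<in>splits p. (case x of (q, r) \<Rightarrow> co q (leading_part (e m)) * co r (e m')) +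
          (case x of (q, r) \<Rightarrow> co q (e m) * co r (leading_part (e m'))))"
      using cl by (simp add: co_mult p sum.distrib)
    also have "\<dots> = (\<Sum>x\<in>splits p. if int_exp p = int_exp (m + m') + \<alpha> then
        (case x of (q, r) \<Rightarrow> co q (u (e m)) * co r (u (e m'))) else 0)"
    proof (rule sum.cong[OF refl], clarify)
      fix q r assume "(q, r) \<in> splits p"
      then have qr: "p = q + r" by (simp add: splits_def)
      then have S: "q \<notin> S" "r \<notin> S" using p up up' by metis+
      let ?a = "co q (u (e m))" and ?b = "co r (u (e m'))"
      show "co q (leading_part (e m)) * co r (e m') + co q (e m) * co r (leading_part (e m')) =
          (if int_exp p = int_exp (m + m') + \<alpha> then ?a * ?b else 0)"
      proof (cases "int_exp p = int_exp (m + m') + \<alpha>")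
        case True
        have dp: "deg q + deg r = deg m + deg m' + d"
          using \<alpha>[OF True] by (simp add: qr deg_add)
        have r: "int_exp q = int_exp m + \<alpha>" if "r = m'"
          using True that by (simp add: qr int_exp_add)
        have q: "int_exp r = int_exp m' + \<alpha>" if "q = m"
          using True that by (simp add: qr int_exp_add)
        consider "r = m'" "q \<noteq> m" | "r \<noteq> m'" "q = m" | "r \<noteq> m'" "q \<noteq> m" | "r = m'" "q = m" by blast
        then show ?thesis
        proof cases
          case 1
          have "?b = 1" using u_low[OF m(2) S(2)] 1 d by simp
          then show ?thesis using True 1 r S by (simp add: co_leading_part co_e)
        next
          case 2
          have "?a = 1" using u_low[OF m(1) S(1)] 2 d by simp
          then show ?thesis using True 2 q S by (simp add: co_leading_part co_e)
        next
          case 3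
          have "?a * ?b = 0"
          proof (cases "deg q < deg m + d")
            case True
            then show ?thesis using u_low[OF m(1) S(1)] 3 by simp
          next
            case False
            then have "deg r < deg m' + d" using dp d by linarith
            then show ?thesis using u_low[OF m(2) S(2)] 3 by simp
          qed
          then show ?thesis using True 3 S by (simp add: co_e)
        next
          case 4
          then show ?thesis using dp d by simp
        qed
      next
        case False
        have "r = m' \<Longrightarrow> int_exp q \<noteq> int_exp m + \<alpha>" "q = m \<Longrightarrow> int_exp r \<noteq> int_exp m' + \<alpha>"
          using False by (auto simp: qr int_exp_add ac_simps)
        then show ?thesis using False S by (auto simp: co_leading_part co_e)
      qed
    qed
    also have "\<dots> = (if int_exp p = int_exp (m + m') + \<alpha> then co p (u (e m) \<star> u (e m')) else 0)"
      using co_mult[OF ucl p] by simp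
    also have "u (e m) \<star> u (e m') = u (e (m + m'))"
      by (simp add: Aut_mult[OF u_Aut, symmetric] e_mult)
    also have "(if int_exp p = int_exp (m + m') + \<alpha> then co p (u (e (m + m'))) else 0) = co p (leading_part (e m \<star> e m'))"
      using p by (simp add: e_mult co_leading_part)
    finally show "co p (leading_part (e m \<star> e m')) =
        co p (leading_part (e m) \<star> e m' \<oplus>\<^bsub>A\<^esub> e m \<star> leading_part (e m'))" ..
  qed (use cl in \<open>simp_all add: leading_part_closed e_mult\<close>)
qed

lemma leading_part_nilpotent: "nilpotent A leading_part"
proof (rule nilpotent_by_weight[OF leading_part_linear, of deg])
  fix m p assume p: "p \<notin> S" and "co p (leading_part (e m)) \<noteq> 0"
  then have "int_exp p = int_exp m + \<alpha>" by (simp add: co_leading_part split: if_splits)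
  then show "deg m < deg p" using \<alpha> d by fastforce
qed

lemma leading_part_homogeneous: "homogeneous I leading_part"
proof (rule homogeneousI[OF leading_part_linear])
  fix m p q assume "p \<notin> S" "q \<notin> S" "co p (leading_part (e m)) \<noteq> 0" "co q (leading_part (e m)) \<noteq> 0"
  then have "int_exp p = int_exp m + \<alpha>" "int_exp q = int_exp m + \<alpha>" by (simp_all add: co_leading_part split: if_splits)
  then show "p = q" by (metis int_exp_inj)
qed

interpretation leading_part: nilpotent_derivation S I leading_part
  by (rule nilpotent_derivation_intro[OF leading_part_derivation leading_part_nilpotent])

text \<open>Its leading term is minus the piece of degree \<open>\<alpha>\<close> of \<open>u\<close>, so that composing with it cancels this piece.\<close>

abbreviation "leading_exp \<equiv> exp_action A leading_part (- 1)"

lemma leading_exp_gen_group: "leading_exp \<in> gen_group"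
  by (rule ga_gen_group[OF ga_imageI[OF leading_part_derivation leading_part_nilpotent leading_part_homogeneous]])

lemma co_leading_part_power:
  assumes "p \<notin> S" "co p ((leading_part ^^ n) (e m)) \<noteq> 0"
  shows "deg p = deg m + n * d"
  using assms
proof (induction n arbitrary: p)
  case 0
  then show ?case by (simp add: co_e split: if_splits)
next
  case (Suc n)
  have "(\<Sum>q\<in>- S. co q ((leading_part ^^ n) (e m)) * co p (leading_part (e q))) \<noteq> 0"
    using Suc.prems(2) co_endo[OF leading_part_linear leading_part.Dn_closed[OF e_closed]] by simp
  then obtain q where q: "q \<in> - S" "co q ((leading_part ^^ n) (e m)) * co p (leading_part (e q)) \<noteq> 0"
    by (rule sum.not_neutral_contains_not_neutral)
  then have 1: "deg q = deg m + n * d" using Suc.IH by simp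
  have "int_exp p = int_exp q + \<alpha>" using q Suc.prems(1) by (simp add: co_leading_part split: if_splits)
  from \<alpha>[OF this] 1 show ?case by simp
qed

lemma co_leading_exp:
  assumes p: "p \<notin> S" and "deg p \<le> deg m + d"
  shows "co p (leading_exp (e m)) = (if p = m then 1 else 0) - co p (leading_part (e m))"
proof -
  have z: "co p ((leading_part ^^ Suc (Suc n)) (e m)) = 0" for n
  proof (rule ccontr)
    assume "co p ((leading_part ^^ Suc (Suc n)) (e m)) \<noteq> 0"
    from co_leading_part_power[OF p this] show False using assms(2) d by simp
  qed
  have "co p (leading_exp (e m)) = (\<Sum>n<Suc (Suc leading_part.idx). (- 1) ^ n / fact n * co p ((leading_part ^^ n) (e m)))"
    by (rule leading_part.E_form[OF linear_form_co e_closed]) simp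
  also have "\<dots> = co p (e m) - co p (leading_part (e m))"
    unfolding sum.lessThan_Suc_shift z by simp
  finally show ?thesis using p by (simp add: co_e)
qed

lemma co_reduced:
  assumes p: "p \<notin> S" and m: "m \<notin> S" and "deg p \<le> deg m + d"
  shows "co p ((leading_exp \<cdot> u) (e m)) =
    (if p = m then 1 else 0) + (if deg p = deg m + d \<and> int_exp p \<noteq> int_exp m + \<alpha> then co p (u (e m)) else 0)"
proof -
  have ucl: "u (e m) \<in> C" by (simp add: GL_closed Aut_GL u_Aut)
  have "co p ((leading_exp \<cdot> u) (e m)) = (\<Sum>q\<in>- S. co q (u (e m)) * co p (leading_exp (e q)))"
    using co_endo[OF leading_part.E_linear ucl] by (simp add: GL_mult_apply leading_part.E_GL Aut_GL u_Aut)
  also have "\<dots> = (\<Sum>q\<in>- S. (if q = m then co p (leading_exp (e m)) else 0) +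
      (if q = p then (if p = m then 0 else co p (u (e m))) else 0))"
  proof (rule sum.cong[OF refl])
    fix q assume "q \<in> - S"
    then have q: "q \<notin> S" by simp
    show "co q (u (e m)) * co p (leading_exp (e q)) = (if q = m then co p (leading_exp (e m)) else 0) +
      (if q = p then (if p = m then 0 else co p (u (e m))) else 0)"
    proof (cases "q = m")
      case True
      then show ?thesis using u_low[OF m m] d by auto
    next
      case qm: False
      show ?thesis
      proof (cases "deg q < deg m + d")
        case True
        then have "co q (u (e m)) = 0" using u_low[OF m q] qm by simp
        then show ?thesis using qm by auto
      next
        case False
        then have "deg p \<le> deg q" using assms(3) by simp
        then have "co p (leading_part (e q)) = 0" using \<alpha>[of p q] d by (auto simp: co_leading_part[OF p])
        then have "co p (leading_exp (e q)) = (if p = q then 1 else 0)"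
          using co_leading_exp[OF p, of q] \<open>deg p \<le> deg q\<close> by simp
        then show ?thesis using qm by auto
      qed
    qed
  qed
  also have "\<dots> = co p (leading_exp (e m)) + (if p = m then 0 else co p (u (e m)))"
    using p m fin by (simp add: sum.distrib sum.delta)
  also have "\<dots> = (if p = m then 1 else 0) + (if deg p = deg m + d \<and> int_exp p \<noteq> int_exp m + \<alpha> then co p (u (e m)) else 0)"
  proof (cases "deg p = deg m + d")
    case True
    then have "p \<noteq> m" using d by auto
    then show ?thesis using True by (simp add: co_leading_exp[OF p] co_leading_part[OF p])
  next
    case False
    then have lt: "deg p < deg m + d" using assms(3) by simp
    have "int_exp p \<noteq> int_exp m + \<alpha>" using False \<alpha> by blast
    then show ?thesis using lt u_low[OF m p lt] by (simp add: co_leading_exp[OF p] co_leading_part[OF p])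
  qed
  finally show ?thesis .
qed

lemma reduced_unipotent: "leading_exp \<cdot> u \<in> unipotent d"
  unfolding unipotent_def
proof (intro CollectI conjI allI impI)
  show "leading_exp \<cdot> u \<in> carrier (Aut A)" by (rule Aut_mult_closed[OF leading_part.E_Aut u_Aut])
  fix m p assume "m \<notin> S" "p \<notin> S" "deg p < deg m + d"
  then show "co p ((leading_exp \<cdot> u) (e m)) = (if p = m then 1 else 0)" using co_reduced[of p m] by simp
qed

lemma reduced_leading_degrees: "leading_degrees d (leading_exp \<cdot> u) \<subseteq> leading_degrees d u - {\<alpha>}"
proof
  fix \<beta> assume "\<beta> \<in> leading_degrees d (leading_exp \<cdot> u)"
  then obtain p m where b: "\<beta> = int_exp p - int_exp m" "p \<notin> S" "m \<notin> S" "deg p = deg m + d"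
      "co p ((leading_exp \<cdot> u) (e m)) \<noteq> 0"
    unfolding leading_degrees_def by (elim CollectE exE conjE) simp
  have pm: "p \<noteq> m" using b(4) d by auto
  have "co p ((leading_exp \<cdot> u) (e m)) = (if int_exp p \<noteq> int_exp m + \<alpha> then co p (u (e m)) else 0)"
    using co_reduced[OF b(2,3)] b(4) pm by simp
  then have "int_exp p \<noteq> int_exp m + \<alpha>" "co p (u (e m)) \<noteq> 0" using b(5) by (auto split: if_splits)
  moreover from this have "\<beta> \<noteq> \<alpha>" using b(1) by auto
  ultimately show "\<beta> \<in> leading_degrees d u - {\<alpha>}" using b(1-4) unfolding leading_degrees_def by blast
qed

end

lemma unipotent_Suc: assumes "u \<in> unipotent d" "leading_degrees d u = {}" "1 \<le> d" shows "u \<in> unipotent (Suc d)"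
  unfolding unipotent_def
proof (intro CollectI conjI allI impI)
  show "u \<in> carrier (Aut A)" using assms(1) by (simp add: unipotent_def)
  fix m p assume mp: "m \<notin> S" "p \<notin> S" "deg p < deg m + Suc d"
  show "co p (u (e m)) = (if p = m then 1 else 0)"
  proof (cases "deg p < deg m + d")
    case True
    then show ?thesis using mp assms(1) by (simp add: unipotent_def)
  next
    case False
    then have dp: "deg p = deg m + d" using mp(3) by simp
    have "co p (u (e m)) = 0"
    proof (rule ccontr)
      assume "co p (u (e m)) \<noteq> 0"
      then have "int_exp p - int_exp m \<in> leading_degrees d u" using mp dp unfolding leading_degrees_def by blast
      then show False using assms(2) by simp
    qed
    then show ?thesis using dp assms(3) by auto
  qed
qed

text \<open>Induction on the number of degrees left above \<open>d\<close>, and for fixed \<open>d\<close> on the number of homogeneous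
pieces that remain; when \<open>d\<close> exceeds all degrees of standard monomials, \<open>u\<close> is the identity.\<close>

lemma unipotent_gen_group:
  assumes "u \<in> unipotent d" "1 \<le> d"
  shows "u \<in> gen_group"
proof -
  obtain R where R: "\<And>m. m \<notin> S \<Longrightarrow> deg m < R" by (rule deg_bound) blast
  show ?thesis using assms
  proof (induction "R - d" arbitrary: d u rule: less_induct)
    case (less d)
    show ?case
    proof (cases "R \<le> d")
      case True
      have uA: "u \<in> carrier (Aut A)" using less.prems(1) by (simp add: unipotent_def)
      have "u = \<one>\<^bsub>GL A\<^esub>"
      proof (rule Aut_eqI[OF uA subgroup.one_closed[OF subgroup_Aut]])
        fix i
        have "u (xg i) = xg i"
        proof (rule co_eqI)
          fix p assume p: "p \<notin> S"
          then have "deg p < deg (X1 i) + d" using R[OF p] True by simp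
          then show "co p (u (xg i)) = co p (xg i)" using less.prems(1) p by (simp add: unipotent_def co_e)
        qed (simp_all add: GL_closed Aut_GL uA)
        then show "u (xg i) = \<one>\<^bsub>GL A\<^esub> (xg i)" by (simp add: GL_one)
      qed
      then show ?thesis by (simp add: gen_group_one)
    next
      case False
      note outer = less.hyps
      show ?thesis using less.prems(1)
      proof (induction "card (leading_degrees d u)" arbitrary: u rule: less_induct)
        case (less u)
        show ?case
        proof (cases "leading_degrees d u = {}")
          case True
          then have "u \<in> unipotent (Suc d)" using unipotent_Suc less.prems \<open>1 \<le> d\<close> by blast
          then show ?thesis using outer[of "Suc d" u] False by simp
        next
          case ne: False
          then obtain \<alpha> where \<alpha>Q: "\<alpha> \<in> leading_degrees d u" by blast
          then obtain p0 m0 where \<alpha>: "\<alpha> = int_exp p0 - int_exp m0" "deg p0 = deg m0 + d"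
            unfolding leading_degrees_def by (elim CollectE exE conjE) simp
          have sh: "deg p = deg m + d" if "int_exp p = int_exp m + \<alpha>" for p m
            using int_exp_deg_shift[OF \<alpha>(2), of p m] that \<alpha>(1) by simp
          note step = less.prems \<open>1 \<le> d\<close> sh
          let ?h = "exp_action A (leading_part u \<alpha>) (- 1)"
          have hH: "?h \<in> gen_group" by (rule leading_exp_gen_group[OF step])
          have reduced: "?h \<cdot> u \<in> unipotent d" by (rule reduced_unipotent[OF step])
          have "leading_degrees d (?h \<cdot> u) \<subset> leading_degrees d u" using reduced_leading_degrees[OF step] \<alpha>Q by blast
          then have "card (leading_degrees d (?h \<cdot> u)) < card (leading_degrees d u)" by (intro psubset_card_mono finite_leading_degrees)
          then have huH: "?h \<cdot> u \<in> gen_group" using less.hyps reduced by blast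
          have hG: "?h \<in> G" using subgroup.mem_carrier[OF subgroup_gen_group hH] .
          have uG: "u \<in> G" using less.prems by (simp add: unipotent_def Aut_GL)
          have "u = ginv ?h \<cdot> (?h \<cdot> u)"
            using hG uG by (simp add: GL.m_assoc[symmetric])
          then show ?thesis using gen_group_mult[OF gen_group_inv[OF hH] huH] by simp
        qed
      qed
    qed
  qed
qed

end

section \<open>Automorphisms induced by semigroup automorphisms\<close>

text \<open>\<^const>\<open>Poly_Mapping.map_key\<close> is contravariant, hence the inverse.\<close>

definition mperm :: "('n \<Rightarrow> 'n) \<Rightarrow> 'n::finite monom \<Rightarrow> 'n monom"
  where "mperm \<tau> m = Poly_Mapping.map_key (inv_into UNIV \<tau>) m"

lemma bij_inv_inj: "bij \<tau> \<Longrightarrow> inj (inv_into UNIV \<tau>)"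
  by (simp add: bij_imp_bij_inv bij_is_inj)

lemma lookup_mperm: "bij \<tau> \<Longrightarrow> lk (mperm \<tau> m) i = lk m (inv_into UNIV \<tau> i)"
  by (simp add: mperm_def map_key.rep_eq bij_inv_inj)

lemma mperm_add: "bij \<tau> \<Longrightarrow> mperm \<tau> (m + m') = mperm \<tau> m + mperm \<tau> m'"
  by (rule poly_mapping_eqI) (simp add: lookup_mperm lookup_add)

lemma mperm_zero: "bij \<tau> \<Longrightarrow> mperm \<tau> 0 = 0"
  by (rule poly_mapping_eqI) (simp add: lookup_mperm)

lemma mperm_X1: "bij \<tau> \<Longrightarrow> mperm \<tau> (X1 k) = X1 (\<tau> k)"
  by (rule poly_mapping_eqI) (simp add: lookup_mperm lookup_X1, metis bij_inv_eq_iff)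

lemma mperm_id: "mperm id m = m"
  by (rule poly_mapping_eqI) (simp add: lookup_mperm)

lemma deg_mperm: "bij \<tau> \<Longrightarrow> deg (mperm \<tau> m) = deg m"
  by (induction m rule: monom_induct) (simp_all add: mperm_add mperm_zero mperm_X1 deg_add deg_X1)

lemma mperm_inverse: "bij \<tau> \<Longrightarrow> mperm \<tau> (mperm (inv_into UNIV \<tau>) m) = m"
  "bij \<tau> \<Longrightarrow> mperm (inv_into UNIV \<tau>) (mperm \<tau> m) = m"
  by (rule poly_mapping_eqI, simp add: lookup_mperm bij_imp_bij_inv inv_inv_eq
      surj_f_inv_f bij_is_surj inv_f_f bij_is_inj)+

lemma bij_mperm: assumes "bij \<tau>" shows "bij (mperm \<tau>)"
  by (rule bij_betw_byWitness[where f' = "mperm (inv_into UNIV \<tau>)"]) (simp_all add: mperm_inverse assms)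

lemma semigroup_aut_mperm: "bij \<tau> \<Longrightarrow> semigroup_aut (mperm \<tau>)"
  by (simp add: semigroup_aut_def bij_mperm mperm_add)

lemma semigroup_aut_inv:
  assumes "semigroup_aut \<sigma>"
  shows "semigroup_aut (inv_into UNIV \<sigma>)"
  unfolding semigroup_aut_def
proof (intro conjI allI)
  have b: "bij \<sigma>" and add: "\<And>m m'. \<sigma> (m + m') = \<sigma> m + \<sigma> m'"
    using assms by (simp_all add: semigroup_aut_def)
  show "bij (inv_into UNIV \<sigma>)" using b by (rule bij_imp_bij_inv)
  fix m m'
  have "\<sigma> (inv_into UNIV \<sigma> m + inv_into UNIV \<sigma> m') = m + m'" using b by (simp add: add surj_f_inv_f bij_is_surj)
  then show "inv_into UNIV \<sigma> (m + m') = inv_into UNIV \<sigma> m + inv_into UNIV \<sigma> m'" by (metis b bij_inv_eq_iff)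
qed

context artin_quotient begin

lemma supp_I: "supp I = S"
  by (auto simp: supp_def I_eq xmon_def)

text \<open>The automorphism \<open>x\<^sup>m \<mapsto> x\<^sup>\<sigma>\<^sup>m\<close>, described by coefficients.\<close>

definition aut_of :: "('n monom \<Rightarrow> 'n monom) \<Rightarrow> ('n, 'k) mpoly set \<Rightarrow> ('n, 'k) mpoly set"
  where "aut_of \<sigma> = (\<lambda>a\<in>C. mk (\<lambda>m. co (inv_into UNIV \<sigma> m) a))"

context
  fixes \<sigma> :: "'n monom \<Rightarrow> 'n monom"
  assumes \<sigma>: "semigroup_aut \<sigma>" "\<sigma> ` S = S"
begin

lemma bij_sigma: "bij \<sigma>"
  using \<sigma>(1) by (simp add: semigroup_aut_def)

lemma inv_sigma_S: "inv_into UNIV \<sigma> m \<in> S \<longleftrightarrow> m \<in> S"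
  using \<sigma>(2) bij_sigma by (metis bij_inv_eq_iff image_iff)

lemma inv_sigma_image: "inv_into UNIV \<sigma> ` S = S"
  using inv_sigma_S bij_sigma by (metis \<sigma>(2) bij_def inv_f_f image_inv_f_f)

lemma co_aut_of: "a \<in> C \<Longrightarrow> co m (aut_of \<sigma> a) = co (inv_into UNIV \<sigma> m) a"
  by (simp add: aut_of_def co_mk inv_sigma_S)

lemma aut_of_closed: "a \<in> C \<Longrightarrow> aut_of \<sigma> a \<in> C"
  by (simp add: aut_of_def)

lemma aut_of_linear: "linear_endo A (aut_of \<sigma>)"
  by (intro linear_endoI co_eqI) (simp_all add: aut_of_closed co_aut_of)

lemma aut_of_e: "aut_of \<sigma> (e m) = e (\<sigma> m)"
proof (rule co_eqI)
  fix p assume p: "p \<notin> S"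
  have "inv_into UNIV \<sigma> p = m \<longleftrightarrow> p = \<sigma> m" using bij_sigma by (metis bij_inv_eq_iff)
  then show "co p (aut_of \<sigma> (e m)) = co p (e (\<sigma> m))" using p by (simp add: co_aut_of co_e inv_sigma_S)
qed (simp_all add: aut_of_closed)

lemma induced_eq_aut_of: "induced_map I I (Poly_Mapping.map_key (inv_into UNIV \<sigma>)) = aut_of \<sigma>"
proof (rule extensionalityI[of _ C])
  let ?f = "Poly_Mapping.map_key (inv_into UNIV \<sigma>) :: ('n, 'k) mpoly \<Rightarrow> ('n, 'k) mpoly"
  have lf: "lk (?f p) m = lk p (inv_into UNIV \<sigma> m)" for p m
    using bij_sigma by (simp add: map_key.rep_eq bij_imp_bij_inv bij_is_inj)
  fix a assume "a \<in> C"
  then obtain p where p: "a = cls p" by (rule carrierE)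
  have "induced_map I I ?f a = cls (?f p)"
    unfolding induced_map_def p
    by (simp, rule UN_cls_eq) (simp_all add: I_iff lookup_minus lf lookup_add inv_sigma_S)
  also have "\<dots> = aut_of \<sigma> a"
    by (rule co_eqI) (simp_all add: p aut_of_closed co_aut_of co_cls lf inv_sigma_S)
  finally show "induced_map I I ?f a = aut_of \<sigma> a" .
qed (simp_all add: induced_map_def aut_of_def)

end

lemma
  assumes \<sigma>: "semigroup_aut \<sigma>" "\<sigma> ` S = S"
  shows aut_of_Aut: "aut_of \<sigma> \<in> carrier (Aut A)"
    and aut_of_inv: "a \<in> C \<Longrightarrow> (ginv (aut_of \<sigma>)) a = aut_of (inv_into UNIV \<sigma>) a"
proof -
  note \<sigma>' = semigroup_aut_inv[OF \<sigma>(1)] inv_sigma_image[OF \<sigma>]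
  have b: "bij \<sigma>" using \<sigma> by (rule bij_sigma)
  have ext: "aut_of \<sigma> \<in> extensional C" by (simp add: aut_of_def)
  have 1: "aut_of \<sigma> (aut_of (inv_into UNIV \<sigma>) a) = a" "aut_of (inv_into UNIV \<sigma>) (aut_of \<sigma> a) = a" if "a \<in> C" for a
    using that b
    by (intro co_eqI; simp add: aut_of_closed[OF \<sigma>] aut_of_closed[OF \<sigma>'] co_aut_of[OF \<sigma>] co_aut_of[OF \<sigma>']
        inv_inv_eq surj_f_inv_f bij_is_surj inv_f_f bij_is_inj)+
  have GL: "aut_of \<sigma> \<in> G" by (rule GL_I(1)[OF aut_of_linear[OF \<sigma>] aut_of_linear[OF \<sigma>'] ext 1])
  show "a \<in> C \<Longrightarrow> (ginv (aut_of \<sigma>)) a = aut_of (inv_into UNIV \<sigma>) a"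
    by (rule GL_I(2)[OF aut_of_linear[OF \<sigma>] aut_of_linear[OF \<sigma>'] ext 1])
  have add: "\<sigma> (m + m') = \<sigma> m + \<sigma> m'" for m m' using \<sigma>(1) by (simp add: semigroup_aut_def)
  show "aut_of \<sigma> \<in> carrier (Aut A)"
  proof (rule AutI[OF GL])
    show "aut_of \<sigma> (a \<star> b) = aut_of \<sigma> a \<star> aut_of \<sigma> b" if "a \<in> C" "b \<in> C" for a b
      by (rule mult_basis[OF aut_of_linear[OF \<sigma>] _ that]) (simp add: e_mult aut_of_e[OF \<sigma>] add)
  qed
qed

lemma semigroup_induced_eq: "semigroup_induced I = {aut_of \<sigma> |\<sigma>. semigroup_aut \<sigma> \<and> \<sigma> ` S = S}"
  unfolding semigroup_induced_def supp_I
proof (intro equalityI subsetI)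
  fix g assume "g \<in> {induced_map I I (Poly_Mapping.map_key (inv_into UNIV \<sigma>)) |\<sigma>. semigroup_aut \<sigma> \<and> \<sigma> ` S = S}"
  then obtain \<sigma> where \<sigma>: "g = induced_map I I (Poly_Mapping.map_key (inv_into UNIV \<sigma>))" "semigroup_aut \<sigma>" "\<sigma> ` S = S"
    by (elim CollectE exE conjE)
  then show "g \<in> {aut_of \<sigma> |\<sigma>. semigroup_aut \<sigma> \<and> \<sigma> ` S = S}"
    by (intro CollectI exI[of _ \<sigma>]) (simp add: induced_eq_aut_of)
next
  fix g assume "g \<in> {aut_of \<sigma> |\<sigma>. semigroup_aut \<sigma> \<and> \<sigma> ` S = S}"
  then obtain \<sigma> where \<sigma>: "g = aut_of \<sigma>" "semigroup_aut \<sigma>" "\<sigma> ` S = S" by (elim CollectE exE conjE)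
  then show "g \<in> {induced_map I I (Poly_Mapping.map_key (inv_into UNIV \<sigma>)) |\<sigma>. semigroup_aut \<sigma> \<and> \<sigma> ` S = S}"
    by (intro CollectI exI[of _ \<sigma>]) (simp add: induced_eq_aut_of)
qed

lemma lin_tor: "lin (tor c) k l = (if k = l then c k else 0)"
  by (simp add: lin_def co_tor co_e X1_eq_iff cmon_X1)

text \<open>If the linear part of \<open>g\<close> is a monomial matrix, the part of lowest degree of \<open>g x\<^sup>m\<close> is the monomial obtained
by substituting the linear parts.\<close>

lemma monomial_leading:
  assumes g: "g \<in> carrier (Aut A)" and \<tau>: "bij \<tau>"
    and Lg: "\<And>k l. lin g k l = (if l = \<tau> k then c k else 0)"
    and "p \<notin> S" "deg p \<le> deg m"
  shows "co p (g (e m)) = (if p = mperm \<tau> m then cmon c m else 0)"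
  using assms(4,5)
proof (induction m arbitrary: p rule: monom_induct)
  case zero
  have "co 0 (g (e 0)) = 1" using co_e[of 0 0] by (simp add: e_0 Aut_one[OF g])
  then show ?case using zero \<tau> by (simp add: mperm_zero deg_eq_0_iff)
next
  case (single k m)
  have "co p (g (e (X1 k + m))) = (\<Sum>(q, r)\<in>splits p. co q (g (xg k)) * co r (g (e m)))"
    using g single.prems(1) by (simp add: e_mult[symmetric] Aut_mult co_mult GL_closed Aut_GL)
  also have "\<dots> = (\<Sum>x\<in>splits p. if x = (X1 (\<tau> k), mperm \<tau> m) then c k * cmon c m else 0)"
  proof (rule sum.cong[OF refl], clarify)
    fix q r assume "(q, r) \<in> splits p"
    then have qr: "p = q + r" by (simp add: splits_def)
    then have S: "q \<notin> S" "r \<notin> S" using single.prems(1) up up' by metis+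
    have d: "deg q + deg r \<le> Suc (deg m)"
      using single.prems(2) by (simp add: qr deg_add deg_X1)
    consider "deg q = 0" | "deg q = 1" | "2 \<le> deg q" by linarith
    then show "co q (g (xg k)) * co r (g (e m)) =
        (if (q, r) = (X1 (\<tau> k), mperm \<tau> m) then c k * cmon c m else 0)"
    proof cases
      case 1
      then have "q = 0" by (simp add: deg_eq_0_iff)
      moreover have "(0 :: 'n monom) \<noteq> X1 (\<tau> k)" using deg_X1[of "\<tau> k"] by (metis deg_zero zero_neq_one)
      ultimately show ?thesis by (simp add: Aut_co_zero[OF g])
    next
      case 2
      then obtain l where l: "q = X1 l" using deg_one_iff by blast
      have "co q (g (xg k)) = (if l = \<tau> k then c k else 0)" using Lg[of k l] by (simp add: lin_def l)
      moreover have "co r (g (e m)) = (if r = mperm \<tau> m then cmon c m else 0)"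
        using S(2) d 2 by (intro single.IH) simp_all
      ultimately show ?thesis by (simp add: l X1_eq_iff)
    next
      case 3
      then have "co r (g (e m)) = (if r = mperm \<tau> m then cmon c m else 0)"
        using S(2) d by (intro single.IH) simp_all
      moreover have "r \<noteq> mperm \<tau> m" using d 3 deg_mperm[OF \<tau>, of m] by auto
      ultimately show ?thesis by simp
    qed
  qed
  also have "\<dots> = (if (X1 (\<tau> k), mperm \<tau> m) \<in> splits p then c k * cmon c m else 0)"
    by (rule sum.delta) simp
  also have "\<dots> = (if p = mperm \<tau> (X1 k + m) then cmon c (X1 k + m) else 0)"
    using \<tau> by (auto simp: splits_def mperm_add mperm_X1 cmon_add cmon_X1)
  finally show ?case .
qed

end

context artin_quotient_char0 begin

section \<open>Elimination\<close>

text \<open>This set is eventually identified with the identity component. The condition on the inverse makes it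
a subgroup without any further argument, and it is a closed condition too.\<close>

definition triangular :: "(('n, 'k) mpoly set \<Rightarrow> ('n, 'k) mpoly set) set"
  where "triangular = {g \<in> carrier (Aut A). (\<forall>k l. lin g k l \<noteq> 0 \<longrightarrow> root_le k l) \<and>
    (\<forall>k l. lin (ginv g) k l \<noteq> 0 \<longrightarrow> root_le k l)}"

lemma triangular_Aut: "g \<in> triangular \<Longrightarrow> g \<in> carrier (Aut A)"
  by (simp add: triangular_def)

lemma lin_mult_root_le:
  assumes "g \<in> carrier (Aut A)" "h \<in> carrier (Aut A)"
    and "\<And>k l. lin g k l \<noteq> 0 \<Longrightarrow> root_le k l" "\<And>k l. lin h k l \<noteq> 0 \<Longrightarrow> root_le k l"
    and "lin (g \<cdot> h) k l \<noteq> 0"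
  shows "root_le k l"
proof -
  have "(\<Sum>p\<in>UNIV. lin h k p * lin g p l) \<noteq> 0" using assms(5) by (simp add: lin_mult assms(1,2))
  then obtain p where "lin h k p * lin g p l \<noteq> 0" by (rule sum.not_neutral_contains_not_neutral)
  then show ?thesis using assms(3,4) root_le_trans by (metis mult_eq_0_iff)
qed

lemma subgroup_triangular: "subgroup triangular (GL A)"
proof (rule GL.subgroupI)
  show "triangular \<subseteq> G" by (rule subsetI) (simp add: triangular_Aut Aut_GL)
  have "\<one>\<^bsub>GL A\<^esub> \<in> triangular"
    unfolding triangular_def using subgroup.one_closed[OF subgroup_Aut] by (auto simp: lin_one)
  then show "triangular \<noteq> {}" by (metis empty_iff)
  show "ginv g \<in> triangular" if "g \<in> triangular" for g
    using that by (simp add: triangular_def Aut_inv_closed Aut_GL)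
  fix g h assume g: "g \<in> triangular" and h: "h \<in> triangular"
  have gA: "g \<in> carrier (Aut A)" "h \<in> carrier (Aut A)" using g h by (simp_all add: triangular_Aut)
  have l: "\<And>k l. lin g k l \<noteq> 0 \<Longrightarrow> root_le k l" "\<And>k l. lin h k l \<noteq> 0 \<Longrightarrow> root_le k l"
    "\<And>k l. lin (ginv g) k l \<noteq> 0 \<Longrightarrow> root_le k l" "\<And>k l. lin (ginv h) k l \<noteq> 0 \<Longrightarrow> root_le k l"
    using g h unfolding triangular_def by simp_all
  have i: "ginv (g \<cdot> h) = ginv h \<cdot> ginv g"
    using gA by (simp add: GL.inv_mult_group Aut_GL)
  show "g \<cdot> h \<in> triangular" unfolding triangular_def
  proof (intro CollectI conjI allI impI Aut_mult_closed gA)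
    show "root_le k l" if "lin (g \<cdot> h) k l \<noteq> 0" for k l
      by (rule lin_mult_root_le[OF gA l(1,2) that])
    show "root_le k l" if "lin (ginv (g \<cdot> h)) k l \<noteq> 0" for k l
      by (rule lin_mult_root_le[OF Aut_inv_closed[OF gA(2)] Aut_inv_closed[OF gA(1)] l(4,3) that[unfolded i]])
  qed
qed

lemma triangular_closed: "closedin (zariski A) triangular"
proof -
  let ?P = "{(k, l). \<not> root_le k l}"
  let ?F = "(\<lambda>(k, l) g. co (X1 l) (g (xg k))) ` ?P \<union> (\<lambda>(k, l) g. co (X1 l) ((ginv g) (xg k))) ` ?P"
  have "?F \<subseteq> regular_fun A"
    by (intro Un_least image_subsetI; clarify;
        intro regular_fun.coeff regular_fun.inv_coeff linear_form_co e_closed)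
  then have "closedin (zariski A) (carrier (Aut A) \<inter> {g \<in> G. \<forall>f\<in>?F. f g = 0})"
    by (intro closedin_Int Aut_closed closedin_zeros)
  moreover have "carrier (Aut A) \<inter> {g \<in> G. \<forall>f\<in>?F. f g = 0} = triangular"
  proof (intro equalityI subsetI)
    fix g assume g: "g \<in> carrier (Aut A) \<inter> {g \<in> G. \<forall>f\<in>?F. f g = 0}"
    then show "g \<in> triangular" unfolding triangular_def lin_def by auto
  next
    fix g assume g: "g \<in> triangular"
    then show "g \<in> carrier (Aut A) \<inter> {g \<in> G. \<forall>f\<in>?F. f g = 0}"
      unfolding triangular_def lin_def by (auto simp: Aut_GL)
  qed
  ultimately show ?thesis by simp
qed

text \<open>Elimination only multiplies by elements of this group. Carrying both properties along serves two
purposes: membership in the generated group is the goal, membership in \<open>triangular\<close> is needed to see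
that finitely many translates of \<open>triangular\<close> cover the group.\<close>

definition tri_gen :: "(('n, 'k) mpoly set \<Rightarrow> ('n, 'k) mpoly set) set"
  where "tri_gen = triangular \<inter> gen_group"

lemma subgroup_tri_gen: "subgroup tri_gen (GL A)"
  unfolding tri_gen_def by (rule GL.subgroups_Inter_pair[OF subgroup_triangular subgroup_gen_group])

lemmas tri_gen_mult = subgroup.m_closed[OF subgroup_tri_gen]
lemmas tri_gen_inv = subgroup.m_inv_closed[OF subgroup_tri_gen]
lemmas tri_gen_one = subgroup.one_closed[OF subgroup_tri_gen]

lemma tri_gen_Aut: "g \<in> tri_gen \<Longrightarrow> g \<in> carrier (Aut A)"
  by (simp add: tri_gen_def triangular_Aut)

lemma tri_gen_GL: "g \<in> tri_gen \<Longrightarrow> g \<in> G"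
  by (simp add: tri_gen_Aut Aut_GL)

lemma T_tri_gen: assumes "g \<in> T" shows "g \<in> tri_gen"
proof -
  obtain c where c: "g = tor c" "\<And>i. c i \<noteq> 0" using assms by (rule torE) simp
  have "g \<in> triangular" unfolding triangular_def
    using T_Aut[OF assms] c by (auto simp: tor_inv_eq lin_tor split: if_splits)
  then show ?thesis using T_gen_group[OF assms] by (simp add: tri_gen_def)
qed

lemma exp_root_der_tri_gen: assumes "i \<noteq> j" "root_le i j" shows "exp_action A (root_der i j) s \<in> tri_gen"
proof -
  have "exp_action A (root_der i j) s \<in> triangular" unfolding triangular_def
    using assms(2) exp_root_der_Aut[OF assms] by (auto simp: exp_root_der_inv[OF assms] lin_exp_root_der[OF assms] split: if_splits)
  then show ?thesis using ga_gen_group[OF exp_root_der_ga[OF assms]] by (simp add: tri_gen_def)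
qed

lemma unipotent_tri_gen: assumes u: "u \<in> unipotent 1" shows "u \<in> tri_gen"
proof -
  have uA: "u \<in> carrier (Aut A)" using u by (simp add: unipotent_def)
  have Lu: "lin u k l = (if k = l then 1 else 0)" for k l
    using u by (auto simp: unipotent_def lin_def deg_X1 X1_eq_iff)
  have "lin (ginv u) k l = (if k = l then 1 else 0)" for k l
    using lin_inv[OF uA, of k l] by (simp add: Lu if_distrib[of "\<lambda>x. x * _"] sum.delta cong: if_cong)
  then have "u \<in> triangular" using uA by (auto simp: triangular_def Lu split: if_splits)
  then show ?thesis using unipotent_gen_group[OF u] by (simp add: tri_gen_def)
qed

lemma lin_root_der_mult:
  assumes "i \<noteq> j" "root_le i j" "g \<in> carrier (Aut A)"
  shows "lin (exp_action A (root_der i j) s \<cdot> g) k l = lin g k l + (if l = j then s * lin g k i else 0)"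
proof -
  have "lin (exp_action A (root_der i j) s \<cdot> g) k l =
      (\<Sum>p\<in>UNIV. (if p = l then lin g k l else 0) + (if p = i then (if l = j then s * lin g k i else 0) else 0))"
    unfolding lin_mult[OF exp_root_der_Aut[OF assms(1,2)] assms(3)]
    by (rule sum.cong) (auto simp: lin_exp_root_der[OF assms(1,2)] algebra_simps)
  also have "\<dots> = lin g k l + (if l = j then s * lin g k i else 0)" by (simp add: sum.distrib)
  finally show ?thesis .
qed

text \<open>Clears row \<open>k\<close> except for a pivot \<open>i\<close>. The pivot is chosen such that also the entry \<open>(i, k)\<close> of the inverse is
nonzero; by \<open>root_of_automorphism\<close> the required column operations are then automorphisms of \<open>A\<close>. Rows with a zero
in column \<open>i\<close> are not touched.\<close>

lemma elim_step:
  assumes g: "g \<in> carrier (Aut A)"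
  obtains h i where "h \<in> tri_gen" "lin g k i \<noteq> 0" "lin (ginv g) i k \<noteq> 0"
    "\<And>l. lin (h \<cdot> g) k l \<noteq> 0 \<longleftrightarrow> l = i"
    "\<And>k' l. lin g k' i = 0 \<Longrightarrow> lin (h \<cdot> g) k' l = lin g k' l"
proof -
  have "(\<Sum>p\<in>UNIV. lin g k p * lin (ginv g) p k) \<noteq> 0" by (simp add: lin_inv[OF g])
  then obtain i where "lin g k i * lin (ginv g) i k \<noteq> 0"
    by (rule sum.not_neutral_contains_not_neutral)
  then have i: "lin g k i \<noteq> 0" "lin (ginv g) i k \<noteq> 0" by simp_all
  have "\<exists>h\<in>tri_gen. (\<forall>l. lin (h \<cdot> g) k l = (if l \<in> J then 0 else lin g k l)) \<and>
      (\<forall>k' l. lin g k' i = 0 \<longrightarrow> lin (h \<cdot> g) k' l = lin g k' l)"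
    if "finite J" "i \<notin> J" for J
    using that
  proof (induction J rule: finite_induct)
    case empty
    show ?case by (intro bexI[OF _ tri_gen_one]) (simp add: Aut_GL g)
  next
    case (insert j J)
    then obtain h where h: "h \<in> tri_gen" "\<And>l. lin (h \<cdot> g) k l = (if l \<in> J then 0 else lin g k l)"
      "\<And>k' l. lin g k' i = 0 \<Longrightarrow> lin (h \<cdot> g) k' l = lin g k' l" by auto
    show ?case
    proof (cases "lin g k j = 0")
      case True
      then show ?thesis using h by (intro bexI[OF _ h(1)]) auto
    next
      case False
      have ij: "i \<noteq> j" using insert.prems by auto
      have lij: "root_le i j" by (rule root_of_automorphism[OF g i(2) False])
      \<comment> \<open>The parameter is chosen to cancel the entry \<open>(k, j)\<close>.\<close>
      let ?E = "exp_action A (root_der i j) (- (lin g k j / lin g k i))"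
      have hg: "h \<cdot> g \<in> carrier (Aut A)" by (rule Aut_mult_closed[OF tri_gen_Aut[OF h(1)] g])
      have EK: "?E \<in> tri_gen" by (rule exp_root_der_tri_gen[OF ij lij])
      have as: "(?E \<cdot> h) \<cdot> g = ?E \<cdot> (h \<cdot> g)"
        by (intro GL.m_assoc tri_gen_GL EK h(1) Aut_GL g)
      show ?thesis
      proof (intro bexI[OF _ tri_gen_mult[OF EK h(1)]] conjI allI impI)
        show "lin (?E \<cdot> h \<cdot> g) k l = (if l \<in> insert j J then 0 else lin g k l)" for l
          unfolding as lin_root_der_mult[OF ij lij hg] h(2) using insert.prems insert.hyps i(1) by auto
        show "lin (?E \<cdot> h \<cdot> g) k' l = lin g k' l" if "lin g k' i = 0" for k' l
          unfolding as lin_root_der_mult[OF ij lij hg] h(3)[OF that] using that by simp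
      qed
    qed
  qed
  from this[of "- {i}"] obtain h where h: "h \<in> tri_gen"
    "\<forall>l. lin (h \<cdot> g) k l = (if l \<in> - {i} then 0 else lin g k l)"
    "\<forall>k' l. lin g k' i = 0 \<longrightarrow> lin (h \<cdot> g) k' l = lin g k' l" by auto
  show thesis by (rule that[OF h(1) i]) (use h i in auto)
qed

text \<open>If the rows in \<open>K\<close> are already cleared, the identity \<open>lin g * lin g\<^sup>-\<^sup>1 = 1\<close> in row \<open>k'\<close> and column \<open>k\<close> has a
single term, which would not vanish if the old pivot were reused.\<close>

lemma pivot_new:
  assumes g: "g \<in> carrier (Aut A)" and K: "\<And>k' l. k' \<in> K \<Longrightarrow> lin g k' l \<noteq> 0 \<longleftrightarrow> l = \<tau> k'"
    and k: "k \<notin> K" and i: "lin (ginv g) i k \<noteq> 0" and k': "k' \<in> K"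
  shows "\<tau> k' \<noteq> i"
proof
  assume t: "\<tau> k' = i"
  have "(\<Sum>p\<in>UNIV. lin g k' p * lin (ginv g) p k) = 0" using k k' by (auto simp: lin_inv[OF g])
  moreover have "(\<Sum>p\<in>UNIV. lin g k' p * lin (ginv g) p k) =
      (\<Sum>p\<in>UNIV. if p = i then lin g k' i * lin (ginv g) i k else 0)"
    by (rule sum.cong) (use K[OF k'] t in auto)
  ultimately have "lin g k' i * lin (ginv g) i k = 0" by (simp add: sum.delta)
  then show False using K[OF k', of i] t i by simp
qed

lemma elim_all:
  assumes g: "g \<in> carrier (Aut A)" and "finite K"
  shows "\<exists>h\<in>tri_gen. \<exists>\<tau>. inj_on \<tau> K \<and> (\<forall>k\<in>K. \<forall>l. lin (h \<cdot> g) k l \<noteq> 0 \<longleftrightarrow> l = \<tau> k)"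
  using assms(2)
proof (induction K rule: finite_induct)
  case empty
  show ?case by (intro bexI[OF _ tri_gen_one] exI[of _ id]) simp
next
  case (insert k K)
  then obtain h \<tau> where h: "h \<in> tri_gen" and \<tau>: "inj_on \<tau> K"
    "\<And>k l. k \<in> K \<Longrightarrow> lin (h \<cdot> g) k l \<noteq> 0 \<longleftrightarrow> l = \<tau> k" by auto
  let ?g = "h \<cdot> g"
  have g1: "?g \<in> carrier (Aut A)" by (rule Aut_mult_closed[OF tri_gen_Aut[OF h] g])
  obtain h1 i where s: "h1 \<in> tri_gen" "lin ?g k i \<noteq> 0" "lin (ginv ?g) i k \<noteq> 0"
    "\<And>l. lin (h1 \<cdot> ?g) k l \<noteq> 0 \<longleftrightarrow> l = i"
    "\<And>k' l. lin ?g k' i = 0 \<Longrightarrow> lin (h1 \<cdot> ?g) k' l = lin ?g k' l"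
    using g1 by (rule elim_step[of ?g k]) auto
  have new: "\<tau> k' \<noteq> i" if "k' \<in> K" for k'
    by (rule pivot_new[OF g1 \<tau>(2) insert.hyps(2) s(3) that])
  have as: "(h1 \<cdot> h) \<cdot> g = h1 \<cdot> ?g"
    by (intro GL.m_assoc tri_gen_GL s(1) h Aut_GL g)
  show ?case
  proof (intro bexI[OF _ tri_gen_mult[OF s(1) h]] exI[of _ "\<tau>(k := i)"] conjI ballI allI)
    show "inj_on (\<tau>(k := i)) (insert k K)"
      using \<tau>(1) new insert.hyps(2) by (auto simp: inj_on_def)
    fix k' l assume k': "k' \<in> insert k K"
    show "lin (h1 \<cdot> h \<cdot> g) k' l \<noteq> 0 \<longleftrightarrow> l = (\<tau>(k := i)) k'"
    proof (cases "k' = k")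
      case True
      then show ?thesis using s(4) by (simp add: as)
    next
      case False
      then have k'K: "k' \<in> K" using k' by simp
      then have "lin ?g k' i = 0" using \<tau>(2)[OF k'K, of i] new[OF k'K] by auto
      then show ?thesis using s(5) \<tau>(2)[OF k'K] False by (simp add: as)
    qed
  qed
qed

text \<open>For triangular \<open>g\<close> the pivot satisfies \<open>i \<preceq> k \<preceq> i\<close>, so it can be moved to the diagonal by two
further column operations, and no permutation is needed.\<close>

lemma elim_triangular:
  assumes g: "g \<in> triangular" and "finite K"
  shows "\<exists>h\<in>tri_gen. \<forall>k\<in>K. \<forall>l. lin (h \<cdot> g) k l \<noteq> 0 \<longleftrightarrow> l = k"
  using assms(2)
proof (induction K rule: finite_induct)
  case empty
  show ?case by (intro bexI[OF _ tri_gen_one]) simp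
next
  case (insert k K)
  then obtain h where h: "h \<in> tri_gen"
    and K: "\<And>k l. k \<in> K \<Longrightarrow> lin (h \<cdot> g) k l \<noteq> 0 \<longleftrightarrow> l = k" by auto
  let ?g = "h \<cdot> g"
  have gN: "?g \<in> triangular" using h g subgroup_triangular by (simp add: tri_gen_def subgroup.m_closed)
  have g1: "?g \<in> carrier (Aut A)" by (rule triangular_Aut[OF gN])
  obtain h1 i where s: "h1 \<in> tri_gen" "lin ?g k i \<noteq> 0" "lin (ginv ?g) i k \<noteq> 0"
    "\<And>l. lin (h1 \<cdot> ?g) k l \<noteq> 0 \<longleftrightarrow> l = i"
    "\<And>k' l. lin ?g k' i = 0 \<Longrightarrow> lin (h1 \<cdot> ?g) k' l = lin ?g k' l"
    using g1 by (rule elim_step[of ?g k]) auto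
  have iK: "i \<notin> K" using pivot_new[OF g1 K insert.hyps(2) s(3)] by metis
  have le: "root_le k i" "root_le i k" using gN s(2,3) by (simp_all add: triangular_def)
  let ?g2 = "h1 \<cdot> ?g"
  have g2: "?g2 \<in> carrier (Aut A)" by (rule Aut_mult_closed[OF tri_gen_Aut[OF s(1)] g1])
  have K2: "lin ?g2 k' l \<noteq> 0 \<longleftrightarrow> l = k'" if "k' \<in> K" for k' l
  proof -
    have "lin ?g k' i = 0" using K[OF that, of i] iK that by auto
    then show ?thesis using s(5) K[OF that] by simp
  qed
  have "\<exists>h2\<in>tri_gen. \<forall>k'\<in>insert k K. \<forall>l. lin (h2 \<cdot> ?g2) k' l \<noteq> 0 \<longleftrightarrow> l = k'"
  proof (cases "i = k")
    case True
    then show ?thesis using K2 s(4) by (intro bexI[OF _ tri_gen_one]) (auto simp: Aut_GL g2)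
  next
    case False
    \<comment> \<open>The first operation copies the pivot to the diagonal, the second one clears its old place.\<close>
    let ?E1 = "exp_action A (root_der i k) 1" and ?E2 = "exp_action A (root_der k i) (- 1)"
    have ik: "i \<noteq> k" "k \<noteq> i" using False by auto
    have E: "?E1 \<in> tri_gen" "?E2 \<in> tri_gen" by (rule exp_root_der_tri_gen[OF ik(1) le(2)], rule exp_root_der_tri_gen[OF ik(2) le(1)])
    let ?g3 = "?E1 \<cdot> ?g2"
    have g3: "?g3 \<in> carrier (Aut A)" by (rule Aut_mult_closed[OF tri_gen_Aut[OF E(1)] g2])
    have as: "(?E2 \<cdot> ?E1) \<cdot> ?g2 = ?E2 \<cdot> ?g3"
      by (intro GL.m_assoc tri_gen_GL E Aut_GL g2)
    have "lin (?E2 \<cdot> ?g3) k' l \<noteq> 0 \<longleftrightarrow> l = k'" if k': "k' \<in> insert k K" for k' l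
    proof (cases "k' = k")
      case True
      have "lin ?g2 k k = 0" using s(4)[of k] ik by auto
      then show ?thesis using True s(4)[of l] s(4)[of i] ik
        by (auto simp: lin_root_der_mult[OF ik(2) le(1) g3] lin_root_der_mult[OF ik(1) le(2) g2])
    next
      case False
      then have k'K: "k' \<in> K" using k' by simp
      have "lin ?g2 k' i = 0" "lin ?g2 k' k = 0"
        using K2[OF k'K, of i] K2[OF k'K, of k] iK k'K False by auto
      then show ?thesis using K2[OF k'K, of l]
        by (auto simp: lin_root_der_mult[OF ik(2) le(1) g3] lin_root_der_mult[OF ik(1) le(2) g2])
    qed
    then show ?thesis by (intro bexI[OF _ tri_gen_mult[OF E(2,1)]]) (simp add: as)
  qed
  then obtain h2 where h2: "h2 \<in> tri_gen"
    "\<forall>k'\<in>insert k K. \<forall>l. lin (h2 \<cdot> ?g2) k' l \<noteq> 0 \<longleftrightarrow> l = k'" by auto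
  have hh: "h1 \<cdot> h \<in> tri_gen" by (rule tri_gen_mult[OF s(1) h])
  have as: "(h2 \<cdot> (h1 \<cdot> h)) \<cdot> g = h2 \<cdot> ?g2"
    using tri_gen_GL[OF h2(1)] tri_gen_GL[OF s(1)] tri_gen_GL[OF h] Aut_GL[OF triangular_Aut[OF g]]
    by (simp add: GL.m_assoc)
  show ?case by (intro bexI[OF _ tri_gen_mult[OF h2(1) hh]]) (unfold as, rule h2(2))
qed

text \<open>Dividing by the diagonal torus element leaves an automorphism with identity linear part, hence a
unipotent one.\<close>

lemma diagonal_tri_gen:
  assumes g: "g \<in> carrier (Aut A)" and d: "\<And>k l. lin g k l \<noteq> 0 \<longleftrightarrow> l = k"
  shows "g \<in> tri_gen"
proof -
  let ?c = "\<lambda>k. lin g k k"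
  have c: "?c k \<noteq> 0" for k using d by simp
  have t: "tor ?c \<in> T" using c by (rule torI)
  have it: "ginv (tor ?c) = tor (\<lambda>i. inverse (?c i))" using c by (rule tor_inv_eq)
  have itA: "tor (\<lambda>i. inverse (?c i)) \<in> carrier (Aut A)" using c by (intro tor_Aut) simp
  let ?u = "g \<cdot> tor (\<lambda>i. inverse (?c i))"
  have uA: "?u \<in> carrier (Aut A)" by (rule Aut_mult_closed[OF g itA])
  have Lu: "lin ?u k l = (if l = id k then 1 else 0)" for k l
  proof -
    have "lin ?u k l = (\<Sum>p\<in>UNIV. if p = k then inverse (?c k) * lin g k l else 0)"
      unfolding lin_mult[OF g itA] by (rule sum.cong) (auto simp: lin_tor)
    also have "\<dots> = inverse (?c k) * lin g k l" by (simp add: sum.delta)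
    also have "\<dots> = (if l = id k then 1 else 0)" using d[of k l] c[of k] by auto
    finally show ?thesis .
  qed
  have "?u \<in> unipotent 1" unfolding unipotent_def
  proof (intro CollectI conjI allI impI uA)
    fix m p :: "'n monom" assume "p \<notin> S" "deg p < deg m + 1"
    then have "co p (?u (e m)) = (if p = mperm id m then cmon (\<lambda>_. 1) m else 0)"
      by (intro monomial_leading[OF uA bij_id Lu]) simp_all
    then show "co p (?u (e m)) = (if p = m then 1 else 0)" by (simp only: mperm_id cmon_one)
  qed
  then have uK: "?u \<in> tri_gen" by (rule unipotent_tri_gen)
  have "g = ?u \<cdot> tor ?c"
    using Aut_GL[OF g] T_GL[OF t] by (simp add: it[symmetric] GL.m_assoc)
  then show ?thesis using tri_gen_mult[OF uK T_tri_gen[OF t]] by simp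
qed

lemma triangular_tri_gen: assumes g: "g \<in> triangular" shows "g \<in> tri_gen"
proof -
  obtain h where h: "h \<in> tri_gen" "\<forall>k\<in>UNIV. \<forall>l. lin (h \<cdot> g) k l \<noteq> 0 \<longleftrightarrow> l = k"
    using elim_triangular[OF g finite[of UNIV]] by (elim bexE)
  have gA: "g \<in> carrier (Aut A)" by (rule triangular_Aut[OF g])
  have "h \<cdot> g \<in> tri_gen"
    by (rule diagonal_tri_gen[OF Aut_mult_closed[OF tri_gen_Aut[OF h(1)] gA]]) (use h(2) in simp)
  moreover have "g = ginv h \<cdot> (h \<cdot> g)"
    using tri_gen_GL[OF h(1)] Aut_GL[OF gA] by (simp add: GL.m_assoc[symmetric])
  ultimately show ?thesis using tri_gen_mult[OF tri_gen_inv[OF h(1)], of "h \<cdot> g"] by simp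
qed

text \<open>For \<open>x\<^sup>m\<close> in \<open>I\<close> the lowest term of \<open>g x\<^sup>m = 0\<close> is a nonzero multiple of the permuted monomial, which must
therefore lie in \<open>I\<close>. The reverse inclusion follows by counting the finite complement.\<close>

lemma permutation_preserves:
  assumes g: "g \<in> carrier (Aut A)" and \<tau>: "bij \<tau>" and Lg: "\<And>k l. lin g k l \<noteq> 0 \<longleftrightarrow> l = \<tau> k"
  shows "mperm \<tau> ` S = S"
proof -
  let ?c = "\<lambda>k. lin g k (\<tau> k)"
  have c: "?c k \<noteq> 0" for k using Lg by simp
  have Lc: "lin g k l = (if l = \<tau> k then ?c k else 0)" for k l using Lg[of k l] by auto
  have sub: "mperm \<tau> m \<in> S" if m: "m \<in> S" for m
  proof (rule ccontr)
    assume n: "mperm \<tau> m \<notin> S"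
    have "co (mperm \<tau> m) (g (e m)) = cmon ?c m"
      using monomial_leading[OF g \<tau> Lc n, of m] deg_mperm[OF \<tau>, of m] by simp
    moreover have "e m = \<zero>\<^bsub>A\<^esub>" using m by (simp add: e_zero_iff)
    ultimately show False using cmon_nonzero[of ?c m, OF c]
      by (simp add: linear_endo_zero[OF GL_linear[OF Aut_GL[OF g]]])
  qed
  let ?i = "mperm (inv_into UNIV \<tau>)"
  have inj: "inj ?i" using bij_mperm[OF bij_imp_bij_inv[OF \<tau>]] by (rule bij_is_inj)
  have "?i ` (- S) \<subseteq> - S"
    using sub mperm_inverse(1)[OF \<tau>] by (metis Compl_iff image_subsetI)
  then have sur: "?i ` (- S) = - S" using fin inj by (intro endo_inj_surj inj_on_subset[OF inj]) auto
  show ?thesis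
  proof (intro equalityI subsetI)
    fix m assume "m \<in> mperm \<tau> ` S"
    then show "m \<in> S" using sub by auto
  next
    fix m assume m: "m \<in> S"
    have "?i m \<in> S"
    proof (rule ccontr)
      assume "?i m \<notin> S"
      then have "?i m \<in> ?i ` (- S)" using sur by simp
      then show False using m inj by (auto simp: inj_def)
    qed
    then show "m \<in> mperm \<tau> ` S" using mperm_inverse(1)[OF \<tau>, of m] by (metis imageI)
  qed
qed

lemma Aut_decomp:
  assumes g: "g \<in> carrier (Aut A)"
  obtains n \<tau> where "n \<in> tri_gen" "bij \<tau>" "mperm \<tau> ` S = S" "g = n \<cdot> aut_of (mperm \<tau>)"
proof -
  obtain h \<tau> where h: "h \<in> tri_gen" and "inj \<tau>"
    and Lh: "\<forall>k\<in>UNIV. \<forall>l. lin (h \<cdot> g) k l \<noteq> 0 \<longleftrightarrow> l = \<tau> k"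
    using elim_all[OF g finite[of UNIV]] by auto
  then have \<tau>: "bij \<tau>" by (simp add: bij_def finite_UNIV_inj_surj)
  let ?g = "h \<cdot> g"
  have g1: "?g \<in> carrier (Aut A)" by (rule Aut_mult_closed[OF tri_gen_Aut[OF h] g])
  have pS: "mperm \<tau> ` S = S" by (rule permutation_preserves[OF g1 \<tau>]) (use Lh in simp)
  note \<sigma> = semigroup_aut_mperm[OF \<tau>] pS
  let ?s = "aut_of (mperm \<tau>)"
  have sA: "?s \<in> carrier (Aut A)" by (rule aut_of_Aut[OF \<sigma>])
  have isA: "ginv ?s \<in> carrier (Aut A)" by (rule Aut_inv_closed[OF sA])
  have Ls: "lin (ginv ?s) k p = (if p = inv_into UNIV \<tau> k then 1 else 0)" for k p
  proof -
    have "inv_into UNIV (mperm \<tau>) (X1 k) = X1 (inv_into UNIV \<tau> k)"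
      using \<tau> bij_mperm[OF \<tau>] mperm_X1[OF \<tau>, of "inv_into UNIV \<tau> k"]
      by (metis bij_inv_eq_iff)
    then show ?thesis
      using aut_of_inv[OF \<sigma> e_closed] aut_of_e[OF semigroup_aut_inv[OF \<sigma>(1)] inv_sigma_image[OF \<sigma>]]
      by (auto simp: lin_def co_e X1_eq_iff)
  qed
  let ?d = "?g \<cdot> ginv ?s"
  have "lin ?d k l = lin ?g (inv_into UNIV \<tau> k) l" for k l
  proof -
    have "lin ?d k l = (\<Sum>p\<in>UNIV. if p = inv_into UNIV \<tau> k then lin ?g (inv_into UNIV \<tau> k) l else 0)"
      unfolding lin_mult[OF g1 isA] by (rule sum.cong) (auto simp: Ls)
    then show ?thesis by (simp add: sum.delta)
  qed
  then have Ld: "lin ?d k l \<noteq> 0 \<longleftrightarrow> l = k" for k l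
    using Lh \<tau> by (simp add: surj_f_inv_f bij_is_surj)
  have dK: "?d \<in> tri_gen" by (rule diagonal_tri_gen[OF Aut_mult_closed[OF g1 isA] Ld])
  have "g = (ginv h \<cdot> ?d) \<cdot> ?s"
  proof -
    have G: "h \<in> G" "g \<in> G" "?s \<in> G" using tri_gen_GL[OF h] Aut_GL[OF g] Aut_GL[OF sA] by simp_all
    have "(ginv h \<cdot> ?d) = g \<cdot> ginv ?s"
      using G by (simp add: GL.m_assoc[symmetric])
    then show ?thesis using G by (simp add: GL.m_assoc)
  qed
  then show thesis using that[OF tri_gen_mult[OF tri_gen_inv[OF h] dK] \<tau> pS] by simp
qed

section \<open>The identity component and the component group\<close>

abbreviation "G0 \<equiv> identity_component A (carrier (Aut A))"

lemma gen_group_identity_component: "gen_group \<subseteq> G0"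
proof -
  note sub = identity_component_subset[OF subgroup_Aut]
  have "T \<subseteq> G0" by (rule T_identity_component[OF subgroup_Aut]) (simp add: subsetI T_Aut)
  moreover have "ga_images I \<subseteq> G0"
  proof
    fix g assume "g \<in> ga_images I"
    then obtain D s where D: "nilpotent_derivation S I D" "g = exp_action A D s" by (rule ga_imageE)
    then show "g \<in> G0"
      using nilpotent_derivation.E_identity_component[OF D(1) nilpotent_derivation.E_Aut[OF D(1)]] by simp
  qed
  moreover have "subgroup G0 (Aut A)"
    using GL.subgroup_incl[OF subgroup_identity_component[OF subgroup_Aut] subgroup_Aut sub] Aut_eq by simp
  ultimately show ?thesis unfolding gen_group_def by (intro Aut.generate_subgroup_incl) simp_all
qed

text \<open>The complement of \<open>triangular\<close> in the automorphism group is covered by finitely many closed translates, so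
\<open>triangular\<close> is open and closed and contains the connected component of \<open>1\<close>.\<close>

lemma identity_component_triangular: "G0 \<subseteq> triangular"
proof -
  let ?P = "{\<tau>. bij \<tau> \<and> mperm \<tau> ` S = S \<and> aut_of (mperm \<tau>) \<notin> triangular}"
  \<comment> \<open>The translate of \<open>triangular\<close> by a permutation, written as a preimage under a continuous map.\<close>
  let ?B = "\<lambda>\<tau>. {x \<in> topspace (zariski A). x \<cdot> ginv (aut_of (mperm \<tau>)) \<in> triangular}"
  have sA: "aut_of (mperm \<tau>) \<in> G" if "\<tau> \<in> ?P" for \<tau>
    using that by (intro Aut_GL aut_of_Aut semigroup_aut_mperm) simp_all
  have clB: "closedin (zariski A) (\<Union> (?B ` ?P))"
  proof (intro closedin_Union)
    show "finite (?B ` ?P)" by (rule finite_imageI) (rule finite_subset[OF subset_UNIV], simp)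
    fix B assume "B \<in> ?B ` ?P"
    then obtain \<tau> where B: "B = ?B \<tau>" "\<tau> \<in> ?P" by (elim imageE)
    show "closedin (zariski A) B" unfolding B(1)
      by (rule closedin_continuous_map_preimage[OF continuous_right[OF GL.inv_closed[OF sA[OF B(2)]]] triangular_closed])
  qed
  have cover: "G0 \<subseteq> triangular \<union> \<Union> (?B ` ?P)"
  proof
    fix g assume "g \<in> G0"
    then have g: "g \<in> carrier (Aut A)" using identity_component_subset[OF subgroup_Aut] by (rule subsetD[rotated])
    then obtain n \<tau> where n: "n \<in> tri_gen" "bij \<tau>" "mperm \<tau> ` S = S" "g = n \<cdot> aut_of (mperm \<tau>)"
      by (rule Aut_decomp)
    have nN: "n \<in> triangular" using n(1) by (simp add: tri_gen_def)
    show "g \<in> triangular \<union> \<Union> (?B ` ?P)"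
    proof (cases "aut_of (mperm \<tau>) \<in> triangular")
      case True
      then show ?thesis using nN n(4) subgroup_triangular by (simp add: subgroup.m_closed)
    next
      case False
      then have P: "\<tau> \<in> ?P" using n by simp
      have "g \<cdot> ginv (aut_of (mperm \<tau>)) = n"
        using n(4) tri_gen_GL[OF n(1)] sA[OF P] by (simp add: GL.m_assoc)
      then have "g \<in> ?B \<tau>" using nN g by (simp add: topspace_zariski Aut_GL)
      then show ?thesis using P by (intro UnI2 UN_I)
    qed
  qed
  have disj: "triangular \<inter> \<Union> (?B ` ?P) \<inter> G0 = {}"
  proof (rule equals0I)
    fix g assume "g \<in> triangular \<inter> \<Union> (?B ` ?P) \<inter> G0"
    then have gN: "g \<in> triangular" and "g \<in> \<Union> (?B ` ?P)" by simp_all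
    then obtain \<tau> where P: "\<tau> \<in> ?P" and "g \<in> ?B \<tau>" by (elim UN_E)
    then have 1: "g \<cdot> ginv (aut_of (mperm \<tau>)) \<in> triangular" (is "?x \<in> _") by simp
    have "ginv ?x \<cdot> g = aut_of (mperm \<tau>)"
      using sA[OF P] Aut_GL[OF triangular_Aut[OF gN]] by (simp add: GL.inv_mult_group GL.m_assoc)
    moreover have "ginv ?x \<cdot> g \<in> triangular"
      by (intro subgroup.m_closed[OF subgroup_triangular] subgroup.m_inv_closed[OF subgroup_triangular] 1 gN)
    ultimately show False using P by simp
  qed
  have ne: "triangular \<inter> G0 \<noteq> {}"
    using one_identity_component[OF subgroup_Aut] subgroup.one_closed[OF subgroup_triangular] by (metis IntI empty_iff)
  have nosep: "\<not> (\<exists>E1 E2. closedin (zariski A) E1 \<and> closedin (zariski A) E2 \<and> G0 \<subseteq> E1 \<union> E2 \<and>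
      E1 \<inter> E2 \<inter> G0 = {} \<and> E1 \<inter> G0 \<noteq> {} \<and> E2 \<inter> G0 \<noteq> {})"
    using identity_component_connected[OF subgroup_Aut] unfolding connectedin_closedin by (rule conjunct2)
  have "\<Union> (?B ` ?P) \<inter> G0 = {}"
  proof (rule ccontr)
    assume n: "\<Union> (?B ` ?P) \<inter> G0 \<noteq> {}"
    show False
      by (rule notE[OF nosep]) (rule exI[of _ triangular], rule exI[of _ "\<Union> (?B ` ?P)"],
        intro conjI triangular_closed clB cover disj ne n)
  qed
  then have no: "g \<notin> \<Union> (?B ` ?P)" if "g \<in> G0" for g
    using that by (metis (no_types, lifting) IntI empty_iff)
  show ?thesis
  proof
    fix g assume g: "g \<in> G0"
    have "g \<in> triangular \<union> \<Union> (?B ` ?P)" using cover g by (rule subsetD)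
    then show "g \<in> triangular" using no[OF g] by (simp only: Un_iff simp_thms)
  qed
qed

lemma identity_component_eq: "G0 = generate (Aut A) (T \<union> ga_images I)"
proof -
  have "triangular \<subseteq> gen_group" using triangular_tri_gen by (auto simp: tri_gen_def)
  then have "G0 = gen_group" using gen_group_identity_component identity_component_triangular by (intro equalityI) simp_all
  then show ?thesis by (simp add: gen_group_def)
qed

lemma G0_normal: "G0 \<lhd> Aut A"
proof -
  have "subgroup G0 (Aut A)"
    using GL.subgroup_incl[OF subgroup_identity_component[OF subgroup_Aut] subgroup_Aut
        identity_component_subset[OF subgroup_Aut]] Aut_eq by simp
  moreover have "g \<otimes>\<^bsub>Aut A\<^esub> h \<otimes>\<^bsub>Aut A\<^esub> inv\<^bsub>Aut A\<^esub> g \<in> G0" if "g \<in> carrier (Aut A)" "h \<in> G0" for g h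
    using identity_component_conj[OF subgroup_Aut that] by (simp add: Aut_mult_eq Aut_inv_eq that(1))
  ultimately show ?thesis by (simp add: Aut.normal_inv_iff)
qed

lemma component_cosets:
  assumes "c \<in> carrier (Aut A Mod G0)"
  shows "\<exists>\<tau>. bij \<tau> \<and> mperm \<tau> ` S = S \<and> c = G0 #>\<^bsub>Aut A\<^esub> aut_of (mperm \<tau>)"
proof -
  obtain g where g: "g \<in> carrier (Aut A)" "c = G0 #>\<^bsub>Aut A\<^esub> g"
    using assms by (auto simp: FactGroup_def RCOSETS_def)
  obtain n \<tau> where n: "n \<in> tri_gen" "bij \<tau>" "mperm \<tau> ` S = S" "g = n \<cdot> aut_of (mperm \<tau>)"
    using g(1) by (rule Aut_decomp)
  have nG0: "n \<in> G0" using n(1) gen_group_identity_component by (auto simp: tri_gen_def)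
  have sA: "aut_of (mperm \<tau>) \<in> carrier (Aut A)" using n by (intro aut_of_Aut semigroup_aut_mperm)
  have "G0 #>\<^bsub>Aut A\<^esub> aut_of (mperm \<tau>) = G0 #>\<^bsub>Aut A\<^esub> g"
  proof (rule Aut.repr_independence[OF _ sA])
    show "subgroup G0 (Aut A)" using G0_normal by (rule normal_imp_subgroup)
    show "g \<in> G0 #>\<^bsub>Aut A\<^esub> aut_of (mperm \<tau>)"
      unfolding r_coset_def using nG0 n(4) by (auto simp: Aut_mult_eq)
  qed
  then show ?thesis using n g by auto
qed

lemma component_group:
  "G0 \<lhd> Aut A \<and> finite (carrier (Aut A Mod G0)) \<and>
    carrier (Aut A Mod G0) = generate (Aut A Mod G0) ((\<lambda>g. G0 #>\<^bsub>Aut A\<^esub> g) ` semigroup_induced I)"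
proof (intro conjI G0_normal)
  have "carrier (Aut A Mod G0) \<subseteq> (\<lambda>\<tau>. G0 #>\<^bsub>Aut A\<^esub> aut_of (mperm \<tau>)) ` UNIV"
    using component_cosets by blast
  then show "finite (carrier (Aut A Mod G0))" by (rule finite_subset) simp
  interpret Q: Group.group "Aut A Mod G0" by (rule normal.factorgroup_is_group[OF G0_normal])
  let ?s = "(\<lambda>g. G0 #>\<^bsub>Aut A\<^esub> g) ` semigroup_induced I"
  show "carrier (Aut A Mod G0) = generate (Aut A Mod G0) ?s"
  proof (intro equalityI subsetI)
    fix c assume "c \<in> carrier (Aut A Mod G0)"
    then obtain \<tau> where \<tau>: "bij \<tau>" "mperm \<tau> ` S = S" "c = G0 #>\<^bsub>Aut A\<^esub> aut_of (mperm \<tau>)"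
      using component_cosets by blast
    then have "aut_of (mperm \<tau>) \<in> semigroup_induced I"
      unfolding semigroup_induced_eq by (intro CollectI exI[of _ "mperm \<tau>"]) (simp add: semigroup_aut_mperm)
    then show "c \<in> generate (Aut A Mod G0) ?s" unfolding \<tau>(3) by (intro generate.incl imageI)
  next
    fix c assume "c \<in> generate (Aut A Mod G0) ?s"
    moreover have "?s \<subseteq> carrier (Aut A Mod G0)"
    proof (rule image_subsetI)
      fix g assume "g \<in> semigroup_induced I"
      then have "g \<in> carrier (Aut A)"
        unfolding semigroup_induced_eq by (elim CollectE exE conjE) (simp add: aut_of_Aut)
      then show "G0 #>\<^bsub>Aut A\<^esub> g \<in> carrier (Aut A Mod G0)" by (auto simp: FactGroup_def RCOSETS_def)
    qed
    ultimately show "c \<in> carrier (Aut A Mod G0)" using Q.generate_in_carrier by blast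
  qed
qed

end

section \<open>Ideals generated by monomials\<close>

lemma sum_in_ideal:
  fixes J :: "('n, 'k::field) mpoly set"
  assumes J: "ideal J mpoly_ring" and "finite F" and "\<And>i. i \<in> F \<Longrightarrow> f i \<in> J"
  shows "sum f F \<in> J"
  using assms(2,3)
proof (induction F rule: finite_induct)
  case empty
  have "0 \<in> J" using additive_subgroup.zero_closed[OF ideal.axioms(1)[OF J]] by simp
  then show ?case by simp
next
  case (insert i F)
  then show ?case
    using additive_subgroup.a_closed[OF ideal.axioms(1)[OF J], of "f i" "sum f F"] by simp
qed

lemma mpoly_expand: "p = (\<Sum>m\<in>ks p. Poly_Mapping.single m (lk p m))"
proof (rule poly_mapping_eqI)
  fix k
  have "lk (\<Sum>m\<in>ks p. Poly_Mapping.single m (lk p m)) k = (\<Sum>m\<in>ks p. if m = k then lk p m else 0)"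
    by (simp add: lookup_sum lookup_single when_def)
  also have "\<dots> = lk p k" by (simp add: in_keys_iff)
  finally show "lk p k = lk (\<Sum>m\<in>ks p. Poly_Mapping.single m (lk p m)) k" ..
qed

text \<open>Used twice: for the given ideal, and for its extension to the algebraic closure.\<close>

lemma genideal_monomial:
  fixes F :: "('n::finite, 'k::field) mpoly set"
  assumes up: "\<And>m m'. m \<in> S \<Longrightarrow> m + m' \<in> S"
    and sub: "\<And>p. p \<in> F \<Longrightarrow> ks p \<subseteq> S"
    and gen: "\<And>m. m \<in> S \<Longrightarrow> \<exists>m0 m1. m = m0 + m1 \<and> xmon m0 \<in> F"
  shows "genideal mpoly_ring F = {p. ks p \<subseteq> S}"
proof (intro equalityI)
  interpret monomial_quotient S "{p :: ('n, 'k) mpoly. ks p \<subseteq> S}"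
    using up by unfold_locales simp_all
  show "genideal mpoly_ring F \<subseteq> {p. ks p \<subseteq> S}"
    unfolding genideal_def using ideal_I sub by (intro Inter_lower CollectI conjI) auto
  show "{p. ks p \<subseteq> S} \<subseteq> genideal mpoly_ring F"
    unfolding genideal_def
  proof (intro Inter_greatest subsetI)
    fix J and p :: "('n, 'k) mpoly" assume "J \<in> {I. ideal I mpoly_ring \<and> F \<subseteq> I}" and p: "p \<in> {p. ks p \<subseteq> S}"
    then have J: "ideal J mpoly_ring" "F \<subseteq> J" by simp_all
    have "(\<Sum>m\<in>ks p. Poly_Mapping.single m (lk p m)) \<in> J"
    proof (rule sum_in_ideal[OF J(1) finite_keys])
      fix m assume "m \<in> ks p"
      then obtain m0 m1 where m: "m = m0 + m1" "xmon m0 \<in> F" using p gen[of m] by auto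
      have "Poly_Mapping.single m (lk p m) = Poly_Mapping.single m1 (lk p m) * xmon m0"
        by (simp add: m(1) xmon_def mult_single add.commute)
      then show "Poly_Mapping.single m (lk p m) \<in> J"
        using ideal.I_l_closed[OF J(1), of "xmon m0" "Poly_Mapping.single m1 (lk p m)"] m(2) J(2) by auto
    qed
    then show "p \<in> J" by (simp only: mpoly_expand[symmetric])
  qed
qed

section \<open>Relabelling the coordinates of a split torus\<close>

lemma alg_group_iso_trans:
  fixes O3 :: "('c \<Rightarrow> 'k) set"
  assumes 1: "alg_group_iso G1 O1 G2 O2 \<phi>" and 2: "alg_group_iso G2 O2 G3 O3 \<psi>"
    and mem: "\<And>x y. x \<in> carrier G1 \<Longrightarrow> y \<in> carrier G1 \<Longrightarrow> x \<otimes>\<^bsub>G1\<^esub> y \<in> carrier G1"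
  shows "alg_group_iso G1 O1 G3 O3 (\<lambda>x. \<psi> (\<phi> x))"
proof -
  have iso: "\<phi> \<in> iso G1 G2" "\<psi> \<in> iso G2 G3"
    and O: "O1 = {\<lambda>x\<in>carrier G1. f (\<phi> x) |f. f \<in> O2}" "O2 = {\<lambda>x\<in>carrier G2. f (\<psi> x) |f. f \<in> O3}"
    using 1 2 by (simp_all add: alg_group_iso_def)
  have cl: "\<phi> x \<in> carrier G2" if "x \<in> carrier G1" for x
    using iso(1) that by (simp add: iso_def hom_def Pi_iff)
  have "(\<lambda>x. \<psi> (\<phi> x)) \<in> iso G1 G3"
  proof (rule isoI)
    show "(\<lambda>x. \<psi> (\<phi> x)) \<in> hom G1 G3"
      using iso cl unfolding iso_def hom_def by (simp add: Pi_iff)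
    show "bij_betw (\<lambda>x. \<psi> (\<phi> x)) (carrier G1) (carrier G3)"
      using bij_betw_trans[of \<phi> "carrier G1" "carrier G2" \<psi> "carrier G3"] iso by (simp add: iso_def comp_def)
  qed
  moreover have "O1 = {\<lambda>x\<in>carrier G1. f (\<psi> (\<phi> x)) |f. f \<in> O3}"
  proof -
    have eq: "(\<lambda>x\<in>carrier G1. (\<lambda>y\<in>carrier G2. g (\<psi> y)) (\<phi> x)) = (\<lambda>x\<in>carrier G1. g (\<psi> (\<phi> x)))" for g :: "'c \<Rightarrow> 'k"
      by (rule restrict_ext) (simp add: cl)
    have "O1 = (\<lambda>f. \<lambda>x\<in>carrier G1. f (\<phi> x)) ` (\<lambda>g. \<lambda>y\<in>carrier G2. g (\<psi> y)) ` O3"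
      unfolding O(2) O(1) by (simp only: setcompr_eq_image Collect_mem_eq)
    also have "\<dots> = (\<lambda>g. \<lambda>x\<in>carrier G1. g (\<psi> (\<phi> x))) ` O3"
      unfolding image_image by (rule image_cong[OF refl eq])
    finally show ?thesis by (simp only: setcompr_eq_image Collect_mem_eq)
  qed
  ultimately show ?thesis by (simp add: alg_group_iso_def)
qed

text \<open>Algebraic tori are defined with coordinates indexed by an initial segment of the natural numbers,
while \<open>T\<close> has its coordinates indexed by the variables; \<open>b\<close> is a numbering of the variables.
The maps \<open>up\<close> and \<open>dn\<close> are mutually inverse isomorphisms between the lattices of exponents.\<close>

locale relabel =
  fixes b :: "'n::finite \<Rightarrow> nat" and r :: nat and ty :: "'k::field itself"
  assumes b: "bij_betw b UNIV {..<r}"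
begin

definition up :: "('n \<Rightarrow>\<^sub>0 int) \<Rightarrow> (nat \<Rightarrow>\<^sub>0 int)"
  where "up m = (\<Sum>i\<in>UNIV. Poly_Mapping.single (b i) (lk m i))"

definition dn :: "(nat \<Rightarrow>\<^sub>0 int) \<Rightarrow> ('n \<Rightarrow>\<^sub>0 int)"
  where "dn m = (\<Sum>i\<in>UNIV. Poly_Mapping.single i (lk m (b i)))"

lemma b_inj: "b i = b j \<longleftrightarrow> i = j"
  using b by (auto simp: bij_betw_def inj_on_def)

lemma lookup_up: "lk (up m) (b i) = lk m i"
  by (simp add: up_def lookup_sum lookup_single when_def b_inj)

lemma lookup_up_ge: "\<not> k < r \<Longrightarrow> lk (up m) k = 0"
proof -
  assume k: "\<not> k < r"
  have "b i \<noteq> k" for i using b k by (auto simp: bij_betw_def)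
  then show ?thesis by (simp add: up_def lookup_sum lookup_single when_def)
qed

lemma lookup_dn: "lk (dn m) i = lk m (b i)"
  by (simp add: dn_def lookup_sum lookup_single when_def)

lemma up_lattice: "up m \<in> exp_lattice {..<r}"
  unfolding exp_lattice_def by (rule CollectI) (use lookup_up_ge[of _ m] in \<open>auto simp: in_keys_iff\<close>)

lemma dn_up: "dn (up m) = m"
  by (rule poly_mapping_eqI) (simp add: lookup_dn lookup_up)

lemma up_dn: assumes "m \<in> exp_lattice {..<r}" shows "up (dn m) = m"
proof (rule poly_mapping_eqI)
  fix k
  show "lk (up (dn m)) k = lk m k"
  proof (cases "k < r")
    case True
    then obtain i where "k = b i" using b by (metis bij_betw_imp_surj_on imageE lessThan_iff)
    then show ?thesis by (simp add: lookup_up lookup_dn)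
  next
    case False
    then have "k \<notin> ks m" using assms by (auto simp: exp_lattice_def)
    then show ?thesis using False by (simp add: lookup_up_ge in_keys_iff)
  qed
qed

lemma up_add: "up (m + m') = up m + up m'"
  by (simp add: up_def lookup_add single_add sum.distrib)

lemma dn_add: "dn (m + m') = dn m + dn m'"
  by (simp add: dn_def lookup_add single_add sum.distrib)

lemma lattice_add: "m \<in> exp_lattice {..<r} \<Longrightarrow> m' \<in> exp_lattice {..<r} \<Longrightarrow> m + m' \<in> exp_lattice {..<r}"
  unfolding exp_lattice_def using keys_add[of m m'] by auto

abbreviation (input) "Tr \<equiv> split_torus {..<r} :: ((nat \<Rightarrow>\<^sub>0 int) \<Rightarrow> 'k) monoid"
abbreviation (input) "Tn \<equiv> split_torus UNIV :: (('n \<Rightarrow>\<^sub>0 int) \<Rightarrow> 'k) monoid"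

definition pull :: "((nat \<Rightarrow>\<^sub>0 int) \<Rightarrow> 'k) \<Rightarrow> ('n \<Rightarrow>\<^sub>0 int) \<Rightarrow> 'k"
  where "pull t = (\<lambda>m. t (up m))"

definition push :: "(('n \<Rightarrow>\<^sub>0 int) \<Rightarrow> 'k) \<Rightarrow> (nat \<Rightarrow>\<^sub>0 int) \<Rightarrow> 'k"
  where "push t = (\<lambda>m\<in>exp_lattice {..<r}. t (dn m))"

lemma pull_closed: "t \<in> carrier Tr \<Longrightarrow> pull t \<in> carrier Tn"
  by (simp add: split_torus_def pull_def up_add up_lattice)

lemma push_closed: "t \<in> carrier Tn \<Longrightarrow> push t \<in> carrier Tr"
  by (simp add: split_torus_def push_def dn_add lattice_add)

lemma push_pull: "t \<in> carrier Tr \<Longrightarrow> push (pull t) = t"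
  by (rule extensionalityI[of _ "exp_lattice {..<r}"]) (simp_all add: split_torus_def push_def pull_def up_dn)

lemma pull_push: "t \<in> carrier Tn \<Longrightarrow> pull (push t) = t"
  by (rule ext) (simp add: push_def pull_def up_lattice dn_up)

lemma torus_mult_closed: "s \<in> carrier Tr \<Longrightarrow> t \<in> carrier Tr \<Longrightarrow> s \<otimes>\<^bsub>Tr\<^esub> t \<in> carrier Tr"
  by (simp add: split_torus_def lattice_add)

lemma relabel_iso: "alg_group_iso Tr (split_torus_ring {..<r}) Tn (split_torus_ring UNIV) pull"
  unfolding alg_group_iso_def
proof (intro conjI isoI)
  show "pull \<in> hom Tr Tn"
  proof (rule homI)
    fix s t assume "s \<in> carrier Tr" "t \<in> carrier Tr"
    show "pull (s \<otimes>\<^bsub>Tr\<^esub> t) = pull s \<otimes>\<^bsub>Tn\<^esub> pull t"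
      by (rule ext) (simp add: split_torus_def pull_def up_lattice)
  qed (rule pull_closed)
  show "bij_betw pull (carrier Tr) (carrier Tn)"
    by (rule bij_betw_byWitness[where f' = push])
      (simp_all add: push_pull pull_push image_subset_iff pull_closed push_closed)
  show "split_torus_ring {..<r} = {\<lambda>x\<in>carrier Tr. f (pull x) |f. f \<in> split_torus_ring UNIV}"
  proof (intro equalityI subsetI)
    fix f :: "((nat \<Rightarrow>\<^sub>0 int) \<Rightarrow> 'k) \<Rightarrow> 'k" assume "f \<in> split_torus_ring {..<r}"
    then obtain M c where f: "f = (\<lambda>t\<in>carrier Tr. \<Sum>m\<in>M. c m * t m)" "finite M" "M \<subseteq> exp_lattice {..<r}"
      unfolding split_torus_ring_def by blast
    let ?g = "\<lambda>t\<in>carrier Tn. \<Sum>m\<in>dn ` M. c (up m) * t m"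
    have inj: "inj_on dn M" using f(3) up_dn by (metis inj_onI subsetD)
    have "f = (\<lambda>x\<in>carrier Tr. ?g (pull x))"
      unfolding f(1)
    proof (rule restrict_ext)
      fix t assume t: "t \<in> carrier Tr"
      have "?g (pull t) = (\<Sum>m\<in>M. c (up (dn m)) * t (up (dn m)))"
        using t by (simp add: pull_closed sum.reindex[OF inj]) (simp add: pull_def)
      also have "\<dots> = (\<Sum>m\<in>M. c m * t m)"
        by (rule sum.cong) (use f(3) up_dn in \<open>auto simp: subset_iff\<close>)
      finally show "(\<Sum>m\<in>M. c m * t m) = ?g (pull t)" ..
    qed
    moreover have "?g \<in> split_torus_ring UNIV"
      unfolding split_torus_ring_def using f(2)
      by (intro CollectI exI[of _ "dn ` M"] exI[of _ "\<lambda>m. c (up m)"]) simp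
    ultimately show "f \<in> {\<lambda>x\<in>carrier Tr. f (pull x) |f. f \<in> split_torus_ring UNIV}" by blast
  next
    fix f :: "((nat \<Rightarrow>\<^sub>0 int) \<Rightarrow> 'k) \<Rightarrow> 'k"
    assume "f \<in> {\<lambda>x\<in>carrier Tr. f (pull x) |f. f \<in> split_torus_ring UNIV}"
    then obtain M c where M: "finite M" "f = (\<lambda>x\<in>carrier Tr. (\<lambda>t\<in>carrier Tn. \<Sum>m\<in>M. c m * t m) (pull x))"
      unfolding split_torus_ring_def by blast
    have inj: "inj_on up M" using dn_up by (metis inj_onI)
    have "f = (\<lambda>t\<in>carrier Tr. \<Sum>m\<in>up ` M. c (dn m) * t m)"
      unfolding M(2) by (rule restrict_ext) (simp add: pull_closed sum.reindex[OF inj] dn_up, simp add: pull_def)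
    then show "f \<in> split_torus_ring {..<r}"
      unfolding split_torus_ring_def using M(1) up_lattice
      by (intro CollectI exI[of _ "up ` M"] exI[of _ "\<lambda>m. c (dn m)"]) auto
  qed
qed

end

lemma alg_group_iso_rank:
  fixes OH :: "('g \<Rightarrow> 'k::field) set"
  assumes "alg_group_iso (split_torus (UNIV :: 'n::finite set)) (split_torus_ring UNIV) H OH \<phi>"
  shows "\<exists>(r::nat) \<phi>. alg_group_iso (split_torus {..<r}) (split_torus_ring {..<r}) H OH \<phi>"
proof -
  obtain b :: "'n \<Rightarrow> nat" where b: "bij_betw b UNIV {0..<CARD('n)}"
    using ex_bij_betw_finite_nat[of "UNIV :: 'n set"] by auto
  then interpret relabel b "CARD('n)" "TYPE('k)" by unfold_locales (simp add: lessThan_atLeast0)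
  show ?thesis
    using alg_group_iso_trans[OF relabel_iso assms torus_mult_closed] by (intro exI)
qed

context artin_quotient_char0 begin

section \<open>Base change to the algebraic closure\<close>

lemma ideal_ac_eq: "ideal_ac I = {p. ks p \<subseteq> S}"
  unfolding ideal_ac_def
proof (rule genideal_monomial[OF up])
  fix p :: "('n, 'k alg_closure) mpoly" assume "p \<in> Poly_Mapping.map to_ac ` I"
  then obtain q where q: "q \<in> I" "p = Poly_Mapping.map to_ac q" by (elim imageE)
  then show "ks p \<subseteq> S" by (auto simp: I_eq in_keys_iff Poly_Mapping.map.rep_eq when_def split: if_splits)
next
  fix m assume m: "m \<in> S"
  have "xmon m \<in> Poly_Mapping.map to_ac ` I"
    by (rule image_eqI[of _ _ "xmon m"]) (use m in \<open>simp_all add: xmon_def I_eq\<close>)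
  then show "\<exists>m0 m1. m = m0 + m1 \<and> xmon m0 \<in> Poly_Mapping.map to_ac ` I"
    by (intro exI[of _ m] exI[of _ 0]) simp
qed

lemma ac_artin: "artin_quotient_char0 S (ideal_ac I)"
  by unfold_locales (simp_all only: up ideal_ac_eq fin vars not_False_eq_True)

interpretation ac: artin_quotient_char0 S "ideal_ac I"
  by (rule ac_artin)

definition iota :: "('n, 'k) mpoly set \<Rightarrow> ('n, 'k alg_closure) mpoly set"
  where "iota = induced_map I (ideal_ac I) (Poly_Mapping.map to_ac)"

lemma lookup_map_ac: "lk (Poly_Mapping.map to_ac p) m = to_ac (lk p m)"
  by (simp add: Poly_Mapping.map.rep_eq when_def)

lemma iota_cls: "iota (cls p) = residue_class (ideal_ac I) (Poly_Mapping.map to_ac p)"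
  unfolding iota_def induced_map_def
  by (simp, rule UN_cls_eq)
    (simp_all add: I_iff ac.I_iff lookup_minus lookup_add lookup_map_ac flip: to_ac_diff)

lemma iota_closed: "a \<in> C \<Longrightarrow> iota a \<in> ac.C"
  by (elim carrierE) (simp add: iota_cls)

lemma co_iota: "a \<in> C \<Longrightarrow> ac.co m (iota a) = to_ac (co m a)"
  by (elim carrierE) (simp add: iota_cls co_cls ac.co_cls lookup_map_ac)

lemma iota_inj: assumes "a \<in> C" "b \<in> C" "iota a = iota b" shows "a = b"
proof (rule co_eqI[OF assms(1,2)])
  fix m
  have "to_ac (co m a) = to_ac (co m b)" using assms by (simp flip: co_iota)
  then show "co m a = co m b" by simp
qed

lemma iota_e: "iota (e m) = ac.e m"
  by (rule ac.co_eqI) (simp_all add: iota_closed co_iota co_e ac.co_e)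

definition extend :: "(('n, 'k) mpoly set \<Rightarrow> ('n, 'k) mpoly set)
    \<Rightarrow> ('n, 'k alg_closure) mpoly set \<Rightarrow> ('n, 'k alg_closure) mpoly set"
  where "extend h = ac.linmap (\<lambda>p m. to_ac (co p (h (e m))))"

lemma extend_linear: "linear_endo ac.A (extend h)"
  by (simp add: extend_def ac.linmap_linear)

lemma extend_iota:
  assumes h: "linear_endo A h" and a: "a \<in> C"
  shows "extend h (iota a) = iota (h a)"
proof (rule ac.co_eqI)
  have ha: "h a \<in> C" using h a by (rule linear_endo_closed)
  show "extend h (iota a) \<in> ac.C"
    by (rule ac.linear_endo_closed[OF extend_linear iota_closed[OF a]])
  show "iota (h a) \<in> ac.C" by (rule iota_closed[OF ha])
  fix p assume p: "p \<notin> S"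
  have "ac.co p (extend h (iota a)) = (\<Sum>m\<in>- S. to_ac (co p (h (e m))) * to_ac (co m a))"
    using p a by (simp add: extend_def ac.linmap_def ac.co_mk iota_closed co_iota)
  also have "\<dots> = to_ac (co p (h a))"
    using co_endo[OF h a, of p] by (simp add: to_ac_sum mult.commute)
  finally show "ac.co p (extend h (iota a)) = ac.co p (iota (h a))" by (simp add: co_iota ha)
qed

lemma iota_determines:
  assumes "linear_endo ac.A f" "linear_endo ac.A g"
    and "\<And>a. a \<in> C \<Longrightarrow> f (iota a) = g (iota a)" and "x \<in> ac.C"
  shows "f x = g x"
  by (rule ac.linear_endo_ext[OF assms(1,2) _ assms(4)]) (use assms(3) in \<open>simp flip: iota_e\<close>)

lemma extend_GL:
  assumes h: "h \<in> G" shows "extend h \<in> ac.G"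
proof (rule ac.GL_I(1)[OF extend_linear extend_linear])
  let ?h = "ginv h"
  have l: "linear_endo A h" "linear_endo A ?h" using h by (simp_all add: GL_linear)
  show "extend h \<in> extensional (ac.C)" by (simp add: extend_def)
  have ext2: "extend f (extend f' a) = a"
    if a: "a \<in> ac.C" and l: "linear_endo A f" "linear_endo A f'"
      and inv: "\<And>a. a \<in> C \<Longrightarrow> f (f' a) = a" for f f' a
  proof (rule iota_determines[OF ac.linear_endo_comp[OF extend_linear extend_linear] ac.linear_endo_id _ a])
    fix b assume b: "b \<in> C"
    show "extend f (extend f' (iota b)) = iota b"
      by (simp only: extend_iota[OF l(2) b] extend_iota[OF l(1) linear_endo_closed[OF l(2) b]] inv[OF b])
  qed
  show "extend h (extend ?h a) = a" if "a \<in> ac.C" for a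
    by (rule ext2[OF that l]) (rule GL_inv_apply(2)[OF h])
  show "extend ?h (extend h a) = a" if "a \<in> ac.C" for a
    by (rule ext2[OF that l(2,1)]) (rule GL_inv_apply(1)[OF h])
qed

lemma base_change_eq: "base_change I H = zariski ac.A closure_of
    {g \<in> ac.G. \<exists>h\<in>H. \<forall>a\<in>C. g (iota a) = iota (h a)}"
  by (simp only: base_change_def iota_def Let_def)

lemma extend_base_change:
  assumes "H \<subseteq> G" "h \<in> H" shows "extend h \<in> base_change I H"
proof -
  let ?K = "{g \<in> ac.G. \<exists>h\<in>H. \<forall>a\<in>C. g (iota a) = iota (h a)}"
  have "?K \<subseteq> base_change I H"
    unfolding base_change_eq by (rule closure_of_subset) (simp add: ac.topspace_zariski)
  moreover have hG: "h \<in> G" using assms by (rule subsetD)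
  have "extend h \<in> ?K"
    using extend_GL[OF hG] extend_iota[OF GL_linear[OF hG]] assms(2) by (intro CollectI conjI bexI[of _ h]) simp_all
  ultimately show ?thesis by (rule subsetD)
qed

text \<open>The extensions of elements of \<open>H\<close> lie in the base change of \<open>H\<close>, which is commutative, and the map
\<open>iota\<close> from \<open>A\<close> to its base change is injective.\<close>

lemma torus_comm:
  assumes t: "is_torus I H" and HG: "H \<subseteq> G" and g: "g \<in> H" and h: "h \<in> H" and a: "a \<in> C"
  shows "g (h a) = h (g a)"
proof -
  let ?B = "GL ac.A\<lparr>carrier := base_change I H\<rparr>"
  have "\<exists>(r::nat) \<phi>. alg_group_iso (split_torus {..<r}) (split_torus_ring {..<r}) ?B
      (coord_ring ac.A (base_change I H)) \<phi>"
    using t unfolding is_torus_def by (rule conjunct2)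
  then obtain r :: nat and \<phi> where "alg_group_iso (split_torus {..<r}) (split_torus_ring {..<r}) ?B
      (coord_ring ac.A (base_change I H)) \<phi>" by (elim exE)
  then have "\<phi> \<in> iso (split_torus {..<r}) ?B" unfolding alg_group_iso_def by (rule conjunct1)
  then have hom: "\<phi> \<in> hom (split_torus {..<r}) ?B" and
    bij: "bij_betw \<phi> (carrier (split_torus {..<r})) (base_change I H)" by (simp_all add: iso_def)
  have gG: "g \<in> G" "h \<in> G" using g h HG by (simp_all add: subset_iff)
  obtain s t where st: "s \<in> carrier (split_torus {..<r})" "t \<in> carrier (split_torus {..<r})"
    "extend g = \<phi> s" "extend h = \<phi> t"
    using extend_base_change[OF HG g] extend_base_change[OF HG h] bij
    unfolding bij_betw_def by (metis (no_types, lifting) imageE)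
  have "s \<otimes>\<^bsub>split_torus {..<r}\<^esub> t = t \<otimes>\<^bsub>split_torus {..<r}\<^esub> s"
    by (simp add: split_torus_def mult.commute)
  then have "extend g \<otimes>\<^bsub>GL ac.A\<^esub> extend h = extend h \<otimes>\<^bsub>GL ac.A\<^esub> extend g"
    using hom_mult[OF hom st(1,2)] hom_mult[OF hom st(2,1)] st(3,4) by simp
  then have "extend g (extend h (iota a)) = extend h (extend g (iota a))"
    using ac.GL_mult_apply[OF extend_GL[OF gG(1)] extend_GL[OF gG(2)] iota_closed[OF a]]
      ac.GL_mult_apply[OF extend_GL[OF gG(2)] extend_GL[OF gG(1)] iota_closed[OF a]] by simp
  then have "iota (g (h a)) = iota (h (g a))"
    using a gG by (simp add: extend_iota GL_linear GL_closed)
  then show ?thesis using a gG by (intro iota_inj) (simp_all add: GL_closed)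
qed

lemma base_change_tor:
  "{g \<in> ac.G. \<exists>h\<in>T. \<forall>a\<in>C. g (iota a) = iota (h a)} =
    {ac.tor (\<lambda>i. to_ac (c i)) |c. \<forall>i. c i \<noteq> 0}" (is "?K = ?R")
proof -
  have cm: "cmon (\<lambda>i. to_ac (c i)) m = to_ac (cmon c m)" for c :: "'n \<Rightarrow> 'k" and m
    by (simp add: cmon_def to_ac_prod)
  have act: "ac.tor (\<lambda>i. to_ac (c i)) (iota a) = iota (tor c a)" if "a \<in> C" for c a
    by (rule ac.co_eqI) (simp_all add: that ac.tor_closed iota_closed tor_closed ac.co_tor co_iota co_tor cm)
  show ?thesis
  proof (intro equalityI subsetI)
    fix g assume "g \<in> ?K"
    then obtain h where g: "g \<in> ac.G" and h: "h \<in> T"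
      and gh: "\<And>a. a \<in> C \<Longrightarrow> g (iota a) = iota (h a)" by auto
    obtain c where c: "h = tor c" "\<And>i. c i \<noteq> 0" using h by (rule torE) simp
    have "g = ac.tor (\<lambda>i. to_ac (c i))"
    proof (rule ac.GL_eqI[OF g])
      show "ac.tor (\<lambda>i. to_ac (c i)) \<in> ac.G"
        using c by (intro ac.tor_GL) simp
      show "g x = ac.tor (\<lambda>i. to_ac (c i)) x" if "x \<in> ac.C" for x
        by (rule iota_determines[OF ac.GL_linear[OF g] ac.tor_linear _ that]) (simp add: gh act c(1))
    qed
    then show "g \<in> ?R" using c(2) by (intro CollectI exI[of _ c]) simp
  next
    fix g assume "g \<in> ?R"
    then obtain c where c: "g = ac.tor (\<lambda>i. to_ac (c i))" "\<forall>i. c i \<noteq> 0" by (elim CollectE exE conjE)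
    show "g \<in> ?K"
    proof (intro CollectI conjI bexI[of _ "tor c"] ballI)
      show "g \<in> ac.G" using c by (simp add: ac.tor_GL)
      show "tor c \<in> T" using c(2) by (intro torI) simp
      show "g (iota a) = iota (tor c a)" if "a \<in> C" for a using act[OF that] c(1) by simp
    qed
  qed
qed

text \<open>Density of the points over \<open>k\<close>: the coordinates are moved from \<open>k\<close> to its algebraic closure one at a time. A
regular function that vanishes for infinitely many values of a coordinate is a rational function of that
coordinate with zero numerator.\<close>

lemma base_change_T: "base_change I T = torus_image (ideal_ac I)"
proof (rule antisym)
  let ?R = "{ac.tor (\<lambda>i. to_ac (c i)) |c. \<forall>i. c i \<noteq> 0}"
  show "base_change I T \<subseteq> torus_image (ideal_ac I)"
    unfolding base_change_eq base_change_tor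
  proof (rule closure_of_minimal[OF _ ac.T_closed], rule subsetI)
    fix g assume "g \<in> ?R"
    then obtain c where "g = ac.tor (\<lambda>i. to_ac (c i))" "\<forall>i. c i \<noteq> 0" by (elim CollectE exE conjE)
    then show "g \<in> torus_image (ideal_ac I)" by (simp add: ac.torI)
  qed
  let ?B = "zariski ac.A closure_of ?R"
  have RB: "?R \<subseteq> ?B"
  proof (rule closure_of_subset, rule subsetI)
    fix g assume "g \<in> ?R"
    then obtain c where "g = ac.tor (\<lambda>i. to_ac (c i))" "\<forall>i. c i \<noteq> 0" by (elim CollectE exE conjE)
    then show "g \<in> topspace (zariski ac.A)" by (simp add: ac.tor_GL ac.topspace_zariski)
  qed
  have "ac.tor c \<in> ?B"
    if "finite F" "\<And>i. c i \<noteq> 0" "\<And>i. i \<notin> F \<Longrightarrow> c i \<in> range to_ac" for F c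
    using that
  proof (induction F arbitrary: c rule: finite_induct)
    case empty
    then have "\<forall>i. \<exists>d. c i = to_ac d" by (simp add: image_iff)
    then obtain d where d: "\<forall>i. c i = to_ac (d i)" by metis
    have "d i \<noteq> 0" for i using empty.prems(1)[of i] d by (metis to_ac_0)
    moreover have "c = (\<lambda>i. to_ac (d i))" using d by (intro ext) simp
    ultimately have "ac.tor c \<in> ?R" by (intro CollectI exI[of _ d]) simp
    then show ?case using RB by (rule subsetD[rotated])
  next
    case (insert j F)
    show ?case
    proof (rule ccontr)
      assume n: "ac.tor c \<notin> ?B"
      have cG: "ac.tor c \<in> ac.G" using insert.prems(1) by (rule ac.tor_GL)
      have "closedin (zariski ac.A) ?B" by (rule closedin_closure_of)
      then obtain f where f: "f \<in> regular_fun ac.A" "f (ac.tor c) \<noteq> 0" "\<forall>x\<in>?B. f x = 0"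
        unfolding ac.closedin_zariski using n cG by (metis (no_types, lifting) DiffI)
      let ?c1 = "c(j := 1)"
      have c1: "?c1 i \<noteq> 0" for i using insert.prems(1) by simp
      have u: "((\<lambda>_. 1)(j := s)) i \<noteq> 0" if "s \<noteq> 0" for s :: "'k alg_closure" and i using that by simp
      have split: "ac.tor ?c1 \<otimes>\<^bsub>GL ac.A\<^esub> ac.tor ((\<lambda>_. 1)(j := s)) = ac.tor (c(j := s))"
        if "s \<noteq> 0" for s
      proof -
        have "(\<lambda>i. ?c1 i * ((\<lambda>_. 1)(j := s)) i) = c(j := s)" by (rule ext) simp
        then show ?thesis using ac.tor_mult[of ?c1 "(\<lambda>_. 1)(j := s)", OF c1 u[OF that]] by simp
      qed
      obtain f' where f': "f' \<in> regular_fun ac.A"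
        "\<forall>g\<in>ac.G. f' g = f (ac.tor ?c1 \<otimes>\<^bsub>GL ac.A\<^esub> g)"
        using ac.regular_left_translate[OF ac.tor_GL[of ?c1, OF c1] f(1)] by (elim bexE)
      have f'eq: "f' (ac.tor ((\<lambda>_. 1)(j := s))) = f (ac.tor (c(j := s)))" if "s \<noteq> 0" for s
      proof -
        have "ac.tor ((\<lambda>_. 1)(j := s)) \<in> ac.G"
          using u[OF that] by (rule ac.tor_GL)
        then show ?thesis using f'(2) split[OF that] by simp
      qed
      obtain p q where pq': "\<forall>s\<in>- {0}. poly q s \<noteq> 0 \<and>
          poly q s * f' (ac.tor ((\<lambda>_. 1)(j := s))) = poly p s"
        using ac.torus_curve_rational[OF f'(1), of j] unfolding ac.rational_on_def by (elim exE)
      have pq: "poly q s \<noteq> 0" "poly q s * f (ac.tor (c(j := s))) = poly p s" if "s \<noteq> 0" for s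
        using bspec[OF pq', of s] that f'eq[OF that] by (simp_all only: Compl_iff singleton_iff not_False_eq_True simp_thms)
      have "poly p (to_ac s) = 0" if s: "s \<noteq> 0" for s
      proof -
        have "ac.tor (c(j := to_ac s)) \<in> ?B"
          using insert.prems s by (intro insert.IH) auto
        then have "f (ac.tor (c(j := to_ac s))) = 0" using f(3) by (rule bspec[rotated])
        then show ?thesis using pq(2)[of "to_ac s"] s by simp
      qed
      then have "to_ac ` (- {0}) \<subseteq> {s. poly p s = 0}" by (intro image_subsetI) simp
      moreover have "infinite (to_ac ` (- {0 :: 'k}))"
      proof -
        have "infinite (- {0 :: 'k})" using infinite_UNIV_char_0[where ?'a = 'k] finite_compl[of "{0 :: 'k}"] by simp
        then show ?thesis using finite_imageD[OF _ inj_on_subset[OF inj_to_ac subset_UNIV]] by metis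
      qed
      ultimately have "infinite {s. poly p s = 0}" by (metis finite_subset)
      then have "p = 0" using poly_roots_finite[of p] by (cases "p = 0") simp_all
      then have "f (ac.tor c) = 0" using pq[of "c j"] insert.prems(1)[of j] by simp
      then show False using f(2) by simp
    qed
  qed
  from this[of UNIV] have tB: "ac.tor c \<in> ?B" if "\<And>i. c i \<noteq> 0" for c using that by simp
  show "torus_image (ideal_ac I) \<subseteq> base_change I T"
    unfolding base_change_eq base_change_tor
  proof
    fix g assume "g \<in> torus_image (ideal_ac I)"
    then obtain c where "g = ac.tor c" "\<And>i. c i \<noteq> 0" by (rule ac.torE) simp
    then show "g \<in> ?B" using tB by simp
  qed
qed

section \<open>Maximality of the torus\<close>

lemma T_is_torus: "is_torus I T"
  unfolding is_torus_def linear_algebraic_def base_change_T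
  by (intro conjI subgroup_T T_closed alg_group_iso_rank[OF ac.torus_alg_group_iso])

text \<open>An automorphism commuting with \<open>T\<close> maps \<open>x\<^sub>i\<close> to an eigenvector with the same character. The value \<open>2\<close> of a single
coordinate is enough to separate \<open>e\<^sub>i\<close> from any other exponent, as powers of \<open>2\<close> are distinct in characteristic zero.\<close>

lemma T_maximal:
  assumes t: "is_torus I H" and H: "H \<subseteq> carrier (Aut A)" and TH: "T \<subseteq> H"
  shows "H = T"
proof (rule antisym[OF _ TH], rule subsetI)
  fix g assume g: "g \<in> H"
  then have gA: "g \<in> carrier (Aut A)" using H by (rule subsetD[rotated])
  have HG: "H \<subseteq> G" using H subgroup.subset[OF subgroup_Aut] by (rule subset_trans)
  show "g \<in> T"
  proof (rule Aut_diag_in_T[OF gA], rule ccontr)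
    fix i m assume m: "m \<notin> S" "m \<noteq> X1 i" and n: "co m (g (xg i)) \<noteq> 0"
    have "\<exists>j. lk m j \<noteq> lk (X1 i) j"
    proof (rule ccontr)
      assume "\<nexists>j. lk m j \<noteq> lk (X1 i) j"
      then have "m = X1 i" by (intro poly_mapping_eqI) simp
      then show False using m(2) by simp
    qed
    then obtain j where j: "lk m j \<noteq> lk (X1 i) j" by (elim exE)
    let ?c = "(\<lambda>_. 1 :: 'k)(j := 2)"
    have "tor ?c \<in> T" by (rule torI) simp
    then have cH: "tor ?c \<in> H" using TH by (rule subsetD[rotated])
    have "tor ?c (g (xg i)) = g (tor ?c (xg i))"
      by (rule torus_comm[OF t HG cH g e_closed])
    also have "\<dots> = cmon ?c (X1 i) \<odot>\<^bsub>A\<^esub> g (xg i)"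
      using GL_linear[OF Aut_GL[OF gA]] by (simp add: tor_e linear_endo_def)
    finally have "co m (tor ?c (g (xg i))) = cmon ?c (X1 i) * co m (g (xg i))"
      by (simp add: GL_closed Aut_GL gA)
    then have "cmon ?c m * co m (g (xg i)) = cmon ?c (X1 i) * co m (g (xg i))"
      by (simp add: co_tor GL_closed Aut_GL gA)
    then have "(2 :: 'k) ^ lk m j = 2 ^ lk (X1 i) j" using n by (simp add: cmon_upd_one)
    then have "of_nat (2 ^ lk m j) = (of_nat (2 ^ lk (X1 i) j) :: 'k)" by simp
    then have "(2 :: nat) ^ lk m j = 2 ^ lk (X1 i) j" by (simp only: of_nat_eq_iff)
    then show False using j by simp
  qed
qed

lemma T_maximal_torus: "maximal_torus I (carrier (Aut A)) T"
  unfolding maximal_torus_def using T_is_torus T_Aut T_maximal by (intro conjI subsetI allI impI) simp_all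

lemma Aut_linear_algebraic: "linear_algebraic A (carrier (Aut A))"
  by (simp add: linear_algebraic_def subgroup_Aut Aut_closed)

end

section \<open>The main theorem\<close>

text \<open>The exponents of a monomial ideal are the sums \<open>m0 + m1\<close> with \<open>m0\<close> among the given generators.\<close>

lemma full_monomial_ideal_artin:
  fixes I :: "('n::finite, 'k::field_char_0) mpoly set"
  assumes "monomial_ideal I" "full I" "finite_dimensional (quot_alg I)"
  shows "artin_quotient_char0 (supp I) I"
proof -
  obtain M where M: "I = genideal mpoly_ring (xmon ` M)" using assms(1) unfolding monomial_ideal_def by blast
  define S where "S = {m0 + m1 |m0 m1. m0 \<in> M}"
  have up: "m + m' \<in> S" if m: "m \<in> S" for m m'
  proof -
    obtain m0 m1 where "m = m0 + m1" "m0 \<in> M" using m unfolding S_def by blast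
    then show ?thesis unfolding S_def by (intro CollectI exI[of _ m0] exI[of _ "m1 + m'"]) (simp add: add.assoc)
  qed
  have MS: "m \<in> S" if "m \<in> M" for m
    unfolding S_def using that by (intro CollectI exI[of _ m] exI[of _ 0]) simp
  have I: "I = {p. ks p \<subseteq> S}" unfolding M
  proof (rule genideal_monomial[OF up])
    show "ks p \<subseteq> S" if "p \<in> xmon ` M" for p :: "('n, 'k) mpoly"
      using that MS by (auto simp: xmon_def)
    show "\<exists>m0 m1. m = m0 + m1 \<and> xmon m0 \<in> xmon ` M" if "m \<in> S" for m
      using that unfolding S_def by blast
  qed
  have supp: "supp I = S" by (auto simp: supp_def I xmon_def)
  interpret monomial_quotient S I by unfold_locales (fact up, fact I)
  show ?thesis unfolding supp
  proof unfold_locales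
    show "finite (- S)" by (rule finite_dimensional_imp_finite[OF assms(3)])
    show "Poly_Mapping.single i 1 \<notin> S" for i using assms(2) by (simp add: full_def supp)
  qed
qed

theorem mainTheorem1:
  fixes I :: "('n::finite, 'k::field_char_0) mpoly set"
  assumes "monomial_ideal I"
    and "full I"
    and "finite_dimensional (quot_alg I)"
  shows
    "let A = quot_alg I;
         G = Aut A;
         T = torus_image I;
         G0 = identity_component A (carrier G)
     in
       linear_algebraic A (carrier G) \<and>
       (alg_group_iso (split_torus (UNIV :: 'n set)) (split_torus_ring UNIV)
          (GL A \<lparr>carrier := T\<rparr>) (coord_ring A T) (torus_action I) \<and>
        maximal_torus I (carrier G) T) \<and>
       G0 = generate G (T \<union> ga_images I) \<and>
       (G0 \<lhd> G \<and> finite (carrier (G Mod G0)) \<and>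
        carrier (G Mod G0) = generate (G Mod G0) ((\<lambda>g. G0 #>\<^bsub>G\<^esub> g) ` semigroup_induced I))"
proof -
  interpret artin_quotient_char0 "supp I" I
    by (rule full_monomial_ideal_artin[OF assms])
  show ?thesis unfolding Let_def
    by (intro conjI[OF Aut_linear_algebraic] conjI[OF conjI[OF torus_alg_group_iso T_maximal_torus]]
        conjI[OF identity_component_eq] component_group)
qed

end
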